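(* Let $T>0$, let $m,n\ge1$ be integers, and let $S,N\in O(m)$ satisfy $S^n=I_m$ and $N^2=(NS)^2=I_m$, acting dihedrally on $T$-periodic functions by $(\mathcal Su)(t)=Su(t+T/n)$ and $(\mathcal Nu)(t)=Nu(T/n-t)$. Let $L=L(t,x,v)$ be a $C^2$ Lagrangian on $\mathbb R\times\mathbb R^m\times\mathbb R^m$ satisfying the Legendre convexity condition and the symmetries $L(t,x,v)=L(t-T/n,Sx,Sv)$ and $L(t,x,v)=L(T/n-t,Nx,Nv)$, and let $x$ be a $D_n$-equivariant $T$-periodic critical point of the action $\int_0^TL(t,x,\dot x)\,dt$. Let $\mathcal A$ be the Sturm operator obtained by linearizing the Euler–Lagrange equation along $x$. If $\mathcal A$ is positive definite on $$E^2(T/(2n))=\{u\in W^{2,2}([0,T/(2n)],\mathbb C^m):\dot u(0)=\dot u(T/(2n))=0\},$$ then $x$ is hyperbolic.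
   Context: Legendre convexity: $\langle D^2_{vv}L(t,q,v)w,w\rangle>0$ for all $t,q,v$ and all $w\in\mathbb R^m\setminus\{0\}$. $D_n$-equivariant means $\mathcal Sx=x$ and $\mathcal Nx=x$. Along $(t,x(t),\dot x(t))$ set $P=\partial^2L/\partial v^2$, $Q=\big(\partial^2L/\partial v_i\partial x_j\big)_{ij}$, $R=\partial^2L/\partial x^2$, and $$\mathcal A\xi=-\frac{d}{dt}\big(P(t)\dot\xi+Q(t)\xi\big)+Q(t)^{\mathsf T}\dot\xi+R(t)\xi.$$ Positive definite on $E^2(T/(2n))$ means $\int_0^{T/(2n)}\langle\mathcal Au,u\rangle\,dt>0$ for all $u\neq0$ in that space. By the Legendre transform, the equation $\mathcal A\xi=0$ reduces to the linear Hamiltonian system $\dot z=JB(t)z$, $t\in[0,T]$, with $J=\begin{bmatrix}0&-I\\ I&0\end{bmatrix}$ and $$B(t)=\begin{bmatrix}P^{-1}&-P^{-1}Q\\-Q^{\mathsf T}P^{-1}&Q^{\mathsf T}P^{-1}Q-R\end{bmatrix}.$$ Let $\gamma$ be its fundamental solution ($\gamma(0)=I$) and $M_T=\gamma(T)$ the monodromy matrix. The orbit $x$ is hyperbolic if $M_T$ has no eigenvalue on the unit circle of $\mathbb C$.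
   Formalization: The reflection symmetry is taken as L(t,x,v)=L(T/n-t,Nx,-Nv) instead of L(T/n-t,Nx,Nv): reversing time flips velocities, and with +Nv the claim is false (e.g. L=|v|²/2+(x1-2cos t)²/2-v1·x2²/8, x=(cos t,0), n=1, T=2π, S=N=I). *)

theory Defs
  imports "HOL-Analysis.Analysis"
begin

type_synonym 'm lagrangian = "real \<Rightarrow> real^'m \<Rightarrow> real^'m \<Rightarrow> real"

definition C2_function :: "('a::real_normed_vector \<Rightarrow> real) \<Rightarrow> bool" where
  "C2_function f \<longleftrightarrow>
     (\<exists>(f' :: 'a \<Rightarrow> 'a \<Rightarrow>\<^sub>L real) (f'' :: 'a \<Rightarrow> 'a \<Rightarrow>\<^sub>L ('a \<Rightarrow>\<^sub>L real)).
        (\<forall>z. (f has_derivative blinfun_apply (f' z)) (at z)) \<and>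
        (\<forall>z. (f' has_derivative blinfun_apply (f'' z)) (at z)) \<and>
        continuous_on UNIV f'')"

definition C2_lagrangian :: "('m::finite) lagrangian \<Rightarrow> bool" where
  "C2_lagrangian L \<longleftrightarrow> C2_function (\<lambda>(t, x, v). L t x v)"

definition partial :: "(real^'m \<Rightarrow> real) \<Rightarrow> 'm::finite \<Rightarrow> real^'m \<Rightarrow> real" where
  "partial f i z = frechet_derivative f (at z) (axis i 1)"

definition L_vv :: "('m::finite) lagrangian \<Rightarrow> real \<Rightarrow> real^'m \<Rightarrow> real^'m \<Rightarrow> real^'m^'m" where
  "L_vv L t x v = (\<chi> i j. partial (\<lambda>w. partial (\<lambda>w'. L t x w') j w) i v)"

definition L_vx :: "('m::finite) lagrangian \<Rightarrow> real \<Rightarrow> real^'m \<Rightarrow> real^'m \<Rightarrow> real^'m^'m" where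
  "L_vx L t x v = (\<chi> i j. partial (\<lambda>w. partial (\<lambda>y. L t y w) j x) i v)"

definition L_xx :: "('m::finite) lagrangian \<Rightarrow> real \<Rightarrow> real^'m \<Rightarrow> real^'m \<Rightarrow> real^'m^'m" where
  "L_xx L t x v = (\<chi> i j. partial (\<lambda>y. partial (\<lambda>y'. L t y' v) j y) i x)"

definition legendre_convex :: "('m::finite) lagrangian \<Rightarrow> bool" where
  "legendre_convex L \<longleftrightarrow> (\<forall>t q v w. w \<noteq> 0 \<longrightarrow> (L_vv L t q v *v w) \<bullet> w > 0)"

text \<open>The product \<open>*\<close> (hence \<open>^\<close>) on \<^typ>\<open>real^'m^'m\<close> is componentwise, so powers
  are iterates of \<open>**\<close>.\<close>

definition dihedral_matrices :: "nat \<Rightarrow> real^'m^'m \<Rightarrow> real^'m^'m::finite \<Rightarrow> bool" where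
  "dihedral_matrices n S N \<longleftrightarrow>
     orthogonal_matrix S \<and> orthogonal_matrix N \<and>
     (((**) S) ^^ n) (mat 1) = mat 1 \<and> N ** N = mat 1 \<and> (N ** S) ** (N ** S) = mat 1"

definition act_S :: "real \<Rightarrow> nat \<Rightarrow> real^'m^'m \<Rightarrow> (real \<Rightarrow> real^'m) \<Rightarrow> (real \<Rightarrow> real^'m::finite)" where
  "act_S T n S u = (\<lambda>t. S *v u (t + T / real n))"

definition act_N :: "real \<Rightarrow> nat \<Rightarrow> real^'m^'m \<Rightarrow> (real \<Rightarrow> real^'m) \<Rightarrow> (real \<Rightarrow> real^'m::finite)" where
  "act_N T n N u = (\<lambda>t. N *v u (T / real n - t))"

definition equivariant ::
    "real \<Rightarrow> nat \<Rightarrow> real^'m^'m \<Rightarrow> real^'m^'m \<Rightarrow> (real \<Rightarrow> real^'m::finite) \<Rightarrow> bool" where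
  "equivariant T n S N x \<longleftrightarrow> act_S T n S x = x \<and> act_N T n N x = x"

text \<open>Invariance of the Lagrangian under the action on curves. The reflection reverses time:
  the velocity of \<open>act_N T n N u\<close> at \<open>t\<close> is \<open>- N u'(T/n - t)\<close>, so \<open>N\<close> acts on velocities with a
  minus sign. This sign cannot be dropped: with \<open>L t x v = L (T/n - t) (N x) (N v)\<close> the action
  functional is not invariant under \<open>act_N\<close>, and positivity on half of the fundamental interval
  says nothing about the other half. For example, for \<open>n = 1\<close>, \<open>T = 2\<pi>\<close>, \<open>S = N = I\<close>,
  \<open>L = (v1^2 + v2^2)/2 + (x1 - 2 cos t)^2/2 - v1 x2^2/8\<close> and the orbit \<open>(cos t, 0)\<close>, the Sturm
  operator is \<open>(-u1'' + u1, -u2'' + (sin t / 4) u2)\<close>. It is positive on \<open>[0, \<pi>]\<close>, while the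
  second equation is a Mathieu equation inside its first stability zone.\<close>

definition lagrangian_symmetric ::
    "real \<Rightarrow> nat \<Rightarrow> real^'m^'m \<Rightarrow> real^'m^'m \<Rightarrow> ('m::finite) lagrangian \<Rightarrow> bool" where
  "lagrangian_symmetric T n S N L \<longleftrightarrow>
     (\<forall>t x v. L t x v = L (t - T / real n) (S *v x) (S *v v)) \<and>
     (\<forall>t x v. L t x v = L (T / real n - t) (N *v x) (- (N *v v)))"

definition periodic_C1 :: "real \<Rightarrow> (real \<Rightarrow> real^'m::finite) \<Rightarrow> bool" where
  "periodic_C1 T x \<longleftrightarrow> x C1_differentiable_on UNIV \<and> (\<forall>t. x (t + T) = x t)"

definition action :: "('m::finite) lagrangian \<Rightarrow> real \<Rightarrow> (real \<Rightarrow> real^'m) \<Rightarrow> real" where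
  "action L T x = integral {0..T} (\<lambda>t. L t (x t) (vector_derivative x (at t)))"

definition critical_point :: "('m::finite) lagrangian \<Rightarrow> real \<Rightarrow> (real \<Rightarrow> real^'m) \<Rightarrow> bool" where
  "critical_point L T x \<longleftrightarrow> periodic_C1 T x \<and>
     (\<forall>\<phi>. periodic_C1 T \<phi> \<longrightarrow>
        ((\<lambda>s. action L T (\<lambda>t. x t + s *\<^sub>R \<phi> t)) has_real_derivative 0) (at 0))"

definition P_along :: "('m::finite) lagrangian \<Rightarrow> (real \<Rightarrow> real^'m) \<Rightarrow> real \<Rightarrow> real^'m^'m" where
  "P_along L x t = L_vv L t (x t) (vector_derivative x (at t))"

definition Q_along :: "('m::finite) lagrangian \<Rightarrow> (real \<Rightarrow> real^'m) \<Rightarrow> real \<Rightarrow> real^'m^'m" where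
  "Q_along L x t = L_vx L t (x t) (vector_derivative x (at t))"

definition R_along :: "('m::finite) lagrangian \<Rightarrow> (real \<Rightarrow> real^'m) \<Rightarrow> real \<Rightarrow> real^'m^'m" where
  "R_along L x t = L_xx L t (x t) (vector_derivative x (at t))"

text \<open>\<open>has_L2_derivative h u g\<close>: the (continuous representative) \<open>u\<close> lies in \<open>W\<^sup>1\<^sup>,\<^sup>2([0,h])\<close>
  and has weak derivative \<open>g\<close>.\<close>

definition has_L2_derivative ::
    "real \<Rightarrow> (real \<Rightarrow> complex^'m::finite) \<Rightarrow> (real \<Rightarrow> complex^'m) \<Rightarrow> bool" where
  "has_L2_derivative h u g \<longleftrightarrow>
     set_integrable lebesgue {0..h} g \<and>
     set_integrable lebesgue {0..h} (\<lambda>t. (norm (g t))\<^sup>2) \<and>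
     (\<forall>t\<in>{0..h}. u t = u 0 + (LINT s:{0..t}|lebesgue. g s))"

definition deriv_on :: "real \<Rightarrow> (real \<Rightarrow> complex^'m::finite) \<Rightarrow> real \<Rightarrow> complex^'m" where
  "deriv_on h u t = vector_derivative u (at t within {0..h})"

text \<open>Elements of \<open>W\<^sup>2\<^sup>,\<^sup>2([0,h])\<close> are represented by their \<open>C\<^sup>1\<close> representatives; values outside
  \<open>[0,h]\<close> are irrelevant.\<close>

definition W22 :: "real \<Rightarrow> (real \<Rightarrow> complex^'m::finite) set" where
  "W22 h = {u. has_L2_derivative h u (deriv_on h u) \<and>
               (\<exists>g. has_L2_derivative h (deriv_on h u) g)}"

definition E2 :: "real \<Rightarrow> (real \<Rightarrow> complex^'m::finite) set" where
  "E2 h = {u \<in> W22 h. deriv_on h u 0 = 0 \<and> deriv_on h u h = 0}"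

abbreviation cmat :: "real^'n^'k \<Rightarrow> complex^'n^'k" where
  "cmat A \<equiv> map_matrix complex_of_real A"

definition hermitian_inner :: "complex^'m \<Rightarrow> complex^'m::finite \<Rightarrow> complex" where
  "hermitian_inner a b = (\<Sum>i\<in>UNIV. a $ i * cnj (b $ i))"

text \<open>\<open>sturm h P Q R u w\<close>: \<open>w\<close> is (a representative of) the element
  \<open>- (P u' + Q u)' + Q\<^sup>T u' + R u\<close> of \<open>L\<^sup>2([0,h])\<close>, where the outer derivative is the weak one.\<close>

definition sturm ::
    "real \<Rightarrow> (real \<Rightarrow> real^'m^'m) \<Rightarrow> (real \<Rightarrow> real^'m^'m) \<Rightarrow> (real \<Rightarrow> real^'m^'m) \<Rightarrow>
     (real \<Rightarrow> complex^'m::finite) \<Rightarrow> (real \<Rightarrow> complex^'m) \<Rightarrow> bool" where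
  "sturm h P Q R u w \<longleftrightarrow>
     (\<exists>g. has_L2_derivative h (\<lambda>t. cmat (P t) *v deriv_on h u t + cmat (Q t) *v u t) g \<and>
          (\<forall>t\<in>{0..h}. w t = - g t + cmat (transpose (Q t)) *v deriv_on h u t + cmat (R t) *v u t))"

text \<open>Positivity includes that the operator is defined on all of \<open>E\<^sup>2(h)\<close>; the complex number
  \<open>\<integral>\<langle>\<A>u,u\<rangle>\<close> is required to be real and positive. Asking only for a positive real part would
  not do: \<open>E\<^sup>2(h)\<close> prescribes \<open>u' = 0\<close>, not the natural condition \<open>P u' + Q u = 0\<close>, and it is the
  reality of the integral that makes \<open>Q\<close> symmetric at the two endpoints.\<close>

definition sturm_positive_definite ::
    "real \<Rightarrow> (real \<Rightarrow> real^'m^'m) \<Rightarrow> (real \<Rightarrow> real^'m^'m) \<Rightarrow> (real \<Rightarrow> real^'m^'m::finite) \<Rightarrow> bool" where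
  "sturm_positive_definite h P Q R \<longleftrightarrow>
     (\<forall>u\<in>E2 h. (\<exists>t\<in>{0..h}. u t \<noteq> 0) \<longrightarrow>
        (\<exists>w. sturm h P Q R u w \<and>
             (LINT t:{0..h}|lebesgue. hermitian_inner (w t) (u t)) \<in> \<real> \<and>
             0 < Re (LINT t:{0..h}|lebesgue. hermitian_inner (w t) (u t))))"

definition block_matrix ::
    "'a^'m^'m \<Rightarrow> 'a^'m^'m \<Rightarrow> 'a^'m^'m \<Rightarrow> 'a^'m^'m \<Rightarrow> 'a^('m + 'm)^('m::finite + 'm)" where
  "block_matrix A B C D = (\<chi> i j.
     case i of
       Inl a \<Rightarrow> (case j of Inl b \<Rightarrow> A $ a $ b | Inr b \<Rightarrow> B $ a $ b)
     | Inr a \<Rightarrow> (case j of Inl b \<Rightarrow> C $ a $ b | Inr b \<Rightarrow> D $ a $ b))"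

definition symp_J :: "real^('m + 'm)^('m::finite + 'm)" where
  "symp_J = block_matrix 0 (- mat 1) (mat 1) 0"

definition hamiltonian_B ::
    "real^'m^'m \<Rightarrow> real^'m^'m \<Rightarrow> real^'m^'m \<Rightarrow> real^('m + 'm)^('m::finite + 'm)" where
  "hamiltonian_B P Q R = block_matrix
     (matrix_inv P) (- (matrix_inv P ** Q))
     (- (transpose Q ** matrix_inv P)) (transpose Q ** matrix_inv P ** Q - R)"

definition fundamental_solution ::
    "real \<Rightarrow> (real \<Rightarrow> real^'k^'k) \<Rightarrow> (real \<Rightarrow> real^'k^'k::finite) \<Rightarrow> bool" where
  "fundamental_solution T A \<gamma> \<longleftrightarrow> \<gamma> 0 = mat 1 \<and>
     (\<forall>t\<in>{0..T}. (\<gamma> has_vector_derivative (A t ** \<gamma> t)) (at t within {0..T}))"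

definition complex_eigenvalue :: "real^'k^'k::finite \<Rightarrow> complex \<Rightarrow> bool" where
  "complex_eigenvalue M \<omega> \<longleftrightarrow> (\<exists>z. z \<noteq> 0 \<and> cmat M *v z = \<omega> *s z)"

definition hyperbolic_monodromy :: "real^'k^'k::finite \<Rightarrow> bool" where
  "hyperbolic_monodromy M \<longleftrightarrow> \<not> (\<exists>\<omega>. norm \<omega> = 1 \<and> complex_eigenvalue M \<omega>)"

definition linearized_system ::
    "('m::finite) lagrangian \<Rightarrow> (real \<Rightarrow> real^'m) \<Rightarrow> real \<Rightarrow> real^('m + 'm)^('m + 'm)" where
  "linearized_system L x t =
     symp_J ** hamiltonian_B (P_along L x t) (Q_along L x t) (R_along L x t)"

end

theory Submission
  imports Defs
begin

text \<open>
  Suppose that the monodromy matrix has an eigenvector \<open>a + i b\<close> (\<open>a\<close>, \<open>b\<close> real) for an eigenvalue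
  \<open>\<omega>\<close> with \<open>|\<omega>| = 1\<close>. Starting the Hamiltonian flow at \<open>a\<close> and at \<open>b\<close> gives two real solutions of
  \<open>\<A> \<xi> = 0\<close> on \<open>[0,T]\<close>. Everything rests on the energy of a real \<open>C\<^sup>1\<close> path \<open>u\<close> on \<open>[\<alpha>,\<beta>]\<close>,
  the integral of \<open>\<langle>P u', u'\<rangle> + 2 \<langle>Q u, u'\<rangle> + \<langle>R u, u\<rangle>\<close> minus the increment of \<open>\<langle>Q u, u\<rangle>\<close> from
  \<open>\<alpha>\<close> to \<open>\<beta>\<close>. Write \<open>h = T/(2n)\<close>.

  \<^item> The energy of a solution is a boundary term. Because \<open>|\<omega>| = 1\<close> and \<open>Q T = Q 0\<close>, the energies of
    the two solutions over \<open>[0,T]\<close> add up to zero (\<open>energy_solution\<close>, \<open>sum_of_rotated_forms\<close>).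

  \<^item> For \<open>u\<close> in \<open>E\<^sup>2(h)\<close> an integration by parts turns \<open>\<integral>\<langle>\<A>u, u\<rangle>\<close> into the energy over \<open>[0,h]\<close>,
    which is therefore positive if \<open>u \<noteq> 0\<close> (\<open>energy_pos_of_sturm_positive_definite\<close>). Such paths
    are dense, so the energy is nonnegative on all \<open>C\<^sup>1\<close> paths (\<open>energy_nonneg\<close>).

  \<^item> The boundary term in the energy is the one that makes it invariant: under the reflection \<open>Q\<close>
    changes sign, but so does the orientation of the interval. Hence \<open>[0,T]\<close> splits into \<open>2n\<close> copies
    of \<open>[0,h]\<close>, each carrying nonnegative energy, and the energy over \<open>[0,h]\<close> is at most that over
    \<open>[0,T]\<close> (\<open>energy_nonneg_fundamental_domain\<close>). So both solutions have energy zero on \<open>[0,h]\<close>.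

  \<^item> A solution of energy zero minimizes the energy, so it satisfies the natural boundary condition.
    The matrices \<open>Q 0\<close> and \<open>Q h\<close> are symmetric, because \<open>\<integral>\<langle>\<A>u, u\<rangle>\<close> is real for complex \<open>u\<close>, and then
    that condition reads \<open>u' = 0\<close> at both ends (\<open>hermitian_coefficient_symmetric_at_ends\<close>,
    \<open>minimizer_natural_boundary_condition\<close>). If \<open>u\<close> lies in \<open>W\<^sup>2\<^sup>,\<^sup>2\<close>, it is therefore in \<open>E\<^sup>2(h)\<close>, strict
    positivity gives \<open>u = 0\<close> on \<open>[0,h]\<close>, and the eigenvector vanishes.

  What is left is the regularity of \<open>u\<close>. As \<open>L\<close> is only \<open>C\<^sup>2\<close>, the coefficient \<open>P\<close> is only continuous,
  and weak differentiability of \<open>u' = P\<^sup>-\<^sup>1 y\<close>, with \<open>y = P u'\<close> weakly differentiable, is not automatic.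
  It comes from the assumption that \<open>\<A>\<close> is defined on all of \<open>E\<^sup>2(h)\<close>: this makes \<open>P f\<close> weakly
  differentiable for every weakly differentiable \<open>f\<close> vanishing at both ends
  (\<open>sturm_domain_coefficients\<close>), in particular when \<open>f\<close> is a component of \<open>y\<close>, and an argument with increments
  transfers this to \<open>P\<^sup>-\<^sup>1 y\<close> (\<open>has_weak_deriv_of_linear_system\<close>).
\<close>

section \<open>Weakly differentiable functions on an interval\<close>

definition sq_integrable :: "real \<Rightarrow> (real \<Rightarrow> complex) \<Rightarrow> bool" where
  "sq_integrable h g \<longleftrightarrow> g absolutely_integrable_on {0..h} \<and>
     (\<lambda>t. (norm (g t))\<^sup>2) absolutely_integrable_on {0..h}"

text \<open>The scalar version of the space \<open>W\<^sup>1\<^sup>,\<^sup>2([0,h])\<close>. The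
  primitive is written with the gauge integral and solved for the integral, so that the
  equation is a terminating rewrite rule.\<close>

definition has_weak_deriv :: "real \<Rightarrow> (real \<Rightarrow> complex) \<Rightarrow> (real \<Rightarrow> complex) \<Rightarrow> bool" where
  "has_weak_deriv h f g \<longleftrightarrow> sq_integrable h g \<and> (\<forall>t\<in>{0..h}. integral {0..t} g = f t - f 0)"

lemma sq_integrable_bound:
  assumes f: "f absolutely_integrable_on {0..h}" and g: "sq_integrable h g" and g': "sq_integrable h g'"
    and bnd: "\<And>t. t \<in> {0..h} \<Longrightarrow> norm (f t) \<le> C * norm (g t) + C' * norm (g' t)"
  shows "sq_integrable h f"
  unfolding sq_integrable_def
proof
  show "(\<lambda>t. (norm (f t))\<^sup>2) absolutely_integrable_on {0..h}"
  proof (rule measurable_bounded_by_integrable_imp_absolutely_integrable)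
    show "(\<lambda>t. (norm (f t))\<^sup>2) \<in> borel_measurable (lebesgue_on {0..h})"
      using absolutely_integrable_imp_borel_measurable[OF f] by (intro borel_measurable_power borel_measurable_norm) auto
    show "(\<lambda>t. 2 * C\<^sup>2 * (norm (g t))\<^sup>2 + 2 * C'\<^sup>2 * (norm (g' t))\<^sup>2) integrable_on {0..h}"
      using g g' unfolding sq_integrable_def
      by (intro integrable_add integrable_on_mult_right) (auto simp: absolutely_integrable_on_def)
    fix t assume t: "t \<in> {0..h}"
    have "(norm (f t))\<^sup>2 \<le> (C * norm (g t) + C' * norm (g' t))\<^sup>2"
      using bnd[OF t] by (intro power_mono) auto
    also have "\<dots> \<le> 2 * (C * norm (g t))\<^sup>2 + 2 * (C' * norm (g' t))\<^sup>2"
      using sum_squares_ge_zero[of "C * norm (g t) - C' * norm (g' t)" 0]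
      by (simp add: power2_eq_square algebra_simps)
    finally show "norm ((norm (f t))\<^sup>2) \<le> 2 * C\<^sup>2 * (norm (g t))\<^sup>2 + 2 * C'\<^sup>2 * (norm (g' t))\<^sup>2"
      by (simp add: power_mult_distrib)
  qed (rule sets_completionI_sets, simp)
qed (rule f)

lemma sq_integrable_add:
  assumes "sq_integrable h f" "sq_integrable h g"
  shows "sq_integrable h (\<lambda>t. f t + g t)"
  by (rule sq_integrable_bound[OF _ assms, where C=1 and C'=1])
     (use assms in \<open>auto simp: sq_integrable_def norm_triangle_ineq\<close>)

lemma absolutely_integrable_continuous_mult:
  fixes g :: "real \<Rightarrow> complex"
  assumes c: "continuous_on {0..h} c" and g: "g absolutely_integrable_on {0..h}"
  shows "(\<lambda>t. c t * g t) absolutely_integrable_on {0..h}"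
proof (rule absolutely_integrable_bounded_measurable_product[where h="(*)", OF _ _ _ _ g])
  show "bilinear ((*) :: complex \<Rightarrow> complex \<Rightarrow> complex)"
    by (simp add: bilinear_conv_bounded_bilinear bounded_bilinear_mult)
  show "c \<in> borel_measurable (lebesgue_on {0..h})"
    by (rule continuous_imp_measurable_on_sets_lebesgue[OF c]) auto
  show "bounded (c ` {0..h})"
    by (rule compact_imp_bounded[OF compact_continuous_image[OF c]]) auto
qed auto

lemma continuous_on_Icc_bound:
  fixes c :: "real \<Rightarrow> 'a::real_normed_vector"
  assumes c: "continuous_on {a..b} c"
  obtains C where "C \<ge> 0" "\<And>t. t \<in> {a..b} \<Longrightarrow> norm (c t) \<le> C"
proof -
  have "bounded (c ` {a..b})"
    by (rule compact_imp_bounded[OF compact_continuous_image[OF c]]) auto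
  then obtain C where "C > 0" "\<forall>y\<in>c ` {a..b}. norm y \<le> C"
    unfolding bounded_pos by blast
  then show ?thesis by (intro that[of C]) auto
qed

lemma sq_integrable_continuous_mult:
  assumes c: "continuous_on {0..h} c" and g: "sq_integrable h g"
  shows "sq_integrable h (\<lambda>t. c t * g t)"
proof -
  obtain C where C: "\<And>t. t \<in> {0..h} \<Longrightarrow> norm (c t) \<le> C"
    using continuous_on_Icc_bound[OF c] by metis
  show ?thesis
    by (rule sq_integrable_bound[OF _ g g, where C=C and C'=0])
       (use g C absolutely_integrable_continuous_mult[OF c] in
         \<open>auto simp: sq_integrable_def norm_mult mult_right_mono\<close>)
qed

lemma sq_integrable_continuous:
  assumes "continuous_on {0..h} c"
  shows "sq_integrable h c"
  unfolding sq_integrable_def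
  by (intro conjI absolutely_integrable_continuous_real continuous_intros assms)

text \<open>A two-point function \<open>\<Delta> s t\<close> has density \<open>g\<close> if it agrees
  with \<open>\<integral> g\<close> over \<open>[s,t]\<close> up to \<open>e \<integral>
  k\<close> as soon as \<open>t - s\<close> is small, for a fixed integrable \<open>k\<close>.
  Such expressions may be added and multiplied by continuous functions of
  \<open>(s,t)\<close>, and the density of the increments of a function is its weak
  derivative. So \<open>f\<close> is differentiated by writing its increments in terms of
  increments of weakly differentiable functions with continuous coefficients.\<close>

definition increment_density :: "real \<Rightarrow> (real \<Rightarrow> real \<Rightarrow> complex) \<Rightarrow> (real \<Rightarrow> complex) \<Rightarrow> bool" where
  "increment_density h \<Delta> g \<longleftrightarrow> sq_integrable h g \<and>
     (\<exists>k. k integrable_on {0..h} \<and> (\<forall>t\<in>{0..h}. k t \<ge> 0) \<and>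
        (\<forall>e>0. \<exists>d>0. \<forall>s t. 0 \<le> s \<longrightarrow> s \<le> t \<longrightarrow> t \<le> h \<longrightarrow> t - s < d \<longrightarrow>
            norm (\<Delta> s t - integral {s..t} g) \<le> e * integral {s..t} k))"

lemma increment_densityE:
  assumes "increment_density h D g"
  obtains k where "sq_integrable h g" "k integrable_on {0..h}" "\<And>t. t\<in>{0..h} \<Longrightarrow> k t \<ge> 0"
      "\<And>e. e > 0 \<Longrightarrow> \<exists>d>0. \<forall>s t. 0 \<le> s \<longrightarrow> s \<le> t \<longrightarrow> t \<le> h \<longrightarrow> t - s < d \<longrightarrow>
            norm (D s t - integral {s..t} g) \<le> e * integral {s..t} k"
  using assms unfolding increment_density_def by (elim conjE exE) (rule that, auto)

lemma integrable_on_Icc_sub: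
  fixes g :: "real \<Rightarrow> 'a::banach"
  assumes "g integrable_on {0..h}" "0 \<le> s" "t \<le> h"
  shows "g integrable_on {s..t}"
  using assms by (auto intro: integrable_on_subinterval)

lemma integral_Icc_diff:
  fixes g :: "real \<Rightarrow> 'a::banach"
  assumes "g integrable_on {0..h}" "0 \<le> s" "s \<le> t" "t \<le> h"
  shows "integral {s..t} g = integral {0..t} g - integral {0..s} g"
proof -
  have "integral {0..s} g + integral {s..t} g = integral {0..t} g"
    using assms by (intro Henstock_Kurzweil_Integration.integral_combine integrable_on_Icc_sub[OF assms(1)]) auto
  then show ?thesis by (simp add: algebra_simps)
qed

lemma has_weak_deriv_increment_density:
  assumes "has_weak_deriv h f g"
  shows "increment_density h (\<lambda>s t. f t - f s) g"
proof -
  have g: "g integrable_on {0..h}" and sq: "sq_integrable h g"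
    and f: "\<And>t. t \<in> {0..h} \<Longrightarrow> integral {0..t} g = f t - f 0"
    using assms by (auto simp: has_weak_deriv_def sq_integrable_def absolutely_integrable_on_def)
  have "f t - f s - integral {s..t} g = 0" if "0 \<le> s" "s \<le> t" "t \<le> h" for s t
    using f[of s] f[of t] integral_Icc_diff[OF g that] that by simp
  then show ?thesis
    unfolding increment_density_def
    by (intro conjI sq exI[of _ "\<lambda>_. 0"] allI impI exI[of _ 1]) auto
qed

lemma increment_density_add:
  assumes "increment_density h D g" "increment_density h D' g'"
  shows "increment_density h (\<lambda>s t. D s t + D' s t) (\<lambda>t. g t + g' t)"
proof -
  obtain k where sq: "sq_integrable h g"
    and k: "k integrable_on {0..h}" "\<And>t. t\<in>{0..h} \<Longrightarrow> k t \<ge> 0"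
      "\<And>e. e > 0 \<Longrightarrow> \<exists>d>0. \<forall>s t. 0 \<le> s \<longrightarrow> s \<le> t \<longrightarrow> t \<le> h \<longrightarrow> t - s < d \<longrightarrow>
            norm (D s t - integral {s..t} g) \<le> e * integral {s..t} k"
    by (rule increment_densityE[OF assms(1)]) blast
  obtain k' where sq': "sq_integrable h g'"
    and k': "k' integrable_on {0..h}" "\<And>t. t\<in>{0..h} \<Longrightarrow> k' t \<ge> 0"
      "\<And>e. e > 0 \<Longrightarrow> \<exists>d>0. \<forall>s t. 0 \<le> s \<longrightarrow> s \<le> t \<longrightarrow> t \<le> h \<longrightarrow> t - s < d \<longrightarrow>
            norm (D' s t - integral {s..t} g') \<le> e * integral {s..t} k'"
    by (rule increment_densityE[OF assms(2)]) blast
  note sq = sq sq'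
  have int: "g integrable_on {0..h}" "g' integrable_on {0..h}"
    using sq by (auto simp: sq_integrable_def absolutely_integrable_on_def)
  show ?thesis
    unfolding increment_density_def
  proof (intro conjI sq_integrable_add sq exI[of _ "\<lambda>t. k t + k' t"] allI impI)
    show "(\<lambda>t. k t + k' t) integrable_on {0..h}" using k k' by (intro integrable_add)
    show "\<forall>t\<in>{0..h}. 0 \<le> k t + k' t" using k(2) k'(2) by (auto intro: add_nonneg_nonneg)
    fix e :: real assume e: "e > 0"
    obtain d where d: "d > 0" and *: "\<And>s t. 0 \<le> s \<Longrightarrow> s \<le> t \<Longrightarrow> t \<le> h \<Longrightarrow> t - s < d \<Longrightarrow>
            norm (D s t - integral {s..t} g) \<le> e * integral {s..t} k"
      using k(3)[OF e] by metis
    obtain d' where d': "d' > 0" and **: "\<And>s t. 0 \<le> s \<Longrightarrow> s \<le> t \<Longrightarrow> t \<le> h \<Longrightarrow> t - s < d' \<Longrightarrow>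
            norm (D' s t - integral {s..t} g') \<le> e * integral {s..t} k'"
      using k'(3)[OF e] by metis
    have "norm (D s t + D' s t - integral {s..t} (\<lambda>t. g t + g' t)) \<le> e * integral {s..t} (\<lambda>t. k t + k' t)"
      if st: "0 \<le> s" "s \<le> t" "t \<le> h" "t - s < min d d'" for s t
    proof -
      have I: "integral {s..t} (\<lambda>t. g t + g' t) = integral {s..t} g + integral {s..t} g'"
        "integral {s..t} (\<lambda>t. k t + k' t) = integral {s..t} k + integral {s..t} k'"
        using st int k k'
        by (simp_all add: Henstock_Kurzweil_Integration.integral_add integrable_on_Icc_sub[of _ h])
      have "norm (D s t + D' s t - integral {s..t} (\<lambda>t. g t + g' t))
          = norm ((D s t - integral {s..t} g) + (D' s t - integral {s..t} g'))"
        unfolding I by (simp add: algebra_simps)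
      also have "\<dots> \<le> e * integral {s..t} k + e * integral {s..t} k'"
        using *[of s t] **[of s t] st by (intro norm_triangle_le add_mono) auto
      finally show ?thesis unfolding I by (simp add: algebra_simps)
    qed
    then show "\<exists>d>0. \<forall>s t. 0 \<le> s \<longrightarrow> s \<le> t \<longrightarrow> t \<le> h \<longrightarrow> t - s < d \<longrightarrow>
        norm (D s t + D' s t - integral {s..t} (\<lambda>t. g t + g' t)) \<le> e * integral {s..t} (\<lambda>t. k t + k' t)"
      using d d' by (intro exI[of _ "min d d'"] conjI allI impI) simp_all
  qed
qed

lemma increment_density_sum:
  assumes "finite I" "\<And>i. i \<in> I \<Longrightarrow> increment_density h (D i) (g i)"
  shows "increment_density h (\<lambda>s t. \<Sum>i\<in>I. D i s t) (\<lambda>t. \<Sum>i\<in>I. g i t)"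
  using assms
proof (induction I)
  case empty
  show ?case
    unfolding increment_density_def
    by (auto intro!: sq_integrable_continuous exI[of _ "\<lambda>_. 0"] exI[of _ 1])
next
  case (insert i I)
  then show ?case using increment_density_add[of h "D i" "g i"] by simp
qed

text \<open>Freezing the coefficient at the diagonal costs at most the oscillation of \<open>c\<close>
  times \<open>\<integral> |g|\<close>; this is why the density of the product only sees
  \<open>c t t\<close>.\<close>

lemma increment_density_mult:
  assumes c: "continuous_on ({0..h} \<times> {0..h}) (\<lambda>z. c (fst z) (snd z))"
    and "increment_density h D g"
  shows "increment_density h (\<lambda>s t. c s t * D s t) (\<lambda>t. c t t * g t)"
proof -
  obtain k where sq: "sq_integrable h g"
    and k: "k integrable_on {0..h}" "\<And>t. t\<in>{0..h} \<Longrightarrow> k t \<ge> 0"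
      "\<And>e. e > 0 \<Longrightarrow> \<exists>d>0. \<forall>s t. 0 \<le> s \<longrightarrow> s \<le> t \<longrightarrow> t \<le> h \<longrightarrow> t - s < d \<longrightarrow>
            norm (D s t - integral {s..t} g) \<le> e * integral {s..t} k"
    by (rule increment_densityE[OF assms(2)]) blast
  have int: "g integrable_on {0..h}" "(\<lambda>t. norm (g t)) integrable_on {0..h}"
    using sq by (auto simp: sq_integrable_def absolutely_integrable_on_def)
  have cdiag: "continuous_on {0..h} (\<lambda>t. c t t)"
    using continuous_on_compose2[OF c continuous_on_Pair[OF continuous_on_id continuous_on_id], of "{0..h}"] by auto
  have "bounded ((\<lambda>z. c (fst z) (snd z)) ` ({0..h} \<times> {0..h}))"
    by (intro compact_imp_bounded compact_continuous_image c compact_Times) auto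
  then obtain C where C: "C > 0" and C': "\<forall>y\<in>(\<lambda>z. c (fst z) (snd z)) ` ({0..h} \<times> {0..h}). norm y \<le> C"
    unfolding bounded_pos by blast
  have Cb: "norm (c s t) \<le> C" if "s \<in> {0..h}" "t \<in> {0..h}" for s t
    using bspec[OF C', of "c s t"] that by force
  have unif: "uniformly_continuous_on ({0..h} \<times> {0..h}) (\<lambda>z. c (fst z) (snd z))"
    by (intro compact_uniformly_continuous c compact_Times) auto
  have sqc: "sq_integrable h (\<lambda>t. c t t * g t)"
    by (rule sq_integrable_continuous_mult[OF cdiag sq])
  then have intc: "(\<lambda>t. c t t * g t) integrable_on {0..h}"
    by (auto simp: sq_integrable_def absolutely_integrable_on_def)
  show ?thesis
    unfolding increment_density_def
  proof (intro conjI sqc exI[of _ "\<lambda>t. C * k t + norm (g t)"] allI impI)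
    show "(\<lambda>t. C * k t + norm (g t)) integrable_on {0..h}"
      using k int by (intro integrable_add integrable_on_mult_right) auto
    show "\<forall>t\<in>{0..h}. 0 \<le> C * k t + norm (g t)"
      using k(2) C by auto
    fix e :: real assume e: "e > 0"
    obtain d where d: "d > 0" "\<And>s t. 0 \<le> s \<Longrightarrow> s \<le> t \<Longrightarrow> t \<le> h \<Longrightarrow> t - s < d \<Longrightarrow>
            norm (D s t - integral {s..t} g) \<le> e * integral {s..t} k"
      using k(3)[OF e] by metis
    obtain d' where d': "d' > 0" "\<And>z z'. z \<in> {0..h} \<times> {0..h} \<Longrightarrow> z' \<in> {0..h} \<times> {0..h} \<Longrightarrow>
        dist z' z < d' \<Longrightarrow> dist (c (fst z') (snd z')) (c (fst z) (snd z)) < e"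
      using unif[unfolded uniformly_continuous_on_def, rule_format, OF e] by blast
    have "norm (c s t * D s t - integral {s..t} (\<lambda>t. c t t * g t))
        \<le> e * integral {s..t} (\<lambda>t. C * k t + norm (g t))"
      if st: "0 \<le> s" "s \<le> t" "t \<le> h" "t - s < min d (d'/2)" for s t
    proof -
      note sub = integrable_on_Icc_sub[OF _ st(1) st(3)]
      have I: "integral {s..t} (\<lambda>t. C * k t + norm (g t)) = C * integral {s..t} k + integral {s..t} (\<lambda>t. norm (g t))"
        using sub[OF k(1)] sub[OF int(2)]
        by (subst Henstock_Kurzweil_Integration.integral_add) (auto intro: integrable_on_mult_right)
      have J: "c s t * integral {s..t} g - integral {s..t} (\<lambda>t. c t t * g t)
          = integral {s..t} (\<lambda>r. c s t * g r - c r r * g r)"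
        using sub[OF int(1)] sub[OF intc]
        by (subst Henstock_Kurzweil_Integration.integral_diff) (auto intro: integrable_on_mult_right)
      have "norm (integral {s..t} (\<lambda>r. c s t * g r - c r r * g r)) \<le> integral {s..t} (\<lambda>r. e * norm (g r))"
      proof (rule integral_norm_bound_integral)
        show "(\<lambda>r. c s t * g r - c r r * g r) integrable_on {s..t}"
          using sub[OF int(1)] sub[OF intc] by (intro integrable_diff integrable_on_mult_right)
        show "(\<lambda>r. e * norm (g r)) integrable_on {s..t}"
          using sub[OF int(2)] by (rule integrable_on_mult_right)
        fix r assume r: "r \<in> {s..t}"
        have "dist (s, t) (r, r) \<le> dist s r + dist t r"
          by (simp add: dist_Pair_Pair sqrt_sum_squares_le_sum)
        also have "\<dots> < d'" using r st by (auto simp: dist_real_def)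
        finally have "dist (c s t) (c r r) < e"
          using d'(2)[of "(r,r)" "(s,t)"] r st by auto
        then have "norm (c s t - c r r) * norm (g r) \<le> e * norm (g r)"
          by (intro mult_right_mono) (auto simp: dist_norm)
        then show "norm (c s t * g r - c r r * g r) \<le> e * norm (g r)"
          by (simp add: norm_mult[symmetric] left_diff_distrib)
      qed
      then have J': "norm (c s t * integral {s..t} g - integral {s..t} (\<lambda>t. c t t * g t))
          \<le> e * integral {s..t} (\<lambda>r. norm (g r))"
        unfolding J by simp
      have K: "norm (c s t * (D s t - integral {s..t} g)) \<le> C * (e * integral {s..t} k)"
        unfolding norm_mult using Cb[of s t] d(2)[of s t] st C by (intro mult_mono) auto
      have "c s t * D s t - integral {s..t} (\<lambda>t. c t t * g t) = c s t * (D s t - integral {s..t} g)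
         + (c s t * integral {s..t} g - integral {s..t} (\<lambda>t. c t t * g t))"
        by (simp add: algebra_simps)
      then have "norm (c s t * D s t - integral {s..t} (\<lambda>t. c t t * g t))
          \<le> C * (e * integral {s..t} k) + e * integral {s..t} (\<lambda>r. norm (g r))"
        using norm_triangle_le[OF add_mono[OF K J']] by (simp only:)
      then show ?thesis unfolding I by (simp add: algebra_simps)
    qed
    then show "\<exists>d>0. \<forall>s t. 0 \<le> s \<longrightarrow> s \<le> t \<longrightarrow> t \<le> h \<longrightarrow> t - s < d \<longrightarrow>
        norm (c s t * D s t - integral {s..t} (\<lambda>t. c t t * g t))
        \<le> e * integral {s..t} (\<lambda>t. C * k t + norm (g t))"
      using d(1) d'(1) by (intro exI[of _ "min d (d'/2)"]) auto
  qed
qed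

text \<open>The difference between \<open>f\<close> and the primitive of \<open>g\<close> has increments
  bounded by \<open>e \<integral> k\<close> on short intervals. Summing over a fine partition
  bounds its total increment by \<open>e \<integral> k\<close> over the whole interval, for
  every \<open>e > 0\<close>.\<close>

lemma has_weak_deriv_of_increments:
  assumes "increment_density h D g"
    and f: "\<And>s t. 0 \<le> s \<Longrightarrow> s \<le> t \<Longrightarrow> t \<le> h \<Longrightarrow> f t - f s = D s t"
  shows "has_weak_deriv h f g"
proof -
  obtain k where sq: "sq_integrable h g"
    and k: "k integrable_on {0..h}" "\<And>t. t\<in>{0..h} \<Longrightarrow> k t \<ge> 0"
      "\<And>e. e > 0 \<Longrightarrow> \<exists>d>0. \<forall>s t. 0 \<le> s \<longrightarrow> s \<le> t \<longrightarrow> t \<le> h \<longrightarrow> t - s < d \<longrightarrow>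
            norm (D s t - integral {s..t} g) \<le> e * integral {s..t} k"
    by (rule increment_densityE[OF assms(1)]) blast
  have int: "g integrable_on {0..h}"
    using sq by (auto simp: sq_integrable_def absolutely_integrable_on_def)
  define E where "E t = f t - integral {0..t} g" for t
  define K where "K t = integral {0..t} k" for t
  have "E t = E 0" if t: "t \<in> {0..h}" for t
  proof -
    have "norm (E t - E 0) \<le> e * K t" if e: "e > 0" for e
    proof -
      obtain d where d: "d > 0" "\<And>s t. 0 \<le> s \<Longrightarrow> s \<le> t \<Longrightarrow> t \<le> h \<Longrightarrow> t - s < d \<Longrightarrow>
            norm (D s t - integral {s..t} g) \<le> e * integral {s..t} k"
        using k(3)[OF e] by metis
      obtain n :: nat where n: "n > 0" "t / real n < d"
      proof -
        obtain m :: nat where "t / d < real m" using reals_Archimedean2 by blast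
        then have "t / real (Suc m) < d" using d(1) by (simp add: field_simps)
        then show ?thesis using that[of "Suc m"] by simp
      qed
      define p where "p i = real i * t / real n" for i :: nat
      have p: "0 \<le> p i" "p i \<le> p (Suc i)" "p (Suc i) - p i < d" for i
      proof -
        have "p (Suc i) - p i = t / real n" by (simp add: p_def add_divide_distrib distrib_right)
        moreover have "0 \<le> t / real n" using t by simp
        ultimately show "p i \<le> p (Suc i)" "p (Suc i) - p i < d" using n by linarith+
        show "0 \<le> p i" using t by (simp add: p_def)
      qed
      have pt: "p i \<le> h" if "i \<le> n" for i
      proof -
        have "real i * t \<le> real n * t" using that t by (intro mult_right_mono) auto
        then have "p i \<le> t" using n by (simp add: p_def field_simps)
        then show ?thesis using t by simp
      qed
      have ends: "p 0 = 0" "p n = t" using n by (auto simp: p_def)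
      have step: "norm (E (p (Suc i)) - E (p i)) \<le> e * (K (p (Suc i)) - K (p i))" if "i < n" for i
      proof -
        have q: "p (Suc i) \<le> h" using that pt by simp
        have "E (p (Suc i)) - E (p i) = D (p i) (p (Suc i)) - integral {p i..p (Suc i)} g"
          unfolding E_def f[OF p(1,2) q, symmetric] integral_Icc_diff[OF int p(1,2) q] by simp
        then show ?thesis
          using d(2)[OF p(1,2) q p(3)] integral_Icc_diff[OF k(1) p(1,2) q] by (simp add: K_def)
      qed
      have "norm (E t - E 0) = norm (\<Sum>i<n. E (p (Suc i)) - E (p i))"
        by (subst sum_lessThan_telescope) (simp add: ends)
      also have "\<dots> \<le> (\<Sum>i<n. e * (K (p (Suc i)) - K (p i)))"
        by (intro sum_norm_le step) auto
      also have "\<dots> = e * (K t - K 0)"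
        by (subst sum_distrib_left[symmetric], subst sum_lessThan_telescope) (simp add: ends)
      finally show ?thesis by (simp add: K_def)
    qed
    then have ev: "eventually (\<lambda>e. norm (E t - E 0) \<le> e * K t) (at_right 0)"
      by (intro eventually_at_rightI[of 0 1]) auto
    have lim: "((\<lambda>e. e * K t) \<longlongrightarrow> 0 * K t) (at_right 0)"
      by (intro tendsto_intros)
    have "norm (E t - E 0) \<le> 0 * K t"
      by (rule tendsto_lowerbound[OF lim ev]) simp
    then show ?thesis by simp
  qed
  moreover have "E 0 = f 0" by (simp add: E_def)
  ultimately have "integral {0..t} g = f t - f 0" if "t \<in> {0..h}" for t
    using that unfolding E_def by (metis diff_diff_eq2 add_diff_cancel_left')
  then show ?thesis
    unfolding has_weak_deriv_def using sq by blast
qed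

lemma has_weak_deriv_integrable: "has_weak_deriv h f g \<Longrightarrow> g integrable_on {0..h}"
  by (auto simp: has_weak_deriv_def sq_integrable_def absolutely_integrable_on_def)

lemma has_weak_deriv_continuous:
  assumes "has_weak_deriv h f g"
  shows "continuous_on {0..h} f"
proof -
  have "continuous_on {0..h} (\<lambda>t. f 0 + integral {0..t} g)"
    by (intro continuous_on_add continuous_on_const indefinite_integral_continuous_1
        has_weak_deriv_integrable[OF assms])
  then show ?thesis
    by (rule continuous_on_eq) (use assms in \<open>auto simp: has_weak_deriv_def\<close>)
qed

lemma continuous_on_fst_Icc:
  "continuous_on A c \<Longrightarrow> continuous_on (A \<times> B) (\<lambda>z. c (fst z))"
  by (rule continuous_on_compose2[OF _ continuous_on_fst[OF continuous_on_id]]) auto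

lemma continuous_on_snd_Icc:
  "continuous_on B c \<Longrightarrow> continuous_on (A \<times> B) (\<lambda>z. c (snd z))"
  by (rule continuous_on_compose2[OF _ continuous_on_snd[OF continuous_on_id]]) auto

text \<open>The product rule, from the identity \<open>f t g t - f s g s = f t (g t - g s) + g s (f t -
  f s)\<close>.\<close>

lemma has_weak_deriv_mult:
  assumes f: "has_weak_deriv h f f'" and g: "has_weak_deriv h g g'"
  shows "has_weak_deriv h (\<lambda>t. f t * g t) (\<lambda>t. f t * g' t + g t * f' t)"
proof (rule has_weak_deriv_of_increments)
  note cont = has_weak_deriv_continuous[OF f] has_weak_deriv_continuous[OF g]
  note inc = has_weak_deriv_increment_density[OF f] has_weak_deriv_increment_density[OF g]
  show "increment_density h (\<lambda>s t. f t * (g t - g s) + g s * (f t - f s)) (\<lambda>t. f t * g' t + g t * f' t)"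
    by (rule increment_density_add[OF
          increment_density_mult[where c="\<lambda>s t. f t", OF continuous_on_snd_Icc[OF cont(1)] inc(2)]
          increment_density_mult[where c="\<lambda>s t. g s", OF continuous_on_fst_Icc[OF cont(2)] inc(1)]])
qed (simp add: algebra_simps)

lemma has_weak_deriv_add:
  assumes "has_weak_deriv h f f'" "has_weak_deriv h g g'"
  shows "has_weak_deriv h (\<lambda>t. f t + g t) (\<lambda>t. f' t + g' t)"
  by (rule has_weak_deriv_of_increments[OF increment_density_add[OF assms[THEN has_weak_deriv_increment_density]]]) simp

lemma has_weak_deriv_sum:
  assumes "finite I" "\<And>i. i \<in> I \<Longrightarrow> has_weak_deriv h (f i) (f' i)"
  shows "has_weak_deriv h (\<lambda>t. \<Sum>i\<in>I. f i t) (\<lambda>t. \<Sum>i\<in>I. f' i t)"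
proof (rule has_weak_deriv_of_increments)
  show "increment_density h (\<lambda>s t. \<Sum>i\<in>I. f i t - f i s) (\<lambda>t. \<Sum>i\<in>I. f' i t)"
    using assms by (intro increment_density_sum has_weak_deriv_increment_density)
qed (simp add: sum_subtractf)

lemma has_weak_deriv_C1:
  assumes "\<And>t. t \<in> {0..h} \<Longrightarrow> (f has_vector_derivative f' t) (at t within {0..h})"
    and "continuous_on {0..h} f'"
  shows "has_weak_deriv h f f'"
  unfolding has_weak_deriv_def
proof (intro conjI ballI sq_integrable_continuous assms(2))
  fix t assume t: "t \<in> {0..h}"
  have "(f' has_integral (f t - f 0)) {0..t}"
  proof (rule fundamental_theorem_of_calculus)
    fix x assume "x \<in> {0..t}"
    with t show "(f has_vector_derivative f' x) (at x within {0..t})"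
      by (intro has_vector_derivative_within_subset[OF assms(1)]) auto
  qed (use t in simp)
  then show "integral {0..t} f' = f t - f 0" by (simp add: integral_unique)
qed

lemma has_weak_deriv_const: "has_weak_deriv h (\<lambda>_. c) (\<lambda>_. 0)"
  by (rule has_weak_deriv_C1) (auto intro: continuous_intros)

lemma has_weak_deriv_cmult: "has_weak_deriv h f g \<Longrightarrow> has_weak_deriv h (\<lambda>t. c * f t) (\<lambda>t. c * g t)"
  using has_weak_deriv_mult[OF has_weak_deriv_const[of h c], of f g] by simp

lemma has_weak_deriv_minus: "has_weak_deriv h f g \<Longrightarrow> has_weak_deriv h (\<lambda>t. - f t) (\<lambda>t. - g t)"
  using has_weak_deriv_cmult[of h f g "-1"] by simp

lemma has_weak_deriv_diff:
  "has_weak_deriv h f f' \<Longrightarrow> has_weak_deriv h g g' \<Longrightarrow> has_weak_deriv h (\<lambda>t. f t - g t) (\<lambda>t. f' t - g' t)"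
  using has_weak_deriv_add[OF _ has_weak_deriv_minus, of h f f' g g'] by simp

lemma has_weak_deriv_cong:
  "has_weak_deriv h f g \<Longrightarrow> (\<And>t. t \<in> {0..h} \<Longrightarrow> f t = f' t) \<Longrightarrow> h \<ge> 0 \<Longrightarrow> has_weak_deriv h f' g"
  unfolding has_weak_deriv_def by auto

section \<open>Second derivatives of a Lagrangian and their transformation\<close>

text \<open>Two applications of the mean value theorem, first along \<open>a\<close> and then along
  \<open>b\<close>.\<close>

lemma second_difference_mean_value:
  fixes f :: "'a::real_normed_vector \<Rightarrow> real"
  assumes f': "\<And>z. (f has_derivative blinfun_apply (f' z)) (at z)"
    and f'': "\<And>z. (f' has_derivative blinfun_apply (f'' z)) (at z)"
    and s: "s > 0"
  shows "\<exists>r q. 0 < r \<and> r < s \<and> 0 < q \<and> q < s \<and>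
     f (z + s *\<^sub>R a + s *\<^sub>R b) - f (z + s *\<^sub>R a) - f (z + s *\<^sub>R b) + f z
       = s\<^sup>2 * blinfun_apply (blinfun_apply (f'' (z + r *\<^sub>R a + q *\<^sub>R b)) b) a"
proof -
  define g where "g r = f (z + r *\<^sub>R a + s *\<^sub>R b) - f (z + r *\<^sub>R a)" for r
  define g' where "g' r = f' (z + r *\<^sub>R a + s *\<^sub>R b) a - f' (z + r *\<^sub>R a) a" for r
  have "(g has_real_derivative g' r) (at r)" for r
    unfolding g_def g'_def has_real_derivative_iff_has_vector_derivative has_vector_derivative_def
    by (auto intro!: derivative_eq_intros has_derivative_compose[OF _ f', of _ "\<lambda>h. h *\<^sub>R a"]
         simp: blinfun.scaleR_right algebra_simps)
  then obtain r where r: "0 < r" "r < s" "g s - g 0 = s * g' r"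
    using MVT2[OF s, of g g'] by auto
  define k where "k q = f' (z + r *\<^sub>R a + q *\<^sub>R b) a" for q
  define k' where "k' q = f'' (z + r *\<^sub>R a + q *\<^sub>R b) b a" for q
  have "(k has_real_derivative k' q) (at q)" for q
    unfolding k_def k'_def has_real_derivative_iff_has_vector_derivative has_vector_derivative_def
    by (auto intro!: derivative_eq_intros has_derivative_compose[OF _ f'', of _ "\<lambda>h. h *\<^sub>R b"]
         simp: blinfun.scaleR_right blinfun.scaleR_left blinfun.zero_right algebra_simps)
  then obtain q where q: "0 < q" "q < s" "k s - k 0 = s * k' q"
    using MVT2[OF s, of k k'] by auto
  have "g' r = k s - k 0" by (simp add: g'_def k_def)
  then have "g s - g 0 = s\<^sup>2 * k' q"
    using r q by (simp add: power2_eq_square)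
  then show ?thesis
    using r q by (intro exI[of _ r] exI[of _ q]) (simp add: g_def k'_def algebra_simps)
qed

text \<open>The second difference is symmetric in \<open>a\<close> and \<open>b\<close>, and divided by
  \<open>s\<^sup>2\<close> it tends to the second derivative in either order of the
  directions.\<close>

lemma second_derivative_symmetric:
  fixes f :: "'a::real_normed_vector \<Rightarrow> real"
  assumes f': "\<And>z. (f has_derivative blinfun_apply (f' z)) (at z)"
    and f'': "\<And>z. (f' has_derivative blinfun_apply (f'' z)) (at z)"
    and cont: "continuous_on UNIV f''"
  shows "blinfun_apply (blinfun_apply (f'' z) a) b = blinfun_apply (blinfun_apply (f'' z) b) a"
proof -
  define s where "s n = inverse (real (Suc n))" for n
  have s: "s n > 0" for n by (simp add: s_def)
  have s0: "s \<longlonglongrightarrow> 0" unfolding s_def by (rule LIMSEQ_inverse_real_of_nat)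
  define D where "D n = (f (z + s n *\<^sub>R a + s n *\<^sub>R b) - f (z + s n *\<^sub>R a) - f (z + s n *\<^sub>R b) + f z) / (s n)\<^sup>2" for n
  have lim: "X \<longlonglongrightarrow> f'' z b a"
    if X: "\<And>n. \<exists>r q. 0 < r \<and> r < s n \<and> 0 < q \<and> q < s n \<and> X n = f'' (z + r *\<^sub>R a + q *\<^sub>R b) b a" for X a b
  proof -
    from X obtain r q where rq: "\<And>n. 0 < r n" "\<And>n. r n < s n" "\<And>n. 0 < q n" "\<And>n. q n < s n"
      "\<And>n. X n = f'' (z + r n *\<^sub>R a + q n *\<^sub>R b) b a"
      by metis
    have "r \<longlonglongrightarrow> 0" "q \<longlonglongrightarrow> 0"
      using rq by (auto intro!: tendsto_sandwich[OF _ _ tendsto_const s0] always_eventually less_imp_le)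
    then have "(\<lambda>n. z + r n *\<^sub>R a + q n *\<^sub>R b) \<longlonglongrightarrow> z + 0 *\<^sub>R a + 0 *\<^sub>R b"
      by (intro tendsto_intros)
    then have "(\<lambda>n. f'' (z + r n *\<^sub>R a + q n *\<^sub>R b)) \<longlonglongrightarrow> f'' z"
      using cont by (intro isCont_tendsto_compose[of z f'']) (auto simp: continuous_on_eq_continuous_at)
    then have "(\<lambda>n. f'' (z + r n *\<^sub>R a + q n *\<^sub>R b) b a) \<longlonglongrightarrow> f'' z b a"
      by (intro tendsto_intros)
    moreover have "X = (\<lambda>n. f'' (z + r n *\<^sub>R a + q n *\<^sub>R b) b a)"
      using rq(5) by (rule ext)
    ultimately show ?thesis by simp
  qed
  have "D \<longlonglongrightarrow> f'' z b a"
  proof (rule lim)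
    fix n
    have "(s n)\<^sup>2 \<noteq> 0" using s[of n] by simp
    then show "\<exists>r q. 0 < r \<and> r < s n \<and> 0 < q \<and> q < s n \<and> D n = f'' (z + r *\<^sub>R a + q *\<^sub>R b) b a"
      using second_difference_mean_value[OF f' f'' s[of n], of z a b]
      unfolding D_def by (metis nonzero_mult_div_cancel_left)
  qed
  moreover have "D \<longlonglongrightarrow> f'' z a b"
  proof (rule lim)
    fix n
    have "D n = (f (z + s n *\<^sub>R b + s n *\<^sub>R a) - f (z + s n *\<^sub>R b) - f (z + s n *\<^sub>R a) + f z) / (s n)\<^sup>2"
      by (simp add: D_def algebra_simps)
    moreover have "(s n)\<^sup>2 \<noteq> 0" using s[of n] by simp
    ultimately show "\<exists>r q. 0 < r \<and> r < s n \<and> 0 < q \<and> q < s n \<and> D n = f'' (z + r *\<^sub>R b + q *\<^sub>R a) a b"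
      using second_difference_mean_value[OF f' f'' s[of n], of z b a]
      by (metis nonzero_mult_div_cancel_left)
  qed
  ultimately show ?thesis using LIMSEQ_unique by blast
qed

text \<open>Gradient and Hessian in all variables \<open>(t,x,v)\<close> jointly. The iterated partial
  derivatives become blocks of a single continuous symmetric bilinear form.\<close>

definition is_hessian ::
  "('m::finite) lagrangian \<Rightarrow> (real \<times> (real^'m) \<times> (real^'m) \<Rightarrow> (real \<times> (real^'m) \<times> (real^'m)) \<Rightarrow>\<^sub>L real) \<Rightarrow>
   (real \<times> (real^'m) \<times> (real^'m) \<Rightarrow> (real \<times> (real^'m) \<times> (real^'m)) \<Rightarrow>\<^sub>L (real \<times> (real^'m) \<times> (real^'m)) \<Rightarrow>\<^sub>L real) \<Rightarrow> bool"
  where "is_hessian L G H \<longleftrightarrow>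
     (\<forall>z. ((\<lambda>(t, x, v). L t x v) has_derivative blinfun_apply (G z)) (at z)) \<and>
     (\<forall>z. (G has_derivative blinfun_apply (H z)) (at z)) \<and> continuous_on UNIV H"

lemma is_hessianD:
  assumes "is_hessian L G H"
  shows "((\<lambda>(t, x, v). L t x v) has_derivative blinfun_apply (G z)) (at z)"
    and "((\<lambda>z. G z e) has_derivative (\<lambda>d. H z d e)) (at z)"
    and "continuous_on UNIV H"
  using assms bounded_linear.has_derivative[OF blinfun.bounded_linear_left, of G "blinfun_apply (H z)" "at z" e]
  unfolding is_hessian_def by blast+

lemma partial_eq: "(g has_derivative D) (at z) \<Longrightarrow> partial g i z = D (axis i 1)"
  unfolding partial_def using frechet_derivative_at by metis

lemma has_derivative_slices:
  assumes "(g has_derivative D) (at (t, x, v))"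
  shows "((\<lambda>w. g (t, x, w)) has_derivative (\<lambda>d. D (0, 0, d))) (at v)"
    and "((\<lambda>w. g (t, w, v)) has_derivative (\<lambda>d. D (0, d, 0))) (at x)"
proof -
  have "((\<lambda>w. (t, x, w)) has_derivative (\<lambda>d. (0, 0, d))) (at v)"
    by (intro derivative_eq_intros) auto
  from has_derivative_compose[OF this assms]
  show "((\<lambda>w. g (t, x, w)) has_derivative (\<lambda>d. D (0, 0, d))) (at v)" .
  have "((\<lambda>w. (t, w, v)) has_derivative (\<lambda>d. (0, d, 0))) (at x)"
    by (intro derivative_eq_intros) auto
  from has_derivative_compose[OF this assms]
  show "((\<lambda>w. g (t, w, v)) has_derivative (\<lambda>d. D (0, d, 0))) (at x)" .
qed

lemma bilinear_form_eqI:
  fixes M :: "real^'m^'m::finite"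
  assumes "bilinear h" and "\<And>i j. M $ i $ j = h (axis i 1) (axis j 1)"
  shows "(M *v a) \<bullet> b = h b a"
proof -
  have eq: "h b a = (\<Sum>i\<in>UNIV. \<Sum>j\<in>UNIV. b $ i * (a $ j * h (axis i 1) (axis j 1)))"
  proof -
    have "h b a = h (\<Sum>i\<in>UNIV. b $ i *\<^sub>R axis i 1) (\<Sum>j\<in>UNIV. a $ j *\<^sub>R axis j 1)"
      using basis_expansion[of a] basis_expansion[of b] by (simp add: scalar_mult_eq_scaleR)
    also have "\<dots> = (\<Sum>(i,j)\<in>UNIV\<times>UNIV. h (b $ i *\<^sub>R axis i 1) (a $ j *\<^sub>R axis j 1))"
      by (rule bilinear_sum[OF assms(1)])
    also have "\<dots> = (\<Sum>i\<in>UNIV. \<Sum>j\<in>UNIV. b $ i * (a $ j * h (axis i 1) (axis j 1)))"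
      by (simp add: sum.cartesian_product bilinear_lmul[OF assms(1)] bilinear_rmul[OF assms(1)] mult_ac)
    finally show ?thesis .
  qed
  show ?thesis
    unfolding eq inner_vec_def matrix_vector_mult_def assms(2)
    by (simp add: sum_distrib_left sum_distrib_right mult_ac)
qed

lemma hessian_blocks:
  assumes "is_hessian L G H"
  shows "(L_vv L t x v *v a) \<bullet> b = H (t, x, v) (0, 0, b) (0, 0, a)"
    and "(L_vx L t x v *v a) \<bullet> b = H (t, x, v) (0, 0, b) (0, a, 0)"
    and "(L_xx L t x v *v a) \<bullet> b = H (t, x, v) (0, b, 0) (0, a, 0)"
proof -
  have G: "((\<lambda>(t, x, v). L t x v) has_derivative blinfun_apply (G z)) (at z)" for z
    by (rule is_hessianD[OF assms])
  have H: "((\<lambda>z. G z e) has_derivative (\<lambda>d. H z d e)) (at z)" for z e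
    by (rule is_hessianD[OF assms])
  have 1: "partial (\<lambda>w'. L t x w') j w = G (t, x, w) (0, 0, axis j 1)" for t x w j
    using partial_eq[OF has_derivative_slices(1)[OF G[of "(t, x, w)"]]] by simp
  have 2: "partial (\<lambda>y. L t y w) j x = G (t, x, w) (0, axis j 1, 0)" for t x w j
    using partial_eq[OF has_derivative_slices(2)[OF G[of "(t, x, w)"]]] by simp
  have bil: "bilinear (\<lambda>b a. H (t, x, v) (f b) (g a))" if "linear f" "linear g" for f g
    using that unfolding bilinear_def
    by (auto intro!: linearI simp: linear_add linear_scale blinfun.add_left blinfun.add_right
        blinfun.scaleR_left blinfun.scaleR_right)
  have lin: "linear (\<lambda>b::real^'m. (0::real, 0::real^'m, b))" "linear (\<lambda>b::real^'m. (0::real, b, 0::real^'m))"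
    by (auto intro!: linearI)
  show "(L_vv L t x v *v a) \<bullet> b = H (t, x, v) (0, 0, b) (0, 0, a)"
    by (rule bilinear_form_eqI[OF bil[OF lin(1) lin(1)]])
       (simp add: L_vv_def 1 partial_eq[OF has_derivative_slices(1)[OF H]])
  show "(L_vx L t x v *v a) \<bullet> b = H (t, x, v) (0, 0, b) (0, a, 0)"
    by (rule bilinear_form_eqI[OF bil[OF lin(1) lin(2)]])
       (simp add: L_vx_def 2 partial_eq[OF has_derivative_slices(1)[OF H]])
  show "(L_xx L t x v *v a) \<bullet> b = H (t, x, v) (0, b, 0) (0, a, 0)"
    by (rule bilinear_form_eqI[OF bil[OF lin(2) lin(2)]])
       (simp add: L_xx_def 2 partial_eq[OF has_derivative_slices(2)[OF H]])
qed

lemma matrix_entry_inner: "(M::real^'m^'m::finite) $ i $ j = (M *v axis j 1) \<bullet> axis i 1"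
  by (simp add: inner_axis matrix_vector_mult_basis column_def)

lemma continuous_on_hessian_blocks:
  fixes x v :: "real \<Rightarrow> real^'m::finite"
  assumes H: "is_hessian L G H" and x: "continuous_on UNIV x" and v: "continuous_on UNIV v"
  shows "continuous_on UNIV (\<lambda>t. L_vv L t (x t) (v t))"
    and "continuous_on UNIV (\<lambda>t. L_vx L t (x t) (v t))"
    and "continuous_on UNIV (\<lambda>t. L_xx L t (x t) (v t))"
proof -
  have "continuous_on UNIV H" using H by (simp add: is_hessian_def)
  then have "continuous_on UNIV (\<lambda>t. H (t, x t, v t))"
    by (rule continuous_on_compose2) (auto intro!: continuous_on_Pair continuous_on_id x v)
  then have c: "continuous_on UNIV (\<lambda>t. H (t, x t, v t) d e)" for d e
    by (intro continuous_intros)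
  have *: "continuous_on UNIV M" if "\<And>i j. continuous_on UNIV (\<lambda>t. M t $ i $ j)" for M :: "real \<Rightarrow> real^'m^'m"
  proof -
    have "continuous_on UNIV (\<lambda>t. \<chi> i. \<chi> j. M t $ i $ j)"
      using that by (intro continuous_on_vec_lambda)
    then show ?thesis by simp
  qed
  show "continuous_on UNIV (\<lambda>t. L_vv L t (x t) (v t))"
    by (rule *) (simp only: matrix_entry_inner hessian_blocks[OF H] c)
  show "continuous_on UNIV (\<lambda>t. L_vx L t (x t) (v t))"
    by (rule *) (simp only: matrix_entry_inner hessian_blocks[OF H] c)
  show "continuous_on UNIV (\<lambda>t. L_xx L t (x t) (v t))"
    by (rule *) (simp only: matrix_entry_inner hessian_blocks[OF H] c)
qed

lemma hessian_symmetric: "is_hessian L G H \<Longrightarrow> H z a b = H z b a"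
  unfolding is_hessian_def using second_derivative_symmetric[of "\<lambda>(t, x, v). L t x v" G H] by blast

text \<open>Two applications of the chain rule at fixed \<open>t\<close>; only the components
  \<open>x\<close> and \<open>v\<close> are transformed linearly, whence the directions with
  vanishing time component.\<close>

lemma hessian_transform:
  fixes A B :: "real^'m::finite \<Rightarrow> real^'m"
  assumes hess: "is_hessian L G H" and A: "bounded_linear A" and B: "bounded_linear B"
    and inv: "\<And>x v. L t x v = L s (A x) (B v)"
  shows "H (t, x, v) (0, a, b) (0, a', b') = H (s, A x, B v) (0, A a, B b) (0, A a', B b')"
proof -
  have G: "((\<lambda>(t, x, v). L t x v) has_derivative blinfun_apply (G z)) (at z)" for z
    by (rule is_hessianD[OF hess])
  have H: "((\<lambda>z. G z e) has_derivative (\<lambda>d. H z d e)) (at z)" for z e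
    by (rule is_hessianD[OF hess])
  have i1: "((\<lambda>w. (t, w)) has_derivative (\<lambda>d. (0, d))) (at (x, v))" for x v :: "real^'m"
    by (intro derivative_eq_intros) auto
  have i2: "((\<lambda>w. (s, A (fst w), B (snd w))) has_derivative (\<lambda>d. (0, A (fst d), B (snd d)))) (at (x, v))" for x v
    by (intro has_derivative_Pair has_derivative_const
        bounded_linear.has_derivative[OF A] bounded_linear.has_derivative[OF B] derivative_intros)
  have first: "G (t, x, v) (0, a, b) = G (s, A x, B v) (0, A a, B b)" for x v a b
  proof -
    have "((\<lambda>w. L t (fst w) (snd w)) has_derivative (\<lambda>d. G (t, x, v) (0, d))) (at (x, v))"
      using has_derivative_compose[OF i1 G] by (simp add: case_prod_beta)
    moreover have "((\<lambda>w. L t (fst w) (snd w)) has_derivative (\<lambda>d. G (s, A x, B v) (0, A (fst d), B (snd d)))) (at (x, v))"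
      using has_derivative_compose[OF i2[of x v] G] by (simp add: case_prod_beta inv)
    ultimately have "(\<lambda>d. G (t, x, v) (0, d)) = (\<lambda>d. G (s, A x, B v) (0, A (fst d), B (snd d)))"
      by (rule has_derivative_unique)
    from fun_cong[OF this, of "(a, b)"] show ?thesis by simp
  qed
  have "((\<lambda>w. G (t, w) (0, a', b')) has_derivative (\<lambda>d. H (t, x, v) (0, d) (0, a', b'))) (at (x, v))"
    using has_derivative_compose[OF i1 H] by simp
  moreover have "(\<lambda>w. G (t, w) (0, a', b')) = (\<lambda>w. G (s, A (fst w), B (snd w)) (0, A a', B b'))"
    using first by auto
  ultimately have "((\<lambda>w. G (s, A (fst w), B (snd w)) (0, A a', B b')) has_derivative
      (\<lambda>d. H (t, x, v) (0, d) (0, a', b'))) (at (x, v))"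
    by simp
  moreover have "((\<lambda>w. G (s, A (fst w), B (snd w)) (0, A a', B b')) has_derivative
      (\<lambda>d. H (s, A x, B v) (0, A (fst d), B (snd d)) (0, A a', B b'))) (at (x, v))"
    using has_derivative_compose[OF i2[of x v] H] by simp
  ultimately have "(\<lambda>d. H (t, x, v) (0, d) (0, a', b')) = (\<lambda>d. H (s, A x, B v) (0, A (fst d), B (snd d)) (0, A a', B b'))"
    by (rule has_derivative_unique)
  from fun_cong[OF this, of "(a, b)"] show ?thesis by simp
qed

section \<open>Symmetries of the coefficients along the orbit\<close>

text \<open>What the smoothness and the Legendre convexity of a Lagrangian give for \<open>P\<close>,
  \<open>Q\<close>, \<open>R\<close> along a \<open>C\<^sup>1\<close> curve. Symmetry and
  positivity are stated through the quadratic forms, in which they are used.\<close>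

definition sturm_coefficients ::
  "(real \<Rightarrow> real^'m^'m) \<Rightarrow> (real \<Rightarrow> real^'m^'m) \<Rightarrow> (real \<Rightarrow> real^'m^'m::finite) \<Rightarrow> bool" where
  "sturm_coefficients P Q R \<longleftrightarrow>
     continuous_on UNIV P \<and> continuous_on UNIV Q \<and> continuous_on UNIV R \<and>
     (\<forall>t a b. (P t *v a) \<bullet> b = (P t *v b) \<bullet> a) \<and>
     (\<forall>t a b. (R t *v a) \<bullet> b = (R t *v b) \<bullet> a) \<and>
     (\<forall>t a. a \<noteq> 0 \<longrightarrow> (P t *v a) \<bullet> a > 0)"

definition shift_covariant ::
  "real \<Rightarrow> real^'m^'m \<Rightarrow> (real \<Rightarrow> real^'m^'m) \<Rightarrow> (real \<Rightarrow> real^'m^'m) \<Rightarrow> (real \<Rightarrow> real^'m^'m::finite) \<Rightarrow> bool" where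
  "shift_covariant d S P Q R \<longleftrightarrow> (\<forall>t a b.
     (P (t + d) *v a) \<bullet> b = (P t *v (S *v a)) \<bullet> (S *v b) \<and>
     (Q (t + d) *v a) \<bullet> b = (Q t *v (S *v a)) \<bullet> (S *v b) \<and>
     (R (t + d) *v a) \<bullet> b = (R t *v (S *v a)) \<bullet> (S *v b))"

text \<open>The reflection reverses velocities, so the mixed block \<open>Q\<close> picks up a minus
  sign.\<close>

definition reflection_covariant ::
  "real \<Rightarrow> real^'m^'m \<Rightarrow> (real \<Rightarrow> real^'m^'m) \<Rightarrow> (real \<Rightarrow> real^'m^'m) \<Rightarrow> (real \<Rightarrow> real^'m^'m::finite) \<Rightarrow> bool" where
  "reflection_covariant d N P Q R \<longleftrightarrow> (\<forall>t a b.
     (P (d - t) *v a) \<bullet> b = (P t *v (N *v a)) \<bullet> (N *v b) \<and>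
     (Q (d - t) *v a) \<bullet> b = - ((Q t *v (N *v a)) \<bullet> (N *v b)) \<and>
     (R (d - t) *v a) \<bullet> b = (R t *v (N *v a)) \<bullet> (N *v b))"

lemma C2_lagrangian_hessian:
  assumes "C2_lagrangian L"
  obtains G H where "is_hessian L G H"
  using assms unfolding C2_lagrangian_def C2_function_def is_hessian_def by blast

lemma periodic_C1D:
  assumes "periodic_C1 T x"
  shows "(x has_vector_derivative vector_derivative x (at t)) (at t)"
    and "continuous_on UNIV x" and "continuous_on UNIV (\<lambda>t. vector_derivative x (at t))"
proof -
  have C1: "x C1_differentiable_on UNIV" using assms by (simp add: periodic_C1_def)
  then show "(x has_vector_derivative vector_derivative x (at t)) (at t)"
    by (auto simp: C1_differentiable_on_eq vector_derivative_works)
  show "continuous_on UNIV x" "continuous_on UNIV (\<lambda>t. vector_derivative x (at t))"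
    using C1 by (auto simp: C1_differentiable_on_eq C1_differentiable_imp_continuous_on)
qed

lemma sturm_coefficients_along:
  assumes "C2_lagrangian L" "legendre_convex L" "periodic_C1 T x"
  shows "sturm_coefficients (P_along L x) (Q_along L x) (R_along L x)"
proof -
  obtain G H where H: "is_hessian L G H" using C2_lagrangian_hessian[OF assms(1)] .
  note cont = continuous_on_hessian_blocks[OF H periodic_C1D(2,3)[OF assms(3)]]
  have "(P_along L x t *v a) \<bullet> b = (P_along L x t *v b) \<bullet> a"
    "(R_along L x t *v a) \<bullet> b = (R_along L x t *v b) \<bullet> a" for t a b
    unfolding P_along_def R_along_def hessian_blocks[OF H] by (rule hessian_symmetric[OF H])+
  then show ?thesis
    unfolding sturm_coefficients_def using cont assms(2)
    by (auto simp: P_along_def[abs_def] Q_along_def[abs_def] R_along_def[abs_def] legendre_convex_def)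
qed

lemma vector_derivative_equivariant:
  assumes "\<And>t. (x has_vector_derivative y t) (at t)"
    and "\<And>t. x t = (A::real^'m^'m::finite) *v x (c + e * t)"
  shows "y t = e *\<^sub>R (A *v y (c + e * t))"
proof -
  have lin: "((\<lambda>t. c + e * t) has_vector_derivative e) (at t)"
    unfolding has_real_derivative_iff_has_vector_derivative[symmetric]
    by (auto intro!: derivative_eq_intros)
  have "((\<lambda>t. x (c + e * t)) has_vector_derivative e *\<^sub>R y (c + e * t)) (at t)"
    using vector_diff_chain_at[OF lin, of x "y (c + e * t)"] assms(1) unfolding o_def by blast
  then have der: "((\<lambda>t. A *v x (c + e * t)) has_vector_derivative A *v (e *\<^sub>R y (c + e * t))) (at t)"
    by (rule bounded_linear.has_vector_derivative[OF matrix_vector_mul_bounded_linear])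
  have eq: "(\<lambda>t. A *v x (c + e * t)) = x"
    by (rule ext, rule assms(2)[symmetric])
  have "y t = A *v (e *\<^sub>R y (c + e * t))"
    by (rule vector_derivative_unique_at[OF assms(1) der[unfolded eq]])
  then show ?thesis by (simp only: matrix_vector_mult_scaleR)
qed

lemma shift_covariant_along:
  assumes "C2_lagrangian L" "lagrangian_symmetric T n S N L" "periodic_C1 T x" "equivariant T n S N x"
  shows "shift_covariant (T / n) S (P_along L x) (Q_along L x) (R_along L x)"
proof -
  obtain G H where H: "is_hessian L G H" using C2_lagrangian_hessian[OF assms(1)] .
  let ?d = "T / n" and ?y = "\<lambda>t. vector_derivative x (at t)"
  have x: "x t = S *v x (t + ?d)" for t
    using fun_cong[OF assms(4)[unfolded equivariant_def act_S_def, THEN conjunct1], of t] by simp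
  have y: "?y t = S *v ?y (t + ?d)" for t
  proof -
    have "x t = S *v x (?d + 1 * t)" for t
      by (simp only: mult_1_left add.commute[of ?d] x[of t, symmetric])
    from vector_derivative_equivariant[OF periodic_C1D(1)[OF assms(3)] this, of t] show ?thesis
      by (simp only: mult_1_left add.commute[of ?d] scaleR_one)
  qed
  have L: "L (t + ?d) a b = L t (S *v a) (S *v b)" for t a b
    using assms(2)[unfolded lagrangian_symmetric_def, THEN conjunct1, rule_format, of "t + ?d" a b] by simp
  have lin: "bounded_linear ((*v) S)" by (rule matrix_vector_mul_bounded_linear)
  have *: "H (t + ?d, x (t + ?d), ?y (t + ?d)) (0, a, b) (0, a', b')
      = H (t, x t, ?y t) (0, S *v a, S *v b) (0, S *v a', S *v b')" for t a b a' b'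
  proof -
    have "H (t + ?d, x (t + ?d), ?y (t + ?d)) (0, a, b) (0, a', b')
        = H (t, S *v x (t + ?d), S *v ?y (t + ?d)) (0, S *v a, S *v b) (0, S *v a', S *v b')"
      by (rule hessian_transform[OF H lin lin]) (rule L)
    then show ?thesis by (simp only: x[of t, symmetric] y[of t, symmetric])
  qed
  show ?thesis
    unfolding shift_covariant_def P_along_def Q_along_def R_along_def hessian_blocks[OF H]
    by (intro allI conjI; simp only: * matrix_vector_mult_0_right)
qed

lemma reflection_covariant_along:
  assumes "C2_lagrangian L" "lagrangian_symmetric T n S N L" "periodic_C1 T x" "equivariant T n S N x"
  shows "reflection_covariant (T / n) N (P_along L x) (Q_along L x) (R_along L x)"
proof -
  obtain G H where H: "is_hessian L G H" using C2_lagrangian_hessian[OF assms(1)] .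
  let ?d = "T / n" and ?y = "\<lambda>t. vector_derivative x (at t)"
  have x: "x t = N *v x (?d - t)" for t
    using fun_cong[OF assms(4)[unfolded equivariant_def act_N_def, THEN conjunct2], of t] by simp
  have y: "?y t = - (N *v ?y (?d - t))" for t
  proof -
    have "x t = N *v x (?d + (-1) * t)" for t
      by (simp only: mult_minus1 add_uminus_conv_diff x[of t, symmetric])
    from vector_derivative_equivariant[OF periodic_C1D(1)[OF assms(3)] this, of t] show ?thesis
      by (simp only: mult_minus1 add_uminus_conv_diff scaleR_minus1_left)
  qed
  have L: "L (?d - t) a b = L t (N *v a) (- (N *v b))" for t a b
    using assms(2)[unfolded lagrangian_symmetric_def, THEN conjunct2, rule_format, of "?d - t" a b] by simp
  have lin: "bounded_linear ((*v) N)" by (rule matrix_vector_mul_bounded_linear)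
  have lin': "bounded_linear (\<lambda>b. - (N *v b))" by (intro bounded_linear_minus lin)
  have *: "H (?d - t, x (?d - t), ?y (?d - t)) (0, a, b) (0, a', b')
      = H (t, x t, ?y t) (0, N *v a, - (N *v b)) (0, N *v a', - (N *v b'))" for t a b a' b'
  proof -
    have "H (?d - t, x (?d - t), ?y (?d - t)) (0, a, b) (0, a', b')
        = H (t, N *v x (?d - t), - (N *v ?y (?d - t))) (0, N *v a, - (N *v b)) (0, N *v a', - (N *v b'))"
      by (rule hessian_transform[OF H lin lin']) (rule L)
    then show ?thesis by (simp only: x[of t, symmetric] y[of t, symmetric])
  qed
  have neg: "(0, 0, - b) = - (0::real, 0::real^'m, b::real^'m)" for b by simp
  show ?thesis
    unfolding reflection_covariant_def P_along_def Q_along_def R_along_def hessian_blocks[OF H]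
    by (intro allI conjI; simp only: * matrix_vector_mult_0_right minus_zero;
        simp only: neg blinfun.minus_left blinfun.minus_right minus_minus)
qed

lemma matrix_eq_of_forms:
  fixes A B :: "real^'m^'m::finite"
  assumes "\<And>a b. (A *v a) \<bullet> b = (B *v a) \<bullet> b"
  shows "A = B"
proof -
  have "A *v a = B *v a" for a
    using assms vector_eq_rdot[of "A *v a" "B *v a"] by blast
  then show ?thesis by (simp add: matrix_eq)
qed

text \<open>Iterating the covariance \<open>n\<close> times conjugates \<open>Q 0\<close> by
  \<open>S\<^sup>n = 1\<close>.\<close>

lemma shift_covariant_period:
  assumes sh: "shift_covariant d S P Q R" and S: "(((**) S) ^^ n) (mat 1) = mat 1"
  shows "Q (of_nat n * d) = Q 0"
proof (rule matrix_eq_of_forms)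
  fix a b
  have "(Q (of_nat k * d) *v a) \<bullet> b
      = (Q 0 *v ((((**) S) ^^ k) (mat 1) *v a)) \<bullet> ((((**) S) ^^ k) (mat 1) *v b)" for k a b
  proof (induction k arbitrary: a b)
    case (Suc k)
    have "S ** (((**) S) ^^ k) (mat 1) = (((**) S) ^^ k) (mat 1) ** S"
    proof (induction k)
      case (Suc k)
      then show ?case by (metis comp_apply funpow.simps(2) matrix_mul_assoc)
    qed simp
    then have comm: "(((**) S) ^^ Suc k) (mat 1) *v c = (((**) S) ^^ k) (mat 1) *v (S *v c)" for c
      by (simp add: matrix_vector_mul_assoc)
    have "of_nat (Suc k) * d = of_nat k * d + d" by (simp add: algebra_simps)
    then have "(Q (of_nat (Suc k) * d) *v a) \<bullet> b = (Q (of_nat k * d) *v (S *v a)) \<bullet> (S *v b)"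
      using sh by (simp only: shift_covariant_def)
    then show ?case by (simp only: Suc comm)
  qed simp
  from this[of n] show "(Q (of_nat n * d) *v a) \<bullet> b = (Q 0 *v a) \<bullet> b" by (simp add: S)
qed

section \<open>The energy of a path and its invariance under the dihedral symmetries\<close>

text \<open>Paths are handled together with their velocity, which avoids choosing a derivative at the
  end points.\<close>

definition C1_path :: "real \<Rightarrow> real \<Rightarrow> (real \<Rightarrow> real^'m::finite) \<Rightarrow> (real \<Rightarrow> real^'m) \<Rightarrow> bool" where
  "C1_path a b u v \<longleftrightarrow>
     (\<forall>t\<in>{a..b}. (u has_vector_derivative v t) (at t within {a..b})) \<and> continuous_on {a..b} v"

definition energy_density ::
  "(real \<Rightarrow> real^'m^'m) \<Rightarrow> (real \<Rightarrow> real^'m^'m) \<Rightarrow> (real \<Rightarrow> real^'m^'m::finite) \<Rightarrow>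
   real \<Rightarrow> real^'m \<Rightarrow> real^'m \<Rightarrow> real^'m \<Rightarrow> real^'m \<Rightarrow> real" where
  "energy_density P Q R t u v w z =
     (P t *v v) \<bullet> z + (Q t *v u) \<bullet> z + (Q t *v w) \<bullet> v + (R t *v u) \<bullet> w"

definition boundary_form :: "(real \<Rightarrow> real^'m^'m) \<Rightarrow> real \<Rightarrow> real^'m::finite \<Rightarrow> real^'m \<Rightarrow> real" where
  "boundary_form Q t u w = ((Q t *v u) \<bullet> w + (Q t *v w) \<bullet> u) / 2"

text \<open>The energy is the quadratic form of this bilinear form, which is symmetric if
  \<open>P\<close> and \<open>R\<close> are; the boundary part is the polarization of
  \<open>\<langle>Q u, u\<rangle>\<close>.\<close>

definition energy_form ::
  "(real \<Rightarrow> real^'m^'m) \<Rightarrow> (real \<Rightarrow> real^'m^'m) \<Rightarrow> (real \<Rightarrow> real^'m^'m::finite) \<Rightarrow> real \<Rightarrow> real \<Rightarrow>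
   (real \<Rightarrow> real^'m) \<Rightarrow> (real \<Rightarrow> real^'m) \<Rightarrow> (real \<Rightarrow> real^'m) \<Rightarrow> (real \<Rightarrow> real^'m) \<Rightarrow> real" where
  "energy_form P Q R a b u v w z =
     integral {a..b} (\<lambda>t. energy_density P Q R t (u t) (v t) (w t) (z t))
     - (boundary_form Q b (u b) (w b) - boundary_form Q a (u a) (w a))"

definition energy ::
  "(real \<Rightarrow> real^'m^'m) \<Rightarrow> (real \<Rightarrow> real^'m^'m) \<Rightarrow> (real \<Rightarrow> real^'m^'m::finite) \<Rightarrow> real \<Rightarrow> real \<Rightarrow>
   (real \<Rightarrow> real^'m) \<Rightarrow> (real \<Rightarrow> real^'m) \<Rightarrow> real" where
  "energy P Q R a b u v = energy_form P Q R a b u v u v"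

lemma continuous_on_matrix_vector:
  fixes M :: "'a::topological_space \<Rightarrow> real^'m^'m::finite"
  assumes "continuous_on A M" "continuous_on A f"
  shows "continuous_on A (\<lambda>t. M t *v f t)"
  unfolding matrix_vector_mult_def by (intro continuous_intros assms)

lemma C1_path_continuous:
  assumes "C1_path a b u v"
  shows "continuous_on {a..b} u" "continuous_on {a..b} v"
  using assms unfolding C1_path_def
  by (auto simp: continuous_on_eq_continuous_within intro: has_vector_derivative_continuous)

lemma C1_path_subset:
  assumes "C1_path a b u v" "a \<le> a'" "b' \<le> b"
  shows "C1_path a' b' u v"
proof -
  have sub: "{a'..b'} \<subseteq> {a..b}" using assms by auto
  show ?thesis
    unfolding C1_path_def
  proof (intro conjI ballI)
    fix t assume "t \<in> {a'..b'}"
    then have "t \<in> {a..b}" using sub by blast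
    then have "(u has_vector_derivative v t) (at t within {a..b})" using assms(1) by (simp add: C1_path_def)
    then show "(u has_vector_derivative v t) (at t within {a'..b'})"
      by (rule has_vector_derivative_within_subset[OF _ sub])
  qed (rule continuous_on_subset[OF C1_path_continuous(2)[OF assms(1)] sub])
qed

lemma C1_path_add_scaled:
  assumes "C1_path a b u v" "C1_path a b w z"
  shows "C1_path a b (\<lambda>t. u t + l *\<^sub>R w t) (\<lambda>t. v t + l *\<^sub>R z t)"
  unfolding C1_path_def
proof (intro conjI ballI)
  fix t assume "t \<in> {a..b}"
  then show "((\<lambda>t. u t + l *\<^sub>R w t) has_vector_derivative v t + l *\<^sub>R z t) (at t within {a..b})"
    using assms unfolding C1_path_def
    by (intro has_vector_derivative_add bounded_linear.has_vector_derivative[OF bounded_linear_scaleR_right]) auto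
next
  show "continuous_on {a..b} (\<lambda>t. v t + l *\<^sub>R z t)"
    using C1_path_continuous(2)[OF assms(1)] C1_path_continuous(2)[OF assms(2)]
    by (intro continuous_on_add continuous_on_scaleR continuous_on_const)
qed

lemma C1_path_affine_image:
  fixes A :: "real^'m^'m::finite"
  assumes u: "C1_path a' b' u v"
    and im: "\<And>t. t \<in> {a..b} \<Longrightarrow> c + e * t \<in> {a'..b'}"
  shows "C1_path a b (\<lambda>t. A *v u (c + e * t)) (\<lambda>t. e *\<^sub>R (A *v v (c + e * t)))"
  unfolding C1_path_def
proof (intro conjI ballI)
  have aff: "((\<lambda>t. c + e * t) has_vector_derivative e) (at t within {a..b})" for t
    unfolding has_real_derivative_iff_has_vector_derivative[symmetric]
    by (auto intro!: derivative_eq_intros)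
  have sub: "(\<lambda>t. c + e * t) ` {a..b} \<subseteq> {a'..b'}" using im by blast
  fix t assume t: "t \<in> {a..b}"
  have "(u has_vector_derivative v (c + e * t)) (at (c + e * t) within (\<lambda>t. c + e * t) ` {a..b})"
    using u im[OF t] by (intro has_vector_derivative_within_subset[OF _ sub]) (simp add: C1_path_def)
  from vector_diff_chain_within[OF aff this]
  have "((\<lambda>t. u (c + e * t)) has_vector_derivative e *\<^sub>R v (c + e * t)) (at t within {a..b})"
    by (simp add: o_def)
  then have "((\<lambda>t. A *v u (c + e * t)) has_vector_derivative A *v (e *\<^sub>R v (c + e * t))) (at t within {a..b})"
    by (rule bounded_linear.has_vector_derivative[OF matrix_vector_mul_bounded_linear])
  then show "((\<lambda>t. A *v u (c + e * t)) has_vector_derivative e *\<^sub>R (A *v v (c + e * t))) (at t within {a..b})"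
    by (simp only: matrix_vector_mult_scaleR)
next
  have "continuous_on {a..b} (\<lambda>t. v (c + e * t))"
    by (rule continuous_on_compose2[OF C1_path_continuous(2)[OF u]])
       (use im in \<open>auto intro!: continuous_intros\<close>)
  then show "continuous_on {a..b} (\<lambda>t. e *\<^sub>R (A *v v (c + e * t)))"
    by (intro continuous_on_scaleR continuous_on_matrix_vector continuous_on_const)
qed

lemma continuous_on_energy_density:
  fixes \<tau> :: "'a::topological_space \<Rightarrow> real"
  assumes "sturm_coefficients P Q R" "continuous_on A \<tau>"
    and "continuous_on A u" "continuous_on A v" "continuous_on A w" "continuous_on A z"
  shows "continuous_on A (\<lambda>t. energy_density P Q R (\<tau> t) (u t) (v t) (w t) (z t))"
proof -
  have "continuous_on UNIV P" "continuous_on UNIV Q" "continuous_on UNIV R"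
    using assms(1) by (simp_all add: sturm_coefficients_def)
  then have "continuous_on A (\<lambda>t. P (\<tau> t))" "continuous_on A (\<lambda>t. Q (\<tau> t))" "continuous_on A (\<lambda>t. R (\<tau> t))"
    using assms(2) by (auto intro: continuous_on_compose2)
  then show ?thesis
    unfolding energy_density_def by (intro continuous_intros continuous_on_matrix_vector assms)
qed

lemma integrable_energy_density:
  assumes "sturm_coefficients P Q R" "C1_path a b u v" "C1_path a b w z"
  shows "(\<lambda>t. energy_density P Q R t (u t) (v t) (w t) (z t)) integrable_on {a..b}"
  by (intro integrable_continuous_real continuous_on_energy_density assms continuous_on_id
      C1_path_continuous[OF assms(2)] C1_path_continuous[OF assms(3)])

lemma energy_eq:
  "energy P Q R a b u v = integral {a..b} (\<lambda>t. energy_density P Q R t (u t) (v t) (u t) (v t))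
     - ((Q b *v u b) \<bullet> u b - (Q a *v u a) \<bullet> u a)"
  by (simp add: energy_def energy_form_def boundary_form_def)

lemma energy_combine:
  assumes "sturm_coefficients P Q R" "C1_path a c u v" "a \<le> b" "b \<le> c"
  shows "energy P Q R a c u v = energy P Q R a b u v + energy P Q R b c u v"
proof -
  have "integral {a..b} (\<lambda>t. energy_density P Q R t (u t) (v t) (u t) (v t))
      + integral {b..c} (\<lambda>t. energy_density P Q R t (u t) (v t) (u t) (v t))
      = integral {a..c} (\<lambda>t. energy_density P Q R t (u t) (v t) (u t) (v t))"
    by (rule Henstock_Kurzweil_Integration.integral_combine[OF assms(3,4) integrable_energy_density[OF assms(1,2,2)]])
  then show ?thesis unfolding energy_eq by linarith
qed

text \<open>The factors \<open>1\<close> on the right give this statement the form of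
  \<open>C1_path_affine_image\<close>, which also covers the reflection.\<close>

lemma energy_shift:
  assumes sh: "shift_covariant d S P Q R"
  shows "energy P Q R (a + d) (b + d) u v
    = energy P Q R a b (\<lambda>t. S *v u (d + 1 * t)) (\<lambda>t. 1 *\<^sub>R (S *v v (d + 1 * t)))"
proof -
  have *: "(P (d + t) *v a) \<bullet> b = (P t *v (S *v a)) \<bullet> (S *v b)"
    "(Q (d + t) *v a) \<bullet> b = (Q t *v (S *v a)) \<bullet> (S *v b)"
    "(R (d + t) *v a) \<bullet> b = (R t *v (S *v a)) \<bullet> (S *v b)" for t a b
    using sh unfolding shift_covariant_def add.commute[of d] by blast+
  show ?thesis
    unfolding energy_eq integral_shift_Icc_real[symmetric] o_def
    by (simp only: energy_density_def * add.commute[of _ d] mult_1 scaleR_one)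
qed

lemma integral_reflect_Icc:
  fixes f :: "real \<Rightarrow> real"
  shows "integral {d - b..d - a} f = integral {a..b} (\<lambda>t. f (d - t))"
proof -
  have "integral {d - b..d - a} f = integral {- b + d..- a + d} f" by simp
  also have "\<dots> = integral {- b..- a} (\<lambda>t. f (d + t))"
    unfolding integral_shift_Icc_real[symmetric] o_def ..
  also have "\<dots> = integral {- b..- a} (\<lambda>x. (\<lambda>t. f (d - t)) (- x))" by simp
  also have "\<dots> = integral {a..b} (\<lambda>t. f (d - t))"
    by (rule Henstock_Kurzweil_Integration.integral_reflect_real)
  finally show ?thesis .
qed

text \<open>In the density the sign of \<open>Q\<close> is compensated by the sign of the velocity; in
  the boundary term it is compensated by the exchange of the two end points.\<close>

lemma energy_reflect:
  assumes refl: "reflection_covariant d N P Q R"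
  shows "energy P Q R (d - b) (d - a) u v
    = energy P Q R a b (\<lambda>t. N *v u (d + (-1) * t)) (\<lambda>t. (-1) *\<^sub>R (N *v v (d + (-1) * t)))"
proof -
  have *: "(P (d - t) *v a) \<bullet> b = (P t *v (N *v a)) \<bullet> (N *v b)"
    "(Q (d - t) *v a) \<bullet> b = - ((Q t *v (N *v a)) \<bullet> (N *v b))"
    "(R (d - t) *v a) \<bullet> b = (R t *v (N *v a)) \<bullet> (N *v b)" for t a b
    using refl unfolding reflection_covariant_def by blast+
  have neg: "P t *v ((-1) *\<^sub>R x) = - (P t *v x)" for t x
    using matrix_vector_mult_scaleR[of "P t" "-1" x] by simp
  show ?thesis
    unfolding energy_eq integral_reflect_Icc
    by (simp only: energy_density_def * mult_minus1 add_uminus_conv_diff neg)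
       (simp add: algebra_simps)
qed

text \<open>Reflection moves \<open>[d/2,d]\<close> to \<open>[0,d/2]\<close>, and shifts move every
  period to the first one, so each piece of \<open>[0,nd]\<close> other than
  \<open>[0,d/2]\<close> contributes nonnegative energy.\<close>

lemma energy_nonneg_fundamental_domain:
  assumes co: "sturm_coefficients P Q R"
    and sh: "shift_covariant d S P Q R" and refl: "reflection_covariant d N P Q R"
    and d: "d > 0"
    and nonneg: "\<And>u v. C1_path 0 (d / 2) u v \<Longrightarrow> energy P Q R 0 (d / 2) u v \<ge> 0"
    and u: "C1_path 0 (of_nat n * d) u v" and n: "n \<ge> 1"
  shows "energy P Q R 0 (d / 2) u v \<le> energy P Q R 0 (of_nat n * d) u v"
proof -
  have half: "energy P Q R (d / 2) d u v \<ge> 0" if "C1_path (d / 2) d u v" for u v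
  proof -
    have "C1_path 0 (d / 2) (\<lambda>t. N *v u (d + (-1) * t)) (\<lambda>t. (-1) *\<^sub>R (N *v v (d + (-1) * t)))"
      by (rule C1_path_affine_image[OF that]) auto
    from nonneg[OF this] show ?thesis
      using energy_reflect[OF refl, of "d / 2" 0 u v] by simp
  qed
  have period: "energy P Q R 0 d u v \<ge> 0" if "C1_path 0 d u v" for u v
  proof -
    have "C1_path 0 (d / 2) u v" "C1_path (d / 2) d u v"
      using d by (auto intro: C1_path_subset[OF that])
    then show ?thesis
      using energy_combine[OF co that, of "d / 2"] d nonneg half by fastforce
  qed
  have periods: "energy P Q R (of_nat k * d) (of_nat k * d + d) u v \<ge> 0"
    if "C1_path (of_nat k * d) (of_nat k * d + d) u v" for k u v
    using that
  proof (induction k arbitrary: u v)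
    case 0
    then show ?case using period by simp
  next
    case (Suc k)
    have e: "of_nat (Suc k) * d = of_nat k * d + d" by (simp add: algebra_simps)
    have "C1_path (of_nat k * d) (of_nat k * d + d)
        (\<lambda>t. S *v u (d + 1 * t)) (\<lambda>t. 1 *\<^sub>R (S *v v (d + 1 * t)))"
      by (rule C1_path_affine_image[OF Suc.prems]) (simp add: algebra_simps)
    from Suc.IH[OF this] show ?case
      unfolding e energy_shift[OF sh] .
  qed
  have "energy P Q R 0 (d / 2) u v \<le> energy P Q R 0 (of_nat (Suc k) * d) u v" if "Suc k \<le> n" for k
    using that
  proof (induction k)
    case 0
    then have "1 * d \<le> of_nat n * d" using d by (intro mult_right_mono) auto
    then have "C1_path 0 d u v" "C1_path (d / 2) d u v"
      using d by (auto intro: C1_path_subset[OF u])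
    then show ?case
      using energy_combine[OF co, of 0 d u v "d / 2"] d half by simp
  next
    case (Suc k)
    have e: "of_nat (Suc (Suc k)) * d = of_nat (Suc k) * d + d" by (simp add: algebra_simps)
    have "of_nat (Suc (Suc k)) * d \<le> of_nat n * d"
      using d Suc.prems by (intro mult_right_mono) simp_all
    then have le: "of_nat (Suc k) * d + d \<le> of_nat n * d" by (simp only: e)
    have pos: "0 \<le> of_nat (Suc k) * d" using d by simp
    have "C1_path 0 (of_nat (Suc k) * d + d) u v"
      using le by (intro C1_path_subset[OF u]) simp_all
    moreover have "C1_path (of_nat (Suc k) * d) (of_nat (Suc k) * d + d) u v"
      using le pos by (intro C1_path_subset[OF u]) simp_all
    ultimately have "energy P Q R 0 (of_nat (Suc k) * d) u v \<le> energy P Q R 0 (of_nat (Suc k) * d + d) u v"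
      using energy_combine[OF co, of 0 "of_nat (Suc k) * d + d" u v "of_nat (Suc k) * d"] periods[of "Suc k" u v] d pos
      by linarith
    then show ?case unfolding e using Suc by (meson Suc_leD order_trans)
  qed
  from this[of "n - 1"] n show ?thesis by simp
qed

section \<open>Energy of solutions and natural boundary conditions\<close>

definition sturm_solution ::
  "(real \<Rightarrow> real^'m^'m) \<Rightarrow> (real \<Rightarrow> real^'m^'m) \<Rightarrow> (real \<Rightarrow> real^'m^'m::finite) \<Rightarrow> real \<Rightarrow> real \<Rightarrow>
   (real \<Rightarrow> real^'m) \<Rightarrow> (real \<Rightarrow> real^'m) \<Rightarrow> bool" where
  "sturm_solution P Q R a b u v \<longleftrightarrow> C1_path a b u v \<and>
     (\<forall>t\<in>{a..b}. ((\<lambda>t. P t *v v t + Q t *v u t) has_vector_derivative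
        transpose (Q t) *v v t + R t *v u t) (at t within {a..b}))"

lemma transpose_inner:
  fixes A :: "real^'m^'m::finite"
  shows "(transpose A *v x) \<bullet> y = (A *v y) \<bullet> x"
  by (simp add: transpose_matrix_vector dot_lmul_matrix) (rule inner_commute)

text \<open>Along a solution the density against \<open>w\<close> is the derivative of \<open>\<langle>P
  u' + Q u, w\<rangle>\<close>.\<close>

lemma integral_energy_density_solution:
  assumes sol: "sturm_solution P Q R a b u v" and w: "C1_path a b w z" and ab: "a \<le> b"
  shows "integral {a..b} (\<lambda>t. energy_density P Q R t (u t) (v t) (w t) (z t))
    = (P b *v v b + Q b *v u b) \<bullet> w b - (P a *v v a + Q a *v u a) \<bullet> w a"
proof -
  have "((\<lambda>t. energy_density P Q R t (u t) (v t) (w t) (z t)) has_integral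
     (P b *v v b + Q b *v u b) \<bullet> w b - (P a *v v a + Q a *v u a) \<bullet> w a) {a..b}"
  proof (rule fundamental_theorem_of_calculus[OF ab])
    fix t assume t: "t \<in> {a..b}"
    have "((\<lambda>t. (P t *v v t + Q t *v u t) \<bullet> w t) has_vector_derivative
       ((P t *v v t + Q t *v u t) \<bullet> z t + (transpose (Q t) *v v t + R t *v u t) \<bullet> w t)) (at t within {a..b})"
      using sol w t unfolding sturm_solution_def C1_path_def
      by (intro bounded_bilinear.has_vector_derivative[OF bounded_bilinear_inner]) auto
    moreover have "(P t *v v t + Q t *v u t) \<bullet> z t + (transpose (Q t) *v v t + R t *v u t) \<bullet> w t
      = energy_density P Q R t (u t) (v t) (w t) (z t)"
      using transpose_inner[of "Q t" "v t" "w t"] by (simp add: energy_density_def inner_add_left)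
    ultimately show "((\<lambda>t. (P t *v v t + Q t *v u t) \<bullet> w t) has_vector_derivative
       energy_density P Q R t (u t) (v t) (w t) (z t)) (at t within {a..b})"
      by simp
  qed
  then show ?thesis by (rule integral_unique)
qed

lemma energy_solution:
  assumes "sturm_solution P Q R a b u v" "a \<le> b"
  shows "energy P Q R a b u v = (P b *v v b) \<bullet> u b - (P a *v v a) \<bullet> u a"
proof -
  have "C1_path a b u v" using assms(1) by (simp add: sturm_solution_def)
  from integral_energy_density_solution[OF assms(1) this assms(2)] show ?thesis
    unfolding energy_eq by (simp add: inner_add_left)
qed

lemma energy_add_scaled:
  assumes co: "sturm_coefficients P Q R" and u: "C1_path a b u v" and w: "C1_path a b w z"
  shows "energy P Q R a b (\<lambda>t. u t + l *\<^sub>R w t) (\<lambda>t. v t + l *\<^sub>R z t)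
    = energy P Q R a b u v + 2 * l * energy_form P Q R a b u v w z + l\<^sup>2 * energy P Q R a b w z"
proof -
  define D where "D = energy_density P Q R"
  have sym: "(P t *v x) \<bullet> y = (P t *v y) \<bullet> x" "(R t *v x) \<bullet> y = (R t *v y) \<bullet> x" for t x y
    using co unfolding sturm_coefficients_def by blast+
  have dens: "D t (u t + l *\<^sub>R w t) (v t + l *\<^sub>R z t) (u t + l *\<^sub>R w t) (v t + l *\<^sub>R z t)
     = D t (u t) (v t) (u t) (v t) + (2 * l) * D t (u t) (v t) (w t) (z t) + l\<^sup>2 * D t (w t) (z t) (w t) (z t)" for t
    unfolding D_def energy_density_def
    using sym(1)[of t "z t" "v t"] sym(2)[of t "w t" "u t"]
    by (simp add: matrix_vector_right_distrib matrix_vector_mult_scaleR inner_add_left inner_add_right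
        power2_eq_square algebra_simps)
  have int: "(\<lambda>t. D t (u t) (v t) (u t) (v t)) integrable_on {a..b}"
    "(\<lambda>t. D t (u t) (v t) (w t) (z t)) integrable_on {a..b}"
    "(\<lambda>t. D t (w t) (z t) (w t) (z t)) integrable_on {a..b}"
    unfolding D_def by (intro integrable_energy_density co u w)+
  have "integral {a..b} (\<lambda>t. D t (u t + l *\<^sub>R w t) (v t + l *\<^sub>R z t) (u t + l *\<^sub>R w t) (v t + l *\<^sub>R z t))
    = integral {a..b} (\<lambda>t. D t (u t) (v t) (u t) (v t)) + (2 * l) * integral {a..b} (\<lambda>t. D t (u t) (v t) (w t) (z t))
      + l\<^sup>2 * integral {a..b} (\<lambda>t. D t (w t) (z t) (w t) (z t))"
    unfolding dens by (intro integral_unique has_integral_add has_integral_mult_right integrable_integral int)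
  moreover have "boundary_form Q t (x + l *\<^sub>R y) (x + l *\<^sub>R y)
     = boundary_form Q t x x + 2 * l * boundary_form Q t x y + l\<^sup>2 * boundary_form Q t y y" for t x y
    unfolding boundary_form_def
    by (simp add: matrix_vector_right_distrib matrix_vector_mult_scaleR inner_add_left inner_add_right
        power2_eq_square algebra_simps)
  ultimately show ?thesis
    unfolding energy_def energy_form_def D_def[symmetric] by (simp add: algebra_simps)
qed

lemma linear_coeff_zero_of_nonneg:
  fixes B E :: real
  assumes "\<And>l. 0 \<le> 2 * l * B + l\<^sup>2 * E"
  shows "B = 0"
proof -
  \<comment> \<open>at \<open>l = - B / k\<close> the linear term \<open>- 2 B\<^sup>2 / k\<close> outweighs the quadratic one\<close>
  define k where "k = 1 + \<bar>E\<bar>"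
  have k: "k > 0" "E - 2 * k < 0" by (auto simp: k_def)
  have "0 \<le> 2 * (- B / k) * B + (- B / k)\<^sup>2 * E" by (rule assms)
  also have "\<dots> = (B / k)\<^sup>2 * (E - 2 * k)"
    using k(1) by (simp add: field_simps power2_eq_square)
  finally have "\<not> 0 < (B / k)\<^sup>2" using k(2) by (metis linorder_not_less mult_pos_neg)
  then show ?thesis using k(1) by simp
qed

text \<open>A minimizer is orthogonal to all paths \<open>w\<close>, and for a solution the energy form
  against \<open>w\<close> is the increment of \<open>\<langle>P u', w\<rangle>\<close>: the
  symmetry of \<open>Q\<close> at the ends removes the contribution of \<open>Q\<close>.
  Affine \<open>w\<close> vanishing at one end and equal to \<open>u'\<close> at the other
  give the claim.\<close>

lemma minimizer_natural_boundary_condition: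
  assumes co: "sturm_coefficients P Q R" and h: "h > 0"
    and sym: "\<And>x y. (Q 0 *v x) \<bullet> y = (Q 0 *v y) \<bullet> x" "\<And>x y. (Q h *v x) \<bullet> y = (Q h *v y) \<bullet> x"
    and nonneg: "\<And>u v. C1_path 0 h u v \<Longrightarrow> energy P Q R 0 h u v \<ge> 0"
    and sol: "sturm_solution P Q R 0 h u v" and zero: "energy P Q R 0 h u v = 0"
  shows "v 0 = 0" "v h = 0"
proof -
  have u: "C1_path 0 h u v" using sol by (simp add: sturm_solution_def)
  have form: "(P h *v v h) \<bullet> w h = (P 0 *v v 0) \<bullet> w 0" if w: "C1_path 0 h w z" for w z
  proof -
    have "energy_form P Q R 0 h u v w z = 0"
    proof (rule linear_coeff_zero_of_nonneg)
      fix l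
      show "0 \<le> 2 * l * energy_form P Q R 0 h u v w z + l\<^sup>2 * energy P Q R 0 h w z"
        using nonneg[OF C1_path_add_scaled[OF u w, of l]] energy_add_scaled[OF co u w, of l] zero by simp
    qed
    moreover have "boundary_form Q 0 (u 0) (w 0) = (Q 0 *v u 0) \<bullet> w 0"
      "boundary_form Q h (u h) (w h) = (Q h *v u h) \<bullet> w h"
      using sym(1)[of "w 0" "u 0"] sym(2)[of "w h" "u h"] by (simp_all add: boundary_form_def)
    ultimately show ?thesis
      using integral_energy_density_solution[OF sol w] h
      by (simp add: energy_form_def inner_add_left)
  qed
  have path: "C1_path 0 h (\<lambda>t. (\<alpha> + \<beta> * t) *\<^sub>R c) (\<lambda>t. \<beta> *\<^sub>R c)" for \<alpha> \<beta> :: real and c :: "real^'a"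
  proof -
    have "((\<lambda>t. (\<alpha> + \<beta> * t)) has_vector_derivative \<beta>) (at t within {0..h})" for t
      unfolding has_real_derivative_iff_has_vector_derivative[symmetric]
      by (auto intro!: derivative_eq_intros)
    then have "((\<lambda>t. (\<alpha> + \<beta> * t) *\<^sub>R c) has_vector_derivative \<beta> *\<^sub>R c) (at t within {0..h})" for t
      by (rule bounded_linear.has_vector_derivative[OF bounded_linear_scaleR_left])
    then show ?thesis unfolding C1_path_def by simp
  qed
  have pos: "x = 0" if "(P t *v x) \<bullet> x = 0" for t x
    using co that unfolding sturm_coefficients_def by (metis less_irrefl)
  show "v 0 = 0"
    using form[OF path[of 1 "- (1 / h)" "v 0"]] h by (intro pos[of 0]) simp
  show "v h = 0"
    using form[OF path[of 0 "1 / h" "v h"]] h by (intro pos[of h]) simp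
qed

section \<open>The Sturm operator in terms of the energy\<close>

lemma bounded_linear_axis_complex: "bounded_linear (\<lambda>z::complex. (axis i z :: complex^'m::finite))"
  by (intro linear_conv_bounded_linear[THEN iffD1] linearI) (simp_all add: vec_eq_iff axis_def)

lemma vec_sum_axis: "(x :: complex^'m::finite) = (\<Sum>i\<in>UNIV. axis i (x $ i))"
  by (simp add: vec_eq_iff axis_def)

lemma norm_vec_power2: "(norm (x :: complex^'m::finite))\<^sup>2 = (\<Sum>i\<in>UNIV. (norm (x $ i))\<^sup>2)"
  unfolding norm_vec_def L2_set_def by (intro real_sqrt_pow2 sum_nonneg) simp

lemma has_L2_derivative_iff_weak:
  fixes u g :: "real \<Rightarrow> complex^'m::finite"
  assumes h: "h \<ge> 0"
  shows "has_L2_derivative h u g \<longleftrightarrow> (\<forall>i. has_weak_deriv h (\<lambda>t. u t $ i) (\<lambda>t. g t $ i))"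
proof
  assume L: "has_L2_derivative h u g"
  then have g: "g absolutely_integrable_on {0..h}"
    and g2: "(\<lambda>t. (norm (g t))\<^sup>2) absolutely_integrable_on {0..h}"
    and u: "\<And>t. t \<in> {0..h} \<Longrightarrow> u t = u 0 + (LINT s:{0..t}|lebesgue. g s)"
    unfolding has_L2_derivative_def by blast+
  show "\<forall>i. has_weak_deriv h (\<lambda>t. u t $ i) (\<lambda>t. g t $ i)"
  proof
    fix i
    have gi: "(\<lambda>t. g t $ i) absolutely_integrable_on {0..h}"
      using absolutely_integrable_linear[OF g bounded_linear_vec_nth[of i]] by (simp add: o_def)
    have "(\<lambda>t. (norm (g t $ i))\<^sup>2) absolutely_integrable_on {0..h}"
    proof (rule measurable_bounded_by_integrable_imp_absolutely_integrable)
      show "(\<lambda>t. (norm (g t $ i))\<^sup>2) \<in> borel_measurable (lebesgue_on {0..h})"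
        using absolutely_integrable_imp_borel_measurable[OF gi]
        by (intro borel_measurable_power borel_measurable_norm) auto
      show "(\<lambda>t. (norm (g t))\<^sup>2) integrable_on {0..h}"
        using g2 by (rule set_lebesgue_integral_eq_integral(1))
      show "norm ((norm (g t $ i))\<^sup>2) \<le> (norm (g t))\<^sup>2" for t
        by (simp add: power_mono Finite_Cartesian_Product.norm_nth_le)
    qed auto
    moreover have "integral {0..t} (\<lambda>t. g t $ i) = u t $ i - u 0 $ i" if t: "t \<in> {0..h}" for t
    proof -
      have gt: "g absolutely_integrable_on {0..t}"
        using t by (intro absolutely_integrable_on_subinterval[OF g]) auto
      have "integral {0..t} (\<lambda>t. g t $ i) = integral {0..t} g $ i"
        using integral_linear[OF set_lebesgue_integral_eq_integral(1)[OF gt] bounded_linear_vec_nth[of i]]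
        by (simp add: o_def)
      then show ?thesis
        using arg_cong[OF u[OF t], of "\<lambda>x. x $ i"] set_lebesgue_integral_eq_integral(2)[OF gt] by simp
    qed
    ultimately show "has_weak_deriv h (\<lambda>t. u t $ i) (\<lambda>t. g t $ i)"
      using gi by (simp add: has_weak_deriv_def sq_integrable_def)
  qed
next
  assume R: "\<forall>i. has_weak_deriv h (\<lambda>t. u t $ i) (\<lambda>t. g t $ i)"
  have gi: "(\<lambda>t. g t $ i) absolutely_integrable_on {0..h}"
    and g2: "(\<lambda>t. (norm (g t $ i))\<^sup>2) absolutely_integrable_on {0..h}"
    and ui: "\<And>t. t \<in> {0..h} \<Longrightarrow> integral {0..t} (\<lambda>t. g t $ i) = u t $ i - u 0 $ i" for i
    using R by (simp_all add: has_weak_deriv_def sq_integrable_def)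
  have "(\<lambda>t. \<Sum>i\<in>UNIV. axis i (g t $ i)) absolutely_integrable_on {0..h}"
    using absolutely_integrable_linear[OF gi bounded_linear_axis_complex]
    by (intro absolutely_integrable_sum) (simp_all add: o_def)
  then have g: "g absolutely_integrable_on {0..h}"
    unfolding vec_sum_axis[symmetric] .
  moreover have "(\<lambda>t. (norm (g t))\<^sup>2) absolutely_integrable_on {0..h}"
    unfolding norm_vec_power2 by (intro absolutely_integrable_sum g2) simp
  moreover have "u t = u 0 + (LINT s:{0..t}|lebesgue. g s)" if t: "t \<in> {0..h}" for t
  proof -
    have gt: "g absolutely_integrable_on {0..t}"
      using t by (intro absolutely_integrable_on_subinterval[OF g]) auto
    have "integral {0..t} g $ i = u t $ i - u 0 $ i" for i
      using integral_linear[OF set_lebesgue_integral_eq_integral(1)[OF gt] bounded_linear_vec_nth[of i]] ui[OF t, of i]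
      by (simp add: o_def)
    then show ?thesis
      using set_lebesgue_integral_eq_integral(2)[OF gt] by (simp add: vec_eq_iff)
  qed
  ultimately show "has_L2_derivative h u g" unfolding has_L2_derivative_def by blast
qed

text \<open>Paths in \<open>W\<^sup>2\<^sup>,\<^sup>2\<close>, given together with their velocity.\<close>

definition complex_path :: "real \<Rightarrow> (real \<Rightarrow> complex^'m::finite) \<Rightarrow> (real \<Rightarrow> complex^'m) \<Rightarrow> bool" where
  "complex_path h u v \<longleftrightarrow>
     (\<forall>t\<in>{0..h}. (u has_vector_derivative v t) (at t within {0..h})) \<and>
     (\<forall>i. \<exists>g. has_weak_deriv h (\<lambda>t. v t $ i) g)"

lemma deriv_on_eq:
  assumes "h > 0" "t \<in> {0..h}" "(u has_vector_derivative v) (at t within {0..h})"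
  shows "deriv_on h u t = v"
  unfolding deriv_on_def using assms vector_derivative_within_cbox[of 0 h t u v] by simp

lemma complex_path_components:
  assumes "complex_path h u v"
  shows "continuous_on {0..h} (\<lambda>t. v t $ i)" "has_weak_deriv h (\<lambda>t. u t $ i) (\<lambda>t. v t $ i)"
    "continuous_on {0..h} (\<lambda>t. u t $ i)"
proof -
  show v: "continuous_on {0..h} (\<lambda>t. v t $ i)"
    using assms has_weak_deriv_continuous unfolding complex_path_def by blast
  show "has_weak_deriv h (\<lambda>t. u t $ i) (\<lambda>t. v t $ i)"
  proof (rule has_weak_deriv_C1[OF _ v])
    fix t assume "t \<in> {0..h}"
    then have "(u has_vector_derivative v t) (at t within {0..h})" using assms by (simp add: complex_path_def)
    then show "((\<lambda>t. u t $ i) has_vector_derivative v t $ i) (at t within {0..h})"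
      by (rule bounded_linear.has_vector_derivative[OF bounded_linear_vec_nth])
  qed
  then show "continuous_on {0..h} (\<lambda>t. u t $ i)" by (rule has_weak_deriv_continuous)
qed

lemma has_weak_deriv_cong_deriv:
  assumes "has_weak_deriv h f g" "\<And>t. t \<in> {0..h} \<Longrightarrow> g t = g' t"
  shows "has_weak_deriv h f g'"
proof -
  have "integral {0..t} g' = integral {0..t} g" if "t \<in> {0..h}" for t
    using that assms(2) by (intro Henstock_Kurzweil_Integration.integral_cong) auto
  moreover have "g' absolutely_integrable_on {0..h} \<longleftrightarrow> g absolutely_integrable_on {0..h}"
    using assms(2) by (intro set_integrable_cong) auto
  moreover have "(\<lambda>t. (norm (g' t))\<^sup>2) absolutely_integrable_on {0..h}
      \<longleftrightarrow> (\<lambda>t. (norm (g t))\<^sup>2) absolutely_integrable_on {0..h}"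
    using assms(2) by (intro set_integrable_cong) auto
  ultimately show ?thesis
    using assms(1) by (simp add: has_weak_deriv_def sq_integrable_def)
qed

lemma complex_path_in_E2:
  assumes h: "h > 0" and u: "complex_path h u v" and ends: "v 0 = 0" "v h = 0"
  shows "u \<in> E2 h"
proof -
  have d: "deriv_on h u t = v t" if "t \<in> {0..h}" for t
    using u that by (intro deriv_on_eq h that) (simp add: complex_path_def)
  have "has_L2_derivative h u (deriv_on h u)"
    unfolding has_L2_derivative_iff_weak[OF less_imp_le[OF h]]
  proof
    fix i show "has_weak_deriv h (\<lambda>t. u t $ i) (\<lambda>t. deriv_on h u t $ i)"
      by (rule has_weak_deriv_cong_deriv[OF complex_path_components(2)[OF u]]) (simp add: d)
  qed
  moreover obtain g where g: "\<And>i. has_weak_deriv h (\<lambda>t. v t $ i) (g i)"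
    using u unfolding complex_path_def by metis
  have "has_L2_derivative h (deriv_on h u) (\<lambda>t. \<chi> i. g i t)"
    unfolding has_L2_derivative_iff_weak[OF less_imp_le[OF h]]
  proof
    fix i show "has_weak_deriv h (\<lambda>t. deriv_on h u t $ i) (\<lambda>t. (\<chi> i. g i t) $ i)"
      using has_weak_deriv_cong[OF g[of i], of "\<lambda>t. deriv_on h u t $ i"] d h by simp
  qed
  ultimately show ?thesis
    using d[of 0] d[of h] ends h unfolding E2_def W22_def by auto
qed

lemma has_weak_deriv_has_integral:
  assumes "has_weak_deriv h f g" "h \<ge> 0"
  shows "(g has_integral f h - f 0) {0..h}"
proof -
  have "integral {0..h} g = f h - f 0"
    using assms unfolding has_weak_deriv_def by simp
  then show ?thesis
    using integrable_integral[OF has_weak_deriv_integrable[OF assms(1)]] by simp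
qed

lemma continuous_on_cmat_mult:
  fixes M :: "real \<Rightarrow> real^'m^'m::finite"
  assumes "continuous_on A M" "\<And>i. continuous_on A (\<lambda>t. u t $ i)"
  shows "continuous_on A (\<lambda>t. (cmat (M t) *v u t) $ i)"
  unfolding matrix_vector_mult_def map_matrix_def vec_lambda_beta
  by (intro continuous_intros assms)

text \<open>The integrand left after integrating \<open>\<langle>\<A>u, u\<rangle>\<close> by parts
  once.\<close>

definition hermitian_density ::
  "(real \<Rightarrow> real^'m^'m) \<Rightarrow> (real \<Rightarrow> real^'m^'m) \<Rightarrow> (real \<Rightarrow> real^'m^'m::finite) \<Rightarrow>
   real \<Rightarrow> complex^'m \<Rightarrow> complex^'m \<Rightarrow> complex" where
  "hermitian_density P Q R t u v =
     hermitian_inner (cmat (P t) *v v) v + hermitian_inner (cmat (Q t) *v u) v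
     + hermitian_inner (cmat (transpose (Q t)) *v v) u + hermitian_inner (cmat (R t) *v u) u"

lemma hermitian_inner_add_left: "hermitian_inner (a + b) c = hermitian_inner a c + hermitian_inner b c"
  by (simp add: hermitian_inner_def distrib_right sum.distrib)

lemma continuous_on_hermitian_density:
  fixes P Q R :: "real \<Rightarrow> real^'m^'m::finite"
  assumes co: "sturm_coefficients P Q R" and u: "complex_path h u v"
  shows "continuous_on {0..h} (\<lambda>t. hermitian_density P Q R t (u t) (v t))"
proof -
  have c: "continuous_on {0..h} P" "continuous_on {0..h} Q" "continuous_on {0..h} R"
    using co by (auto simp: sturm_coefficients_def intro: continuous_on_subset)
  then have cT: "continuous_on {0..h} (\<lambda>t. transpose (Q t))"
    unfolding transpose_def by (intro continuous_on_vec_lambda continuous_on_component)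
  show ?thesis
    unfolding hermitian_density_def hermitian_inner_def
    by (intro continuous_on_add continuous_on_sum continuous_on_mult continuous_on_cnj
        continuous_on_cmat_mult c cT complex_path_components[OF u])
qed

text \<open>With \<open>G = P u' + Q u\<close> and \<open>G' = g\<close>, the product rule gives
  \<open>\<integral>\<langle>-g, u\<rangle> = \<integral>\<langle>G, u'\<rangle> -
  [\<langle>G, u\<rangle>]\<close>. At the ends \<open>u' = 0\<close>, so there
  \<open>G\<close> reduces to \<open>Q u\<close>.\<close>

lemma sturm_positive_definite_path:
  fixes P Q R :: "real \<Rightarrow> real^'m^'m::finite"
  assumes co: "sturm_coefficients P Q R" and pd: "sturm_positive_definite h P Q R"
    and h: "h > 0" and u: "complex_path h u v" and ends: "v 0 = 0" "v h = 0"
    and nz: "\<exists>t\<in>{0..h}. u t \<noteq> 0"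
  defines "I \<equiv> integral {0..h} (\<lambda>t. hermitian_density P Q R t (u t) (v t))
      - (hermitian_inner (cmat (Q h) *v u h) (u h) - hermitian_inner (cmat (Q 0) *v u 0) (u 0))"
  shows "I \<in> \<real>" and "0 < Re I"
    and "\<exists>g. \<forall>i. has_weak_deriv h (\<lambda>t. (cmat (P t) *v v t + cmat (Q t) *v u t) $ i) (g i)"
proof -
  have h0: "h \<ge> 0" using h by simp
  have d: "deriv_on h u t = v t" if "t \<in> {0..h}" for t
    using u that by (intro deriv_on_eq h that) (simp add: complex_path_def)
  obtain w where w: "sturm h P Q R u w"
    and real: "(LINT t:{0..h}|lebesgue. hermitian_inner (w t) (u t)) \<in> \<real>"
    and pos: "0 < Re (LINT t:{0..h}|lebesgue. hermitian_inner (w t) (u t))"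
    using pd complex_path_in_E2[OF h u ends] nz unfolding sturm_positive_definite_def by blast
  obtain g where g: "has_L2_derivative h (\<lambda>t. cmat (P t) *v deriv_on h u t + cmat (Q t) *v u t) g"
    and w_eq: "\<And>t. t\<in>{0..h} \<Longrightarrow> w t = - g t + cmat (transpose (Q t)) *v deriv_on h u t + cmat (R t) *v u t"
    using w unfolding sturm_def by blast
  define G where "G t = cmat (P t) *v v t + cmat (Q t) *v u t" for t
  have G: "has_weak_deriv h (\<lambda>t. G t $ i) (\<lambda>t. g t $ i)" for i
  proof -
    have "has_weak_deriv h (\<lambda>t. (cmat (P t) *v deriv_on h u t + cmat (Q t) *v u t) $ i) (\<lambda>t. g t $ i)"
      using g unfolding has_L2_derivative_iff_weak[OF h0] by (rule spec)
    then show ?thesis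
      by (rule has_weak_deriv_cong) (simp_all add: d G_def h0)
  qed
  then show "\<exists>g. \<forall>i. has_weak_deriv h (\<lambda>t. (cmat (P t) *v v t + cmat (Q t) *v u t) $ i) (g i)"
    unfolding G_def by (intro exI[of _ "\<lambda>i t. g t $ i"]) simp
  have ucnj: "has_weak_deriv h (\<lambda>t. cnj (u t $ i)) (\<lambda>t. cnj (v t $ i))" for i
  proof (rule has_weak_deriv_C1)
    fix t assume "t \<in> {0..h}"
    then have "(u has_vector_derivative v t) (at t within {0..h})" using u by (simp add: complex_path_def)
    then have "((\<lambda>t. u t $ i) has_vector_derivative v t $ i) (at t within {0..h})"
      by (rule bounded_linear.has_vector_derivative[OF bounded_linear_vec_nth])
    then show "((\<lambda>t. cnj (u t $ i)) has_vector_derivative cnj (v t $ i)) (at t within {0..h})"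
      by (rule has_vector_derivative_cnj)
  qed (intro continuous_on_cnj complex_path_components[OF u])
  define b where "b t = (\<Sum>i\<in>UNIV. G t $ i * cnj (v t $ i) + cnj (u t $ i) * (g t $ i))" for t
  have B: "has_weak_deriv h (\<lambda>t. \<Sum>i\<in>UNIV. G t $ i * cnj (u t $ i)) b"
    unfolding b_def by (intro has_weak_deriv_sum has_weak_deriv_mult G ucnj) simp
  let ?K = "\<lambda>t. hermitian_density P Q R t (u t) (v t)"
  have split: "hermitian_inner (w t) (u t) = ?K t - b t" if t: "t \<in> {0..h}" for t
  proof -
    have "b t = hermitian_inner (G t) (v t) + hermitian_inner (g t) (u t)"
      by (simp add: b_def hermitian_inner_def sum.distrib mult.commute)
    moreover have "hermitian_inner (w t) (u t) = - hermitian_inner (g t) (u t)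
        + hermitian_inner (cmat (transpose (Q t)) *v v t) (u t) + hermitian_inner (cmat (R t) *v u t) (u t)"
      unfolding w_eq[OF t] d[OF t] hermitian_inner_add_left
      by (simp add: hermitian_inner_def sum_negf)
    ultimately show ?thesis
      by (simp add: hermitian_density_def G_def hermitian_inner_add_left)
  qed
  note Kc = continuous_on_hermitian_density[OF co u]
  have abs: "(\<lambda>t. ?K t - b t) absolutely_integrable_on {0..h}"
    using B absolutely_integrable_continuous_real[OF Kc]
    by (intro set_integral_diff(1)) (simp_all add: has_weak_deriv_def sq_integrable_def)
  have "(LINT t:{0..h}|lebesgue. hermitian_inner (w t) (u t)) = (LINT t:{0..h}|lebesgue. ?K t - b t)"
    by (intro set_lebesgue_integral_cong) (auto simp: split)
  also have "\<dots> = integral {0..h} (\<lambda>t. ?K t - b t)"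
    by (rule set_lebesgue_integral_eq_integral(2)[OF abs])
  also have "\<dots> = integral {0..h} ?K - ((\<Sum>i\<in>UNIV. G h $ i * cnj (u h $ i)) - (\<Sum>i\<in>UNIV. G 0 $ i * cnj (u 0 $ i)))"
    by (intro integral_unique has_integral_diff integrable_integral integrable_continuous_real Kc
        has_weak_deriv_has_integral[OF B h0])
  also have "\<dots> = I"
    by (simp add: I_def G_def ends hermitian_inner_def)
  finally show "I \<in> \<real>" "0 < Re I" using real pos by simp_all
qed

section \<open>What positivity and the domain of the operator force on the coefficients\<close>

definition cvec :: "real^'m \<Rightarrow> complex^'m::finite" where
  "cvec a = (\<chi> i. complex_of_real (a $ i))"

lemma cvec_nth [simp]: "cvec a $ i = complex_of_real (a $ i)"
  by (simp add: cvec_def)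

lemma bounded_linear_cvec: "bounded_linear (cvec :: real^'m \<Rightarrow> complex^'m::finite)"
  by (intro linear_conv_bounded_linear[THEN iffD1] linearI)
    (simp_all add: vec_eq_iff scaleR_conv_of_real[where 'a=complex])

lemma cmat_cvec: "cmat A *v cvec a = cvec ((A :: real^'m^'m::finite) *v a)"
  by (simp add: vec_eq_iff matrix_vector_mult_def)

lemma hermitian_inner_cvec: "hermitian_inner (cvec a) (cvec b) = complex_of_real (a \<bullet> b)"
  by (simp add: hermitian_inner_def inner_vec_def)

lemma complex_path_cvec:
  assumes u: "C1_path 0 h u v" and v: "\<And>i. \<exists>g. has_weak_deriv h (\<lambda>t. complex_of_real (v t $ i)) g"
  shows "complex_path h (\<lambda>t. cvec (u t)) (\<lambda>t. cvec (v t))"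
  unfolding complex_path_def
proof (intro conjI ballI allI)
  fix t assume "t \<in> {0..h}"
  then have "(u has_vector_derivative v t) (at t within {0..h})" using u by (simp add: C1_path_def)
  then show "((\<lambda>t. cvec (u t)) has_vector_derivative cvec (v t)) (at t within {0..h})"
    by (rule bounded_linear.has_vector_derivative[OF bounded_linear_cvec])
qed (simp add: v)

lemma integral_complex_of_real:
  assumes "f integrable_on S"
  shows "integral S (\<lambda>t. complex_of_real (f t)) = complex_of_real (integral S f)"
  by (rule integral_unique[OF has_integral_of_real[OF integrable_integral[OF assms]]])

text \<open>On real paths the integrated form of \<open>sturm_positive_definite_path\<close> is the
  energy.\<close>

lemma energy_pos_of_sturm_positive_definite:
  fixes P Q R :: "real \<Rightarrow> real^'m^'m::finite"
  assumes co: "sturm_coefficients P Q R" and pd: "sturm_positive_definite h P Q R" and h: "h > 0"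
    and u: "C1_path 0 h u v" and v: "\<And>i. \<exists>g. has_weak_deriv h (\<lambda>t. complex_of_real (v t $ i)) g"
    and ends: "v 0 = 0" "v h = 0" and nz: "\<exists>t\<in>{0..h}. u t \<noteq> 0"
  shows "energy P Q R 0 h u v > 0"
proof -
  have dens: "hermitian_density P Q R t (cvec x) (cvec y) = complex_of_real (energy_density P Q R t x y x y)" for t x y
    using transpose_inner[of "Q t" y x]
    by (simp add: hermitian_density_def energy_density_def cmat_cvec hermitian_inner_cvec)
  have z: "cvec 0 = (0 :: complex^'m)" by (simp add: vec_eq_iff)
  have nz': "\<exists>t\<in>{0..h}. cvec (u t) \<noteq> 0"
    using nz by (auto simp: vec_eq_iff)
  have "0 < Re (integral {0..h} (\<lambda>t. hermitian_density P Q R t (cvec (u t)) (cvec (v t)))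
      - (hermitian_inner (cmat (Q h) *v cvec (u h)) (cvec (u h)) - hermitian_inner (cmat (Q 0) *v cvec (u 0)) (cvec (u 0))))"
    by (rule sturm_positive_definite_path(2)[OF co pd h complex_path_cvec[OF u v] _ _ nz']) (simp_all add: ends z)
  then show ?thesis
    unfolding dens integral_complex_of_real[OF integrable_energy_density[OF co u u]] cmat_cvec hermitian_inner_cvec energy_eq
    by simp
qed

text \<open>The imaginary part of a real form at \<open>a + i b\<close> measures its skew-symmetric
  part.\<close>

lemma Im_hermitian_form:
  fixes A :: "real^'m^'m::finite" and a b :: "real^'m"
  shows "Im (hermitian_inner (cmat A *v (cvec a + \<i> *s cvec b)) (cvec a + \<i> *s cvec b))
    = (A *v b) \<bullet> a - (A *v a) \<bullet> b"
proof -
  let ?c = "cvec a + \<i> *s cvec b"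
  have "Im ((cmat A *v ?c) $ i * cnj (?c $ i)) = (A *v b) $ i * a $ i - (A *v a) $ i * b $ i" for i
  proof -
    have "(cmat A *v ?c) $ i = Complex ((A *v a) $ i) ((A *v b) $ i)"
      by (simp add: matrix_vector_mult_def complex_eq_iff)
    then show ?thesis by simp
  qed
  then show ?thesis
    unfolding hermitian_inner_def inner_vec_def by (simp add: sum_subtractf)
qed

lemma hermitian_inner_scaled:
  "hermitian_inner (cmat A *v (complex_of_real r *s c)) (complex_of_real q *s d)
    = complex_of_real (r * q) * hermitian_inner (cmat A *v c) (d :: complex^'m::finite)"
proof -
  have "cmat A *v (complex_of_real r *s c) = complex_of_real r *s (cmat A *v c)"
    by (simp add: vec_eq_iff matrix_vector_mult_def sum_distrib_left mult_ac)
  then show ?thesis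
    by (simp add: hermitian_inner_def sum_distrib_left mult_ac)
qed

text \<open>Test paths \<open>r(t) (a + i b)\<close> with a real scalar \<open>r\<close>. The integrand
  has imaginary part zero because \<open>P\<close>, \<open>R\<close> and \<open>Q +
  Q\<^sup>T\<close> are symmetric, so reality of the total says that
  \<open>r(t)\<^sup>2\<close> times the skew part of \<open>Q t\<close> has the same value at
  both ends. Letting \<open>r\<close> vanish at one end only makes both skew parts zero.\<close>

lemma hermitian_coefficient_symmetric_at_ends:
  fixes P Q R :: "real \<Rightarrow> real^'m^'m::finite"
  assumes co: "sturm_coefficients P Q R" and pd: "sturm_positive_definite h P Q R" and h: "h > 0"
  shows "(Q 0 *v a) \<bullet> b = (Q 0 *v b) \<bullet> a" "(Q h *v a) \<bullet> b = (Q h *v b) \<bullet> a"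
proof -
  let ?c = "cvec a + \<i> *s cvec b"
  have Im_of_real_mult: "Im (complex_of_real x * z) = x * Im z" for x z by simp
  have sym: "(P t *v x) \<bullet> y = (P t *v y) \<bullet> x" "(R t *v x) \<bullet> y = (R t *v y) \<bullet> x" for t x y
    using co unfolding sturm_coefficients_def by blast+
  have key: "r 0 * r 0 * ((Q 0 *v b) \<bullet> a - (Q 0 *v a) \<bullet> b) = r h * r h * ((Q h *v b) \<bullet> a - (Q h *v a) \<bullet> b)"
    if c: "?c \<noteq> 0" and r: "\<And>t. (r has_real_derivative r' t) (at t)" and r': "\<And>t. (r' has_real_derivative r'' t) (at t)"
      and cont: "continuous_on {0..h} r''" and ends: "r' 0 = 0" "r' h = 0" and nz: "r 0 \<noteq> 0 \<or> r h \<noteq> 0" for r r' r''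
  proof -
    define u where "u t = complex_of_real (r t) *s ?c" for t
    define v where "v t = complex_of_real (r' t) *s ?c" for t
    have scl: "complex_of_real x *s ?c = x *\<^sub>R ?c" for x
      by (simp add: vec_eq_iff scaleR_conv_of_real[where 'a=complex] distrib_left)
    have der: "(f has_vector_derivative f' t) (at t within {0..h})" if "\<And>t. (f has_real_derivative f' t) (at t)" for f f' t
      using that has_vector_derivative_at_within has_real_derivative_iff_has_vector_derivative by blast
    have path: "complex_path h u v"
      unfolding complex_path_def
    proof (intro conjI ballI allI)
      fix t
      show "(u has_vector_derivative v t) (at t within {0..h})"
        unfolding u_def v_def scl
        by (rule bounded_linear.has_vector_derivative[OF bounded_linear_scaleR_left der[OF r]])
    next
      fix i
      have "has_weak_deriv h (\<lambda>t. v t $ i) (\<lambda>t. (r'' t *\<^sub>R ?c) $ i)"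
      proof (rule has_weak_deriv_C1)
        fix t
        have "((\<lambda>t. r' t *\<^sub>R ?c) has_vector_derivative r'' t *\<^sub>R ?c) (at t within {0..h})"
          by (rule bounded_linear.has_vector_derivative[OF bounded_linear_scaleR_left der[OF r']])
        then show "((\<lambda>t. v t $ i) has_vector_derivative (r'' t *\<^sub>R ?c) $ i) (at t within {0..h})"
          unfolding v_def scl by (rule bounded_linear.has_vector_derivative[OF bounded_linear_vec_nth])
      qed (intro continuous_on_component continuous_on_scaleR continuous_on_const cont)
      then show "\<exists>g. has_weak_deriv h (\<lambda>t. v t $ i) g" by blast
    qed
    have "u 0 \<noteq> 0 \<or> u h \<noteq> 0" using nz c unfolding u_def scl by auto
    then have nzu: "\<exists>t\<in>{0..h}. u t \<noteq> 0" using h by (meson atLeastAtMost_iff less_imp_le order_refl)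
    have v0: "v 0 = 0" "v h = 0" using ends by (simp_all add: v_def)
    let ?K = "\<lambda>t. hermitian_density P Q R t (u t) (v t)"
    have ImK: "Im (?K t) = 0" for t
    proof -
      have "Im (?K t) = r' t * r' t * ((P t *v b) \<bullet> a - (P t *v a) \<bullet> b)
         + r t * r' t * ((Q t *v b) \<bullet> a - (Q t *v a) \<bullet> b)
         + r' t * r t * ((transpose (Q t) *v b) \<bullet> a - (transpose (Q t) *v a) \<bullet> b)
         + r t * r t * ((R t *v b) \<bullet> a - (R t *v a) \<bullet> b)"
        unfolding hermitian_density_def u_def v_def hermitian_inner_scaled
        by (simp only: plus_complex.sel Im_of_real_mult Im_hermitian_form)
      also have "\<dots> = 0"
        unfolding sym(1)[of t b a] sym(2)[of t b a] transpose_inner by (simp add: algebra_simps)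
      finally show ?thesis .
    qed
    have "Im (integral {0..h} ?K) = integral {0..h} (\<lambda>t. Im (?K t))"
      using integral_linear[OF integrable_continuous_real[OF continuous_on_hermitian_density[OF co path]] bounded_linear_Im]
      by (simp add: o_def)
    then have "Im (integral {0..h} ?K) = 0" by (simp add: ImK)
    moreover have "Im (integral {0..h} ?K
      - (hermitian_inner (cmat (Q h) *v u h) (u h) - hermitian_inner (cmat (Q 0) *v u 0) (u 0))) = 0"
      using sturm_positive_definite_path(1)[OF co pd h path v0 nzu] by (rule complex_is_Real_iff[THEN iffD1])
    ultimately have "Im (hermitian_inner (cmat (Q h) *v u h) (u h)) = Im (hermitian_inner (cmat (Q 0) *v u 0) (u 0))"
      by simp
    then show ?thesis
      unfolding u_def hermitian_inner_scaled Im_of_real_mult Im_hermitian_form by simp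
  qed
  have "(Q 0 *v b) \<bullet> a - (Q 0 *v a) \<bullet> b = 0 \<and> (Q h *v b) \<bullet> a - (Q h *v a) \<bullet> b = 0"
  proof (cases "?c = 0")
    case True
    have "a $ i = 0 \<and> b $ i = 0" for i
      using arg_cong[OF True, of "\<lambda>x. x $ i"] by (simp add: complex_eq_iff)
    then have "a = 0" "b = 0" by (simp_all add: vec_eq_iff)
    then show ?thesis by simp
  next
    case False
    \<comment> \<open>\<open>1 + cos (k t)\<close> vanishes at \<open>h\<close>, \<open>1 - cos (k t)\<close> vanishes at 0, and both have zero slope at the ends\<close>
    define k where "k = pi / h"
    have kh: "k * h = pi" using h by (simp add: k_def)
    have "((\<lambda>t. 1 + s * cos (k * t)) has_real_derivative - (s * k * sin (k * t))) (at t)"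
      "((\<lambda>t. - (s * k * sin (k * t))) has_real_derivative - (s * k * k * cos (k * t))) (at t)" for s t
      by (auto intro!: derivative_eq_intros)
    moreover have "continuous_on {0..h} (\<lambda>t. - (s * k * k * cos (k * t)))" for s
      by (intro continuous_intros)
    ultimately have "(1 + s) * (1 + s) * ((Q 0 *v b) \<bullet> a - (Q 0 *v a) \<bullet> b)
        = (1 - s) * (1 - s) * ((Q h *v b) \<bullet> a - (Q h *v a) \<bullet> b)" if "s \<noteq> 0" for s
      using key[OF False, of "\<lambda>t. 1 + s * cos (k * t)" "\<lambda>t. - (s * k * sin (k * t))"
          "\<lambda>t. - (s * k * k * cos (k * t))"] that by (simp add: kh)
    from this[of 1] this[of "-1"] show ?thesis by simp
  qed
  then show "(Q 0 *v a) \<bullet> b = (Q 0 *v b) \<bullet> a" "(Q h *v a) \<bullet> b = (Q h *v b) \<bullet> a" by simp_all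
qed

text \<open>Membership of \<open>u\<close> in the domain makes \<open>P u' + Q u\<close> weakly
  differentiable. A constant path isolates a column of \<open>Q\<close>; a path with velocity
  \<open>f\<close> times a basis vector then isolates \<open>P f\<close>.\<close>

lemma sturm_domain_coefficients:
  fixes P Q R :: "real \<Rightarrow> real^'m^'m::finite"
  assumes co: "sturm_coefficients P Q R" and pd: "sturm_positive_definite h P Q R" and h: "h > 0"
  shows "\<exists>g. has_weak_deriv h (\<lambda>t. complex_of_real (Q t $ k $ j)) g"
    and "has_weak_deriv h f f' \<Longrightarrow> f 0 = 0 \<Longrightarrow> f h = 0 \<Longrightarrow>
      \<exists>g. has_weak_deriv h (\<lambda>t. complex_of_real (P t $ k $ j) * f t) g"
proof -
  have cm: "(cmat A *v axis j z) $ k = complex_of_real (A $ k $ j) * z" for A :: "real^'m^'m" and z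
    by (simp add: matrix_vector_mult_def axis_def if_distrib[of "\<lambda>x. _ * x"] sum.delta cong: if_cong)
  have main: "\<exists>g. has_weak_deriv h (\<lambda>t. complex_of_real (P t $ k $ j) * f t
        + complex_of_real (Q t $ k $ j) * (1 + integral {0..t} f)) g"
    if f: "has_weak_deriv h f f'" and ends: "f 0 = 0" "f h = 0" for f f'
  proof -
    \<comment> \<open>the summand 1 keeps the path nonzero even if \<open>f\<close> vanishes\<close>
    define u :: "real \<Rightarrow> complex^'m" where "u t = axis j (1 + integral {0..t} f)" for t
    define v :: "real \<Rightarrow> complex^'m" where "v t = axis j (f t)" for t
    have path: "complex_path h u v"
      unfolding complex_path_def
    proof (intro conjI ballI allI)
      fix t assume "t \<in> {0..h}"
      then have "((\<lambda>t. integral {0..t} f) has_vector_derivative f t) (at t within {0..h})"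
        by (rule integral_has_vector_derivative[OF has_weak_deriv_continuous[OF f]])
      then have "((\<lambda>t. 1 + integral {0..t} f) has_vector_derivative f t) (at t within {0..h})"
        using has_vector_derivative_add[OF has_vector_derivative_const[of 1]] by fastforce
      then show "(u has_vector_derivative v t) (at t within {0..h})"
        unfolding u_def v_def by (rule bounded_linear.has_vector_derivative[OF bounded_linear_axis_complex])
    next
      fix i
      have "(\<lambda>t. v t $ i) = (if i = j then f else (\<lambda>_. 0))"
        by (auto simp: v_def axis_def)
      then show "\<exists>g. has_weak_deriv h (\<lambda>t. v t $ i) g"
        using f has_weak_deriv_const[of h 0] by auto
    qed
    have "u 0 $ j \<noteq> 0" by (simp add: u_def axis_def)
    then have "u 0 \<noteq> 0" by auto
    then have nz: "\<exists>t\<in>{0..h}. u t \<noteq> 0" using h by (meson atLeastAtMost_iff less_imp_le order_refl)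
    have v0: "v 0 = 0" "v h = 0" using ends by (simp_all add: v_def vec_eq_iff axis_def)
    obtain g where "has_weak_deriv h (\<lambda>t. (cmat (P t) *v v t + cmat (Q t) *v u t) $ k) (g k)"
      using sturm_positive_definite_path(3)[OF co pd h path v0 nz] by blast
    then show ?thesis
      unfolding u_def v_def vector_add_component cm by blast
  qed
  have "\<exists>g. has_weak_deriv h (\<lambda>t. complex_of_real (P t $ k $ j) * 0
        + complex_of_real (Q t $ k $ j) * (1 + integral {0..t} (\<lambda>_. 0))) g"
    by (rule main[OF has_weak_deriv_const]) simp_all
  then show Qjk: "\<exists>g. has_weak_deriv h (\<lambda>t. complex_of_real (Q t $ k $ j)) g"
    by simp
  assume f: "has_weak_deriv h f f'" and ends: "f 0 = 0" "f h = 0"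
  obtain q where q: "has_weak_deriv h (\<lambda>t. complex_of_real (Q t $ k $ j)) q" using Qjk ..
  obtain g where g: "has_weak_deriv h (\<lambda>t. complex_of_real (P t $ k $ j) * f t
        + complex_of_real (Q t $ k $ j) * (1 + integral {0..t} f)) g"
    using main[OF f ends] ..
  have F: "has_weak_deriv h (\<lambda>t. 1 + integral {0..t} f) (\<lambda>t. 0 + f t)"
  proof (rule has_weak_deriv_add[OF has_weak_deriv_const has_weak_deriv_C1])
    show "((\<lambda>t. integral {0..t} f) has_vector_derivative f t) (at t within {0..h})" if "t \<in> {0..h}" for t
      using that by (rule integral_has_vector_derivative[OF has_weak_deriv_continuous[OF f]])
  qed (rule has_weak_deriv_continuous[OF f])
  from has_weak_deriv_diff[OF g has_weak_deriv_mult[OF q F]]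
  show "\<exists>g. has_weak_deriv h (\<lambda>t. complex_of_real (P t $ k $ j) * f t) g"
    by (simp only: add_diff_cancel_right') blast
qed

section \<open>Regularity of solutions\<close>

text \<open>Here \<open>z\<close> is the inverse of \<open>p\<close>, and no differentiability of
  \<open>p\<close> is available. From \<open>v t - v s = z(t) ((y t - y s) - (p(t) - p(s))
  v(s))\<close> and \<open>v(s) = z(s) y(s)\<close> the increments of \<open>v\<close> involve
  \<open>p\<close> only through \<open>(p(t) - p(s)) y\<^sub>i(s)\<close>, which equals the
  increment of \<open>p y\<^sub>i\<close> minus \<open>p(t) (y\<^sub>i(t) -
  y\<^sub>i(s))\<close>.\<close>

lemma has_weak_deriv_of_linear_system:
  fixes p z :: "'m::finite \<Rightarrow> 'm \<Rightarrow> real \<Rightarrow> complex" and v y :: "'m \<Rightarrow> real \<Rightarrow> complex"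
  assumes cp: "\<And>k l. continuous_on {0..h} (p k l)" and cz: "\<And>k l. continuous_on {0..h} (z k l)"
    and y: "\<And>k. \<exists>g. has_weak_deriv h (y k) g"
    and py: "\<And>k l i. \<exists>g. has_weak_deriv h (\<lambda>t. p k l t * y i t) g"
    and eq: "\<And>t k. t \<in> {0..h} \<Longrightarrow> y k t = (\<Sum>l\<in>UNIV. p k l t * v l t)"
    and inv: "\<And>t j l. t \<in> {0..h} \<Longrightarrow> (\<Sum>k\<in>UNIV. z j k t * p k l t) = (if j = l then 1 else 0)"
  shows "\<exists>g. has_weak_deriv h (v j) g"
proof -
  have sol: "(\<Sum>k\<in>UNIV. z j k t * (\<Sum>l\<in>UNIV. p k l t * x l)) = x j" if "t \<in> {0..h}" for t j and x :: "'m \<Rightarrow> complex"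
  proof -
    have "(\<Sum>k\<in>UNIV. z j k t * (\<Sum>l\<in>UNIV. p k l t * x l)) = (\<Sum>k\<in>UNIV. \<Sum>l\<in>UNIV. z j k t * p k l t * x l)"
      by (simp add: sum_distrib_left mult.assoc)
    also have "\<dots> = (\<Sum>l\<in>UNIV. (\<Sum>k\<in>UNIV. z j k t * p k l t) * x l)"
      by (subst sum.swap) (simp add: sum_distrib_right)
    also have "\<dots> = (\<Sum>l\<in>UNIV. if j = l then x l else 0)"
      using that by (intro sum.cong) (simp_all add: inv)
    finally show ?thesis by simp
  qed
  have sol': "v j t = (\<Sum>k\<in>UNIV. z j k t * y k t)" if "t \<in> {0..h}" for t j
    using sol[OF that, of j "\<lambda>l. v l t"] by (simp add: eq[OF that])
  obtain y' where y': "\<And>k. has_weak_deriv h (y k) (y' k)" using y by metis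
  obtain q where q: "\<And>k l i. has_weak_deriv h (\<lambda>t. p k l t * y i t) (q k l i)" using py by metis
  \<comment> \<open>the increment of \<open>v j\<close>, expanded; its density \<open>g\<close> puts derivatives for increments and \<open>t\<close> for \<open>s\<close>\<close>
  define D where "D s t = (\<Sum>k\<in>UNIV. z j k t * ((y k t - y k s) + (\<Sum>l\<in>UNIV. \<Sum>i\<in>UNIV.
      - z l i s * ((p k l t * y i t - p k l s * y i s) + - p k l t * (y i t - y i s)))))" for s t
  define g where "g t = (\<Sum>k\<in>UNIV. z j k t * (y' k t + (\<Sum>l\<in>UNIV. \<Sum>i\<in>UNIV.
      - z l i t * (q k l i t + - p k l t * y' i t))))" for t
  have cneg: "continuous_on {0..h} (\<lambda>t. - z k l t)" "continuous_on {0..h} (\<lambda>t. - p k l t)" for k l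
    by (intro continuous_on_minus cp cz)+
  have term1: "increment_density h (\<lambda>s t. - p k l t * (y i t - y i s)) (\<lambda>t. - p k l t * y' i t)" for k l i
    by (rule increment_density_mult[where c="\<lambda>s t. - p k l t", OF continuous_on_snd_Icc[OF cneg(2)]
        has_weak_deriv_increment_density[OF y']])
  have term2: "increment_density h (\<lambda>s t. - z l i s * ((p k l t * y i t - p k l s * y i s) + - p k l t * (y i t - y i s)))
      (\<lambda>t. - z l i t * (q k l i t + - p k l t * y' i t))" for k l i
    by (rule increment_density_mult[where c="\<lambda>s t. - z l i s", OF continuous_on_fst_Icc[OF cneg(1)]
        increment_density_add[OF has_weak_deriv_increment_density[OF q] term1]])
  have term3: "increment_density h (\<lambda>s t. z j k t * ((y k t - y k s) + (\<Sum>l\<in>UNIV. \<Sum>i\<in>UNIV.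
      - z l i s * ((p k l t * y i t - p k l s * y i s) + - p k l t * (y i t - y i s)))))
      (\<lambda>t. z j k t * (y' k t + (\<Sum>l\<in>UNIV. \<Sum>i\<in>UNIV. - z l i t * (q k l i t + - p k l t * y' i t))))" for k
    by (rule increment_density_mult[where c="\<lambda>s t. z j k t", OF continuous_on_snd_Icc[OF cz]
        increment_density_add[OF has_weak_deriv_increment_density[OF y']
          increment_density_sum[OF finite increment_density_sum[OF finite term2]]]])
  have "increment_density h D g"
    unfolding D_def g_def by (rule increment_density_sum[OF finite term3])
  moreover have "v j t - v j s = D s t" if st: "0 \<le> s" "s \<le> t" "t \<le> h" for s t
  proof -
    have s: "s \<in> {0..h}" and t: "t \<in> {0..h}" using st by auto
    have "(\<Sum>l\<in>UNIV. \<Sum>i\<in>UNIV. - z l i s * ((p k l t * y i t - p k l s * y i s) + - p k l t * (y i t - y i s)))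
      = y k s - (\<Sum>l\<in>UNIV. p k l t * v l s)" for k
    proof -
      have "- z l i s * ((p k l t * y i t - p k l s * y i s) + - p k l t * (y i t - y i s))
          = (p k l s - p k l t) * (z l i s * y i s)" for l i
        by (simp add: algebra_simps)
      then have "(\<Sum>l\<in>UNIV. \<Sum>i\<in>UNIV. - z l i s * ((p k l t * y i t - p k l s * y i s) + - p k l t * (y i t - y i s)))
          = (\<Sum>l\<in>UNIV. (p k l s - p k l t) * v l s)"
        by (simp only: sum_distrib_left[symmetric] sol'[OF s, symmetric])
      then show ?thesis by (simp only: eq[OF s] left_diff_distrib sum_subtractf)
    qed
    then have "D s t = (\<Sum>k\<in>UNIV. z j k t * (y k t - (\<Sum>l\<in>UNIV. p k l t * v l s)))"
      unfolding D_def by (simp only:) (simp add: algebra_simps)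
    also have "\<dots> = v j t - v j s"
      by (simp only: right_diff_distrib sum_subtractf sol'[OF t, symmetric] sol[OF t])
    finally show ?thesis by simp
  qed
  ultimately have "has_weak_deriv h (v j) g" by (rule has_weak_deriv_of_increments)
  then show ?thesis by blast
qed

lemma positive_definite_invertible:
  fixes A :: "real^'m^'m::finite"
  assumes "\<And>x. x \<noteq> 0 \<Longrightarrow> (A *v x) \<bullet> x > 0"
  shows "invertible A"
proof -
  have "x = 0" if "A *v x = 0" for x using assms[of x] that by force
  then show ?thesis unfolding invertible_left_inverse matrix_left_invertible_ker by blast
qed

lemma matrix_inv_mult:
  fixes A :: "real^'m^'m::finite"
  assumes "invertible A"
  shows "A ** matrix_inv A = mat 1" "matrix_inv A ** A = mat 1"
  using someI_ex[OF assms[unfolded invertible_def]] by (simp_all add: matrix_inv_def)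

text \<open>Cramer's rule.\<close>

lemma continuous_on_matrix_inv:
  fixes P :: "real \<Rightarrow> real^'m^'m::finite"
  assumes P: "continuous_on A P" and inv: "\<And>t. t \<in> A \<Longrightarrow> invertible (P t)"
  shows "continuous_on A (\<lambda>t. matrix_inv (P t) $ j $ k)"
proof -
  have cdet: "continuous_on A (\<lambda>t. det (M t))" if "\<And>i j. continuous_on A (\<lambda>t. M t $ i $ j)"
    for M :: "real \<Rightarrow> real^'m^'m"
    unfolding det_def by (intro continuous_intros that)
  have cP: "continuous_on A (\<lambda>t. P t $ i $ l)" for i l
    by (intro continuous_on_component P)
  \<comment> \<open>the numerator in Cramer's rule: column \<open>j\<close> of \<open>P t\<close> replaced by a basis vector\<close>
  define M where "M t = (\<chi> i l. if l = j then axis k 1 $ i else P t $ i $ l)" for t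
  have "continuous_on A (\<lambda>t. M t $ i $ l)" for i l
    by (cases "l = j") (simp_all add: M_def cP)
  then have c: "continuous_on A (\<lambda>t. det (M t))" by (rule cdet)
  have nz: "det (P t) \<noteq> 0" if "t \<in> A" for t using inv[OF that] by (simp add: invertible_det_nz)
  have "matrix_inv (P t) $ j $ k = det (M t) / det (P t)" if t: "t \<in> A" for t
  proof -
    have "P t *v (matrix_inv (P t) *v axis k 1) = axis k 1"
      using matrix_inv_mult(1)[OF inv[OF t]] by (simp add: matrix_vector_mul_assoc)
    then have "matrix_inv (P t) *v axis k 1
        = (\<chi> r. det (\<chi> i l. if l = r then axis k 1 $ i else P t $ i $ l) / det (P t))"
      using cramer[OF nz[OF t]] by blast
    then have "(matrix_inv (P t) *v axis k 1) $ j = det (M t) / det (P t)"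
      by (simp add: M_def)
    then show ?thesis by (simp add: matrix_vector_mult_basis column_def)
  qed
  moreover have "continuous_on A (\<lambda>t. det (M t) / det (P t))"
    by (intro continuous_on_divide c cdet cP) (use nz in blast)
  ultimately show ?thesis by (simp cong: continuous_on_cong)
qed

text \<open>The system is \<open>y = P u'\<close>: the momentum \<open>y + Q u\<close> is
  \<open>C\<^sup>1\<close> and \<open>Q u\<close> is weakly differentiable, so
  \<open>y\<close> is, and it vanishes at both ends.\<close>

lemma solution_velocity_has_weak_deriv:
  fixes P Q R :: "real \<Rightarrow> real^'m^'m::finite"
  assumes co: "sturm_coefficients P Q R" and pd: "sturm_positive_definite h P Q R" and h: "h > 0"
    and sol: "sturm_solution P Q R 0 h u v" and ends: "v 0 = 0" "v h = 0"
  shows "\<exists>g. has_weak_deriv h (\<lambda>t. complex_of_real (v t $ j)) g"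
proof -
  have u: "C1_path 0 h u v" using sol by (simp add: sturm_solution_def)
  have cont: "continuous_on {0..h} P" "continuous_on {0..h} Q" "continuous_on {0..h} R"
    using co by (auto simp: sturm_coefficients_def intro: continuous_on_subset)
  have inv: "invertible (P t)" for t
    by (rule positive_definite_invertible) (use co in \<open>simp add: sturm_coefficients_def\<close>)
  define y where "y k t = complex_of_real ((P t *v v t) $ k)" for k t
  have y: "\<exists>g. has_weak_deriv h (y k) g" for k
  proof -
    have "has_weak_deriv h (\<lambda>t. complex_of_real ((P t *v v t + Q t *v u t) $ k))
        (\<lambda>t. complex_of_real ((transpose (Q t) *v v t + R t *v u t) $ k))"
    proof (rule has_weak_deriv_C1)
      fix t assume "t \<in> {0..h}"
      then have "((\<lambda>t. P t *v v t + Q t *v u t) has_vector_derivative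
          transpose (Q t) *v v t + R t *v u t) (at t within {0..h})"
        using sol by (simp add: sturm_solution_def)
      then show "((\<lambda>t. complex_of_real ((P t *v v t + Q t *v u t) $ k)) has_vector_derivative
          complex_of_real ((transpose (Q t) *v v t + R t *v u t) $ k)) (at t within {0..h})"
        by (intro bounded_linear.has_vector_derivative[OF bounded_linear_of_real]
            bounded_linear.has_vector_derivative[OF bounded_linear_vec_nth])
    next
      have "continuous_on {0..h} (\<lambda>t. transpose (Q t))"
        unfolding transpose_def by (intro continuous_on_vec_lambda continuous_on_component cont)
      then show "continuous_on {0..h} (\<lambda>t. complex_of_real ((transpose (Q t) *v v t + R t *v u t) $ k))"
        by (intro continuous_on_of_real continuous_on_component continuous_on_add
            continuous_on_matrix_vector cont C1_path_continuous[OF u])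
    qed
    note p = this
    obtain q where q: "\<And>l. has_weak_deriv h (\<lambda>t. complex_of_real (Q t $ k $ l)) (q l)"
      using sturm_domain_coefficients(1)[OF co pd h] by metis
    have ul: "has_weak_deriv h (\<lambda>t. complex_of_real (u t $ l)) (\<lambda>t. complex_of_real (v t $ l))" for l
    proof (rule has_weak_deriv_C1)
      fix t assume "t \<in> {0..h}"
      then have "(u has_vector_derivative v t) (at t within {0..h})" using u by (simp add: C1_path_def)
      then show "((\<lambda>t. complex_of_real (u t $ l)) has_vector_derivative complex_of_real (v t $ l)) (at t within {0..h})"
        by (intro bounded_linear.has_vector_derivative[OF bounded_linear_of_real]
            bounded_linear.has_vector_derivative[OF bounded_linear_vec_nth])
    qed (intro continuous_on_of_real continuous_on_component C1_path_continuous[OF u])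
    have y_eq: "y k = (\<lambda>t. complex_of_real ((P t *v v t + Q t *v u t) $ k)
        - (\<Sum>l\<in>UNIV. complex_of_real (Q t $ k $ l) * complex_of_real (u t $ l)))"
      by (rule ext) (simp add: y_def matrix_vector_mult_def)
    show ?thesis
      unfolding y_eq by (rule exI, rule has_weak_deriv_diff[OF p has_weak_deriv_sum[OF finite has_weak_deriv_mult[OF q ul]]])
  qed
  have y0: "y k 0 = 0" "y k h = 0" for k by (simp_all add: y_def ends)
  have py: "\<exists>g. has_weak_deriv h (\<lambda>t. complex_of_real (P t $ k $ l) * y i t) g" for k l i
  proof -
    obtain f' where "has_weak_deriv h (y i) f'" using y by blast
    then show ?thesis by (rule sturm_domain_coefficients(2)[OF co pd h _ y0])
  qed
  have cP: "continuous_on {0..h} (\<lambda>t. complex_of_real (P t $ k $ l))" for k l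
    by (intro continuous_on_of_real continuous_on_component cont)
  have cZ: "continuous_on {0..h} (\<lambda>t. complex_of_real (matrix_inv (P t) $ k $ l))" for k l
    by (intro continuous_on_of_real continuous_on_matrix_inv cont inv)
  have sys: "y k t = (\<Sum>l\<in>UNIV. complex_of_real (P t $ k $ l) * complex_of_real (v t $ l))" for k t
    by (simp add: y_def matrix_vector_mult_def)
  have inverse: "(\<Sum>k\<in>UNIV. complex_of_real (matrix_inv (P t) $ j $ k) * complex_of_real (P t $ k $ l))
      = (if j = l then 1 else 0)" for t j l
  proof -
    have "(matrix_inv (P t) ** P t) $ j $ l = (if j = l then 1 else 0)"
      using matrix_inv_mult(2)[OF inv] by (simp add: mat_def)
    then have "(\<Sum>k\<in>UNIV. matrix_inv (P t) $ j $ k * P t $ k $ l) = (if j = l then 1 else 0)"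
      by (simp add: matrix_matrix_mult_def)
    from arg_cong[OF this, of complex_of_real] show ?thesis by simp
  qed
  show ?thesis
    by (rule has_weak_deriv_of_linear_system[where v="\<lambda>j t. complex_of_real (v t $ j)",
          OF cP cZ y py sys inverse])
qed

section \<open>Nonnegativity of the energy on all paths\<close>

text \<open>Uniform polynomial approximations of \<open>v\<close>, multiplied by polynomials that vanish
  at both ends and tend to 1 in between while staying in \<open>[0,1]\<close>.\<close>

lemma cutoff_polynomial_approximation:
  fixes v :: "real \<Rightarrow> 'a::euclidean_space"
  assumes h: "h > 0" and v: "continuous_on {0..h} v"
  obtains w V where "\<And>k::nat. polynomial_function (w k)" "\<And>k. w k 0 = 0" "\<And>k. w k h = 0"
    "\<And>k t. t \<in> {0..h} \<Longrightarrow> norm (w k t) \<le> V"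
    "\<And>t. 0 < t \<Longrightarrow> t < h \<Longrightarrow> (\<lambda>k. w k t) \<longlonglongrightarrow> v t"
proof -
  obtain C where C: "C \<ge> 0" "\<And>t. t \<in> {0..h} \<Longrightarrow> norm (v t) \<le> C"
    by (rule continuous_on_Icc_bound[OF v]) (rule that)
  have "\<exists>g. polynomial_function g \<and> (\<forall>t\<in>{0..h}. norm (v t - g t) < inverse (real (Suc k)))" for k
    by (rule Stone_Weierstrass_polynomial_function[OF compact_Icc v]) simp
  from choice[OF allI[OF this]] obtain p where
    P: "\<forall>k. polynomial_function (p k) \<and> (\<forall>t\<in>{0..h}. norm (v t - p k t) < inverse (real (Suc k)))" ..
  have p: "polynomial_function (p k)" "t \<in> {0..h} \<Longrightarrow> norm (v t - p k t) < inverse (real (Suc k))" for k t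
    using spec[OF P, of k] by simp_all
  define c where "c k t = 1 - (1 - t / h) ^ Suc k - (t / h) ^ Suc k" for k :: nat and t :: real
  have "real_polynomial_function (\<lambda>t::real. t / h)"
    by (intro real_polynomial_function.intros(1) bounded_linear_divide)
  then have "real_polynomial_function (c k)" for k
    unfolding c_def
    by (intro real_polynomial_function_diff real_polynomial_function_power real_polynomial_function.intros(2))
  then have poly: "polynomial_function (\<lambda>t. c k t *\<^sub>R p k t)" for k
    by (intro polynomial_function_mult p(1)) (simp add: real_polynomial_function_eq)
  have c01: "0 \<le> c k t" "c k t \<le> 1" if "t \<in> {0..h}" for k t
  proof -
    have s: "0 \<le> t / h" "t / h \<le> 1" using that h by simp_all
    have "r ^ Suc k \<le> r" if "0 \<le> r" "r \<le> 1" for r :: real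
      unfolding power_Suc using that by (intro mult_left_le power_le_one)
    from this[of "t / h"] this[of "1 - t / h"] show "0 \<le> c k t"
      using s unfolding c_def by linarith
    have "0 \<le> (t / h) ^ Suc k" "0 \<le> (1 - t / h) ^ Suc k"
      using s by (simp_all only: zero_le_power diff_ge_0_iff_ge)
    then show "c k t \<le> 1" unfolding c_def by linarith
  qed
  show ?thesis
  proof (rule that[of "\<lambda>k t. c k t *\<^sub>R p k t" "C + 1"])
    fix k show "polynomial_function (\<lambda>t. c k t *\<^sub>R p k t)" by (rule poly)
    show "c k 0 *\<^sub>R p k 0 = 0" "c k h *\<^sub>R p k h = 0" using h by (simp_all add: c_def)
    fix t assume t: "t \<in> {0..h}"
    have "norm (p k t) \<le> norm (v t) + norm (v t - p k t)"
      using norm_triangle_ineq4[of "v t" "v t - p k t"] by simp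
    also have "\<dots> \<le> C + 1"
    proof -
      have "inverse (real (Suc k)) \<le> 1" by (simp add: inverse_eq_divide)
      then show ?thesis using C(2)[OF t] p(2)[OF t, of k] by linarith
    qed
    finally have "c k t * norm (p k t) \<le> 1 * (C + 1)"
      using c01[OF t, of k] C(1) by (intro mult_mono) auto
    then show "norm (c k t *\<^sub>R p k t) \<le> C + 1" using c01(1)[OF t, of k] by simp
  next
    fix t assume t: "0 < t" "t < h"
    have "(\<lambda>k. (t / h) ^ Suc k) \<longlonglongrightarrow> 0" "(\<lambda>k. (1 - t / h) ^ Suc k) \<longlonglongrightarrow> 0"
      using t by (auto intro!: LIMSEQ_Suc LIMSEQ_realpow_zero simp del: power_Suc)
    then have "(\<lambda>k. c k t) \<longlonglongrightarrow> 1 - 0 - 0"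
      unfolding c_def by (intro tendsto_diff tendsto_const)
    moreover have "(\<lambda>k. p k t) \<longlonglongrightarrow> v t"
    proof (rule LIM_zero_cancel, rule tendsto_norm_zero_cancel)
      have "norm (p k t - v t) \<le> inverse (real (Suc k))" for k
        using p(2)[of t k] t by (simp add: norm_minus_commute less_imp_le)
      then show "(\<lambda>k. norm (p k t - v t)) \<longlonglongrightarrow> 0"
        by (intro tendsto_sandwich[OF _ _ tendsto_const LIMSEQ_inverse_real_of_nat] always_eventually) auto
    qed
    ultimately have "(\<lambda>k. c k t *\<^sub>R p k t) \<longlonglongrightarrow> (1 - 0 - 0) *\<^sub>R v t"
      by (rule tendsto_scaleR)
    then show "(\<lambda>k. c k t *\<^sub>R p k t) \<longlonglongrightarrow> v t" by simp
  qed
qed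

text \<open>Positivity, together with the value zero on the zero path.\<close>

lemma energy_nonneg_of_vanishing_velocity:
  fixes P Q R :: "real \<Rightarrow> real^'m^'m::finite"
  assumes co: "sturm_coefficients P Q R" and pd: "sturm_positive_definite h P Q R" and h: "h > 0"
    and u: "C1_path 0 h u v" and v: "\<And>i. \<exists>g. has_weak_deriv h (\<lambda>t. complex_of_real (v t $ i)) g"
    and ends: "v 0 = 0" "v h = 0"
  shows "energy P Q R 0 h u v \<ge> 0"
proof (cases "\<exists>t\<in>{0..h}. u t \<noteq> 0")
  case True
  show ?thesis
    using energy_pos_of_sturm_positive_definite[OF co pd h u v ends True] by simp
next
  case False
  have "v t = 0" if t: "t \<in> {0..h}" for t
  proof -
    have "(u has_vector_derivative v t) (at t within {0..h})" using u t by (simp add: C1_path_def)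
    moreover have "(u has_vector_derivative 0) (at t within {0..h})"
      by (rule has_vector_derivative_transform[OF t _ has_vector_derivative_const[of 0]]) (use False in auto)
    ultimately show ?thesis
      using vector_derivative_within_cbox[of 0 h t u] h t by (metis box_real(2))
  qed
  then have "integral {0..h} (\<lambda>t. energy_density P Q R t (u t) (v t) (u t) (v t)) = integral {0..h} (\<lambda>t. 0)"
    using False by (intro Henstock_Kurzweil_Integration.integral_cong) (simp add: energy_density_def)
  moreover have "u 0 = 0" "u h = 0" using False h by auto
  ultimately show ?thesis by (simp add: energy_eq)
qed

text \<open>Velocities are approximated by polynomials vanishing at the ends, boundedly and pointwise in
  the interior. By dominated convergence the paths converge pointwise, also at the two ends
  where the boundary term is evaluated, and the energies converge.\<close>

lemma energy_nonneg:
  fixes P Q R :: "real \<Rightarrow> real^'m^'m::finite"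
  assumes co: "sturm_coefficients P Q R" and pd: "sturm_positive_definite h P Q R" and h: "h > 0"
    and u: "C1_path 0 h u v"
  shows "energy P Q R 0 h u v \<ge> 0"
proof -
  obtain w V where w: "\<And>k::nat. polynomial_function (w k)" "\<And>k. w k 0 = 0" "\<And>k. w k h = 0"
    and wV: "\<And>k t. t \<in> {0..h} \<Longrightarrow> norm (w k t) \<le> V"
    and wlim: "\<And>t. 0 < t \<Longrightarrow> t < h \<Longrightarrow> (\<lambda>k. w k t) \<longlonglongrightarrow> v t"
    by (rule cutoff_polynomial_approximation[OF h C1_path_continuous(2)[OF u]]) (rule that)
  have V0: "V \<ge> 0" using order_trans[OF norm_ge_zero wV[of 0 0]] h by simp
  have wcont: "continuous_on A (w k)" for A k
    using w(1) by (rule continuous_on_polymonial_function)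
  \<comment> \<open>the approximations vanish at the ends, so their pointwise limit differs from \<open>v\<close> there\<close>
  define v' where "v' t = (if t \<in> {0, h} then 0 else v t)" for t
  have wlim': "(\<lambda>k. w k t) \<longlonglongrightarrow> v' t" if "t \<in> {0..h}" for t
    using that wlim[of t] w(2,3) by (auto simp: v'_def)
  define x where "x k t = u 0 + integral {0..t} (w k)" for k t
  have path: "C1_path 0 h (x k) (w k)" for k
    unfolding C1_path_def
  proof (intro conjI ballI wcont)
    fix t assume "t \<in> {0..h}"
    then have "((\<lambda>t. integral {0..t} (w k)) has_vector_derivative w k t) (at t within {0..h})"
      by (rule integral_has_vector_derivative[OF wcont])
    then have "((\<lambda>t. u 0 + integral {0..t} (w k)) has_vector_derivative 0 + w k t) (at t within {0..h})"
      by (intro has_vector_derivative_add has_vector_derivative_const)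
    moreover have "x k = (\<lambda>t. u 0 + integral {0..t} (w k))" by (rule ext) (rule x_def)
    ultimately show "(x k has_vector_derivative w k t) (at t within {0..h})" by simp
  qed
  have pos: "energy P Q R 0 h (x k) (w k) \<ge> 0" for k
  proof (rule energy_nonneg_of_vanishing_velocity[OF co pd h path _ w(2,3)])
    fix i
    obtain p' where p': "polynomial_function p'" "\<And>t. (w k has_vector_derivative p' t) (at t)"
      by (rule has_vector_derivative_polynomial_function[OF w(1)[of k]]) (rule that)
    have "has_weak_deriv h (\<lambda>t. complex_of_real (w k t $ i)) (\<lambda>t. complex_of_real (p' t $ i))"
    proof (rule has_weak_deriv_C1)
      fix t
      show "((\<lambda>t. complex_of_real (w k t $ i)) has_vector_derivative complex_of_real (p' t $ i)) (at t within {0..h})"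
        by (rule bounded_linear.has_vector_derivative[OF bounded_linear_of_real
              bounded_linear.has_vector_derivative[OF bounded_linear_vec_nth
                has_vector_derivative_at_within[OF p'(2)]]])
    qed (intro continuous_on_of_real continuous_on_component continuous_on_polymonial_function p'(1))
    then show "\<exists>g. has_weak_deriv h (\<lambda>t. complex_of_real (w k t $ i)) g" by blast
  qed
  have xlim: "(\<lambda>k. x k t) \<longlonglongrightarrow> u t" if t: "t \<in> {0..h}" for t
  proof -
    have "(\<lambda>k. integral {0..t} (w k)) \<longlonglongrightarrow> integral {0..t} v'"
    proof (rule dominated_convergence(2)[where h="\<lambda>_. V"])
      show "w k integrable_on {0..t}" for k by (intro integrable_continuous_real wcont)
      show "(\<lambda>_. V) integrable_on {0..t}" by (intro integrable_continuous_real continuous_on_const)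
      show "norm (w k s) \<le> V" "(\<lambda>k. w k s) \<longlonglongrightarrow> v' s" if "s \<in> {0..t}" for k s
        using that t by (simp_all add: wV wlim')
    qed
    moreover have "integral {0..t} v' = integral {0..t} v"
      by (rule integral_spike[of "{0, h}"]) (auto simp: v'_def)
    moreover have "(v has_integral u t - u 0) {0..t}"
    proof (rule fundamental_theorem_of_calculus)
      fix s assume "s \<in> {0..t}"
      then show "(u has_vector_derivative v s) (at s within {0..t})"
        using C1_path_subset[OF u, of 0 t] t by (simp add: C1_path_def)
    qed (use t in simp)
    ultimately have "(\<lambda>k. u 0 + integral {0..t} (w k)) \<longlonglongrightarrow> u 0 + (u t - u 0)"
      by (intro tendsto_add tendsto_const) (simp add: integral_unique)
    then show ?thesis by (simp add: x_def)
  qed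
  define U where "U = norm (u 0) + V * h"
  have xU: "norm (x k t) \<le> U" if t: "t \<in> {0..h}" for k t
  proof -
    have "norm (integral {0..t} (w k)) \<le> V * (t - 0)"
    proof (rule integral_bound[OF _ wcont])
      show "0 \<le> t" using t by simp
      show "norm (w k s) \<le> V" if "s \<in> {0..t}" for s using that t by (intro wV) simp
    qed
    also have "\<dots> \<le> V * h" using t V0 by (intro mult_left_mono) auto
    finally show ?thesis
      unfolding x_def U_def by (intro norm_triangle_le) simp
  qed
  \<comment> \<open>the density as one continuous function of time, position and velocity, bounded on compact sets\<close>
  define e where "e z = energy_density P Q R (fst z) (fst (snd z)) (snd (snd z)) (fst (snd z)) (snd (snd z))" for z
  have econt: "continuous_on A e" for A
    unfolding e_def by (intro continuous_on_energy_density[OF co] continuous_on_fst continuous_on_snd continuous_on_id)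
  have "compact ({0..h} \<times> cball (0::real^'m) U \<times> cball (0::real^'m) V)"
    by (intro compact_Times compact_Icc compact_cball)
  then have "bounded (e ` ({0..h} \<times> cball 0 U \<times> cball 0 V))"
    by (intro compact_imp_bounded compact_continuous_image econt)
  then obtain B where B: "\<forall>y \<in> e ` ({0..h} \<times> cball 0 U \<times> cball 0 V). norm y \<le> B"
    unfolding bounded_iff by blast
  have lim: "(\<lambda>k. integral {0..h} (\<lambda>t. e (t, x k t, w k t))) \<longlonglongrightarrow> integral {0..h} (\<lambda>t. e (t, u t, v' t))"
  proof (rule dominated_convergence(2)[where h="\<lambda>_. B"])
    show "(\<lambda>t. e (t, x k t, w k t)) integrable_on {0..h}" for k
      unfolding e_def using integrable_energy_density[OF co path path] by simp
    show "norm (e (t, x k t, w k t)) \<le> B" if "t \<in> {0..h}" for k t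
      using that xU[OF that] wV[OF that] by (intro bspec[OF B] imageI) auto
    show "(\<lambda>k. e (t, x k t, w k t)) \<longlonglongrightarrow> e (t, u t, v' t)" if "t \<in> {0..h}" for t
    proof (rule isCont_tendsto_compose[of _ e])
      show "isCont e (t, u t, v' t)"
        using econt[of UNIV] by (simp add: continuous_on_eq_continuous_at)
      show "(\<lambda>k. (t, x k t, w k t)) \<longlonglongrightarrow> (t, u t, v' t)"
        by (intro tendsto_Pair tendsto_const xlim wlim' that)
    qed
  qed (intro integrable_continuous_real continuous_on_const)
  have ends: "integral {0..h} (\<lambda>t. e (t, u t, v' t)) = integral {0..h} (\<lambda>t. e (t, u t, v t))"
    by (rule integral_spike[of "{0, h}"]) (auto simp: v'_def)
  have limQ: "(\<lambda>k. (Q t *v x k t) \<bullet> x k t) \<longlonglongrightarrow> (Q t *v u t) \<bullet> u t" if "t \<in> {0..h}" for t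
  proof -
    have "(\<lambda>k. Q t *v x k t) \<longlonglongrightarrow> Q t *v u t"
      by (rule bounded_linear.tendsto[OF matrix_vector_mul_bounded_linear xlim[OF that]])
    then show ?thesis by (rule tendsto_inner[OF _ xlim[OF that]])
  qed
  have h01: "h \<in> {0..h}" "0 \<in> {0..h}" using h by simp_all
  have "(\<lambda>k. integral {0..h} (\<lambda>t. e (t, x k t, w k t)) - ((Q h *v x k h) \<bullet> x k h - (Q 0 *v x k 0) \<bullet> x k 0))
     \<longlonglongrightarrow> integral {0..h} (\<lambda>t. e (t, u t, v t)) - ((Q h *v u h) \<bullet> u h - (Q 0 *v u 0) \<bullet> u 0)"
    by (rule tendsto_diff[OF lim[unfolded ends] tendsto_diff[OF limQ[OF h01(1)] limQ[OF h01(2)]]])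
  then have energy_lim: "(\<lambda>k. energy P Q R 0 h (x k) (w k)) \<longlonglongrightarrow> energy P Q R 0 h u v"
    unfolding energy_eq e_def fst_conv snd_conv .
  show ?thesis
    by (rule tendsto_lowerbound[OF energy_lim]) (simp_all add: pos)
qed

section \<open>The Hamiltonian system and its monodromy\<close>

text \<open>Momentum and position in the phase space, whose coordinates are indexed by a sum type.\<close>

definition upper :: "real^('m + 'm) \<Rightarrow> real^'m::finite" where
  "upper z = (\<chi> i. z $ Inl i)"

definition lower :: "real^('m + 'm) \<Rightarrow> real^'m::finite" where
  "lower z = (\<chi> i. z $ Inr i)"

lemma upper_lower_bounded_linear:
  "bounded_linear (upper :: real^('m + 'm) \<Rightarrow> real^'m::finite)"
  "bounded_linear (lower :: real^('m + 'm) \<Rightarrow> real^'m::finite)"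
  by (intro linear_conv_bounded_linear[THEN iffD1] linearI;
      simp add: upper_def lower_def vec_eq_iff)+

lemma upper_lower_eq_0:
  assumes "upper z = 0" "lower z = 0"
  shows "z = 0"
proof -
  have "z $ i = 0" for i
    using assms by (cases i) (simp_all add: upper_def lower_def vec_eq_iff)
  then show ?thesis by (simp add: vec_eq_iff)
qed

lemma block_matrix_vector:
  fixes A B C D :: "real^'m^'m::finite"
  shows "upper (block_matrix A B C D *v z) = A *v upper z + B *v lower z"
    and "lower (block_matrix A B C D *v z) = C *v upper z + D *v lower z"
proof -
  have split: "(\<Sum>j\<in>UNIV. f j) = (\<Sum>b\<in>UNIV. f (Inl b)) + (\<Sum>b\<in>UNIV. f (Inr b))" for f :: "'m + 'm \<Rightarrow> real"
    by (simp add: UNIV_Plus_UNIV[symmetric] sum.Plus o_def del: UNIV_Plus_UNIV)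
  show "upper (block_matrix A B C D *v z) = A *v upper z + B *v lower z"
    "lower (block_matrix A B C D *v z) = C *v upper z + D *v lower z"
    by (simp_all add: vec_eq_iff upper_def lower_def matrix_vector_mult_def block_matrix_def split)
qed

text \<open>With the velocity \<open>v = P\<^sup>-\<^sup>1 (p - Q q)\<close> the Hamiltonian system
  reads \<open>p' = Q\<^sup>T v + R q\<close>, \<open>q' = v\<close>, where \<open>p = P v + Q
  q\<close> (the inverse Legendre transform).\<close>

lemma hamiltonian_vector_field:
  fixes P Q R :: "real^'m^'m::finite"
  assumes "invertible P"
  defines "v \<equiv> \<lambda>z. matrix_inv P *v (upper z - Q *v lower z)"
  shows "upper ((symp_J ** hamiltonian_B P Q R) *v z) = transpose Q *v v z + R *v lower z"
    and "lower ((symp_J ** hamiltonian_B P Q R) *v z) = v z"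
    and "P *v v z + Q *v lower z = upper z"
proof -
  have neg: "(- A) *v x = - (A *v x)" for A :: "real^'m^'m" and x
    by (simp add: vec_eq_iff matrix_vector_mult_def sum_negf)
  have u: "upper (hamiltonian_B P Q R *v z) = v z"
    unfolding hamiltonian_B_def block_matrix_vector v_def
    by (simp add: neg matrix_vector_mult_diff_distrib matrix_vector_mul_assoc)
  have l: "lower (hamiltonian_B P Q R *v z) = - (transpose Q *v v z + R *v lower z)"
    unfolding hamiltonian_B_def block_matrix_vector v_def
    by (simp only: neg matrix_vector_mult_diff_distrib matrix_vector_mult_diff_rdistrib
        matrix_vector_mul_assoc[symmetric]) simp
  have id: "mat 1 *v x = x" for x :: "real^'m" by (rule matrix_vector_mul_lid)
  show "upper ((symp_J ** hamiltonian_B P Q R) *v z) = transpose Q *v v z + R *v lower z"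
    "lower ((symp_J ** hamiltonian_B P Q R) *v z) = v z"
    unfolding matrix_vector_mul_assoc[symmetric] symp_J_def block_matrix_vector u l
    by (simp_all only: neg id matrix_vector_mult_0) simp_all
  have "P *v v z = upper z - Q *v lower z"
    unfolding v_def by (simp add: matrix_vector_mul_assoc matrix_inv_mult(1)[OF assms(1)])
  then show "P *v v z + Q *v lower z = upper z" by simp
qed

lemma sturm_solution_of_fundamental_solution:
  fixes P Q R :: "real \<Rightarrow> real^'m^'m::finite"
  assumes co: "sturm_coefficients P Q R"
    and fs: "fundamental_solution T (\<lambda>t. symp_J ** hamiltonian_B (P t) (Q t) (R t)) \<gamma>"
  obtains v where "sturm_solution P Q R 0 T (\<lambda>t. lower (\<gamma> t *v c)) v"
    "\<And>t. P t *v v t + Q t *v lower (\<gamma> t *v c) = upper (\<gamma> t *v c)"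
proof -
  define z where "z t = \<gamma> t *v c" for t
  define u where "u t = lower (z t)" for t
  define v where "v t = matrix_inv (P t) *v (upper (z t) - Q t *v u t)" for t
  have inv: "invertible (P t)" for t
    by (rule positive_definite_invertible) (use co in \<open>simp add: sturm_coefficients_def\<close>)
  have lin: "bounded_linear (\<lambda>M :: real^('m+'m)^('m+'m). M *v c)"
    by (intro linear_conv_bounded_linear[THEN iffD1] linearI)
       (simp_all add: matrix_vector_mult_add_rdistrib scaleR_matrix_vector_assoc)
  have z: "(z has_vector_derivative (symp_J ** hamiltonian_B (P t) (Q t) (R t)) *v z t) (at t within {0..T})"
    if "t \<in> {0..T}" for t
  proof -
    have "(\<gamma> has_vector_derivative (symp_J ** hamiltonian_B (P t) (Q t) (R t)) ** \<gamma> t) (at t within {0..T})"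
      using fs that by (simp add: fundamental_solution_def)
    from bounded_linear.has_vector_derivative[OF lin this]
    show ?thesis unfolding z_def matrix_vector_mul_assoc .
  qed
  note field = hamiltonian_vector_field[OF inv]
  have mom: "P t *v v t + Q t *v u t = upper (z t)" for t
    unfolding v_def u_def by (rule field(3))
  have u': "(u has_vector_derivative v t) (at t within {0..T})" if "t \<in> {0..T}" for t
    using bounded_linear.has_vector_derivative[OF upper_lower_bounded_linear(2) z[OF that]]
    unfolding u_def[abs_def] v_def field(2) .
  have p': "((\<lambda>t. upper (z t)) has_vector_derivative transpose (Q t) *v v t + R t *v u t) (at t within {0..T})"
    if "t \<in> {0..T}" for t
    using bounded_linear.has_vector_derivative[OF upper_lower_bounded_linear(1) z[OF that]]
    unfolding u_def v_def field(1) .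
  have cont: "continuous_on {0..T} P" "continuous_on {0..T} Q"
    using co by (auto simp: sturm_coefficients_def intro: continuous_on_subset)
  have "continuous_on {0..T} (\<lambda>t. \<chi> i. \<chi> j. matrix_inv (P t) $ i $ j)"
    by (intro continuous_on_vec_lambda continuous_on_matrix_inv cont inv)
  then have cinv: "continuous_on {0..T} (\<lambda>t. matrix_inv (P t))" by simp
  have cu: "continuous_on {0..T} u" "continuous_on {0..T} (\<lambda>t. upper (z t))"
    using u' p' has_vector_derivative_continuous unfolding continuous_on_eq_continuous_within by blast+
  have "continuous_on {0..T} v"
    unfolding v_def by (intro continuous_on_matrix_vector continuous_on_diff cinv cont cu)
  then have "sturm_solution P Q R 0 T u v"
    unfolding sturm_solution_def C1_path_def mom using u' p' by blast
  then show ?thesis using mom by (intro that[of v]) (simp_all add: u_def[abs_def] z_def)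
qed

lemma sturm_solution_subset:
  assumes "sturm_solution P Q R a b u v" "a \<le> a'" "b' \<le> b"
  shows "sturm_solution P Q R a' b' u v"
  unfolding sturm_solution_def
proof (intro conjI ballI)
  show "C1_path a' b' u v"
    by (rule C1_path_subset[OF _ assms(2,3)]) (use assms(1) in \<open>simp add: sturm_solution_def\<close>)
  have sub: "{a'..b'} \<subseteq> {a..b}" using assms by auto
  fix t assume "t \<in> {a'..b'}"
  then have "t \<in> {a..b}" using sub by blast
  then have "((\<lambda>t. P t *v v t + Q t *v u t) has_vector_derivative
        transpose (Q t) *v v t + R t *v u t) (at t within {a..b})"
    using assms(1) unfolding sturm_solution_def by blast
  then show "((\<lambda>t. P t *v v t + Q t *v u t) has_vector_derivative
        transpose (Q t) *v v t + R t *v u t) (at t within {a'..b'})"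
    by (rule has_vector_derivative_within_subset[OF _ sub])
qed

text \<open>A solution of energy zero has vanishing velocity at both ends and a weakly differentiable
  velocity, so it belongs to the class on which the energy is strictly positive unless the
  path is zero.\<close>

lemma zero_energy_solution_trivial:
  fixes P Q R :: "real \<Rightarrow> real^'m^'m::finite"
  assumes co: "sturm_coefficients P Q R" and pd: "sturm_positive_definite h P Q R" and h: "h > 0"
    and sol: "sturm_solution P Q R 0 h u v" and zero: "energy P Q R 0 h u v = 0"
  shows "u 0 = 0" "v 0 = 0"
proof -
  have u: "C1_path 0 h u v" using sol by (simp add: sturm_solution_def)
  have ends: "v 0 = 0" "v h = 0"
    by (rule minimizer_natural_boundary_condition[OF co h _ _ _ sol zero],
        rule hermitian_coefficient_symmetric_at_ends[OF co pd h],
        rule hermitian_coefficient_symmetric_at_ends[OF co pd h],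
        erule energy_nonneg[OF co pd h])+
  then show "v 0 = 0" by simp
  have "0 < energy P Q R 0 h u v" if "\<exists>t\<in>{0..h}. u t \<noteq> 0"
    by (rule energy_pos_of_sturm_positive_definite[OF co pd h u _ ends that])
       (rule solution_velocity_has_weak_deriv[OF co pd h sol ends])
  moreover have "0 \<in> {0..h}" using h by simp
  ultimately show "u 0 = 0" using zero by (metis less_irrefl)
qed

text \<open>If the monodromy matrix multiplies \<open>a + i b\<close> by \<open>x + i y\<close>, it maps
  \<open>a\<close> and \<open>b\<close> to the rotated vectors on the left. A quadratic form
  summed over a pair is invariant under rotations of the pair.\<close>

lemma sum_of_rotated_forms:
  fixes Q :: "real^'m^'m::finite" and a b :: "real^('m + 'm)" and x y :: real
  defines "\<phi> \<equiv> \<lambda>z. (upper z - Q *v lower z) \<bullet> lower z"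
  assumes "x\<^sup>2 + y\<^sup>2 = 1"
  shows "\<phi> (x *\<^sub>R a - y *\<^sub>R b) + \<phi> (y *\<^sub>R a + x *\<^sub>R b) = \<phi> a + \<phi> b"
proof -
  note lin = upper_lower_bounded_linear[THEN bounded_linear.linear]
  have "\<phi> (x *\<^sub>R a - y *\<^sub>R b) + \<phi> (y *\<^sub>R a + x *\<^sub>R b) = (x\<^sup>2 + y\<^sup>2) * (\<phi> a + \<phi> b)"
    unfolding \<phi>_def
    by (simp add: linear_add[OF lin(1)] linear_add[OF lin(2)] linear_diff[OF lin(1)] linear_diff[OF lin(2)]
        linear_scale[OF lin(1)] linear_scale[OF lin(2)] matrix_vector_right_distrib
        matrix_vector_mult_diff_distrib matrix_vector_mult_scaleR inner_add_left inner_add_right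
        inner_diff_left inner_diff_right power2_eq_square algebra_simps)
  then show ?thesis by (simp add: assms(2))
qed

lemma complex_eigenvector_parts:
  fixes M :: "real^'k^'k::finite"
  assumes "cmat M *v z = \<omega> *s z"
  defines "a \<equiv> \<chi> i. Re (z $ i)" and "b \<equiv> \<chi> i. Im (z $ i)"
  shows "M *v a = Re \<omega> *\<^sub>R a - Im \<omega> *\<^sub>R b" "M *v b = Im \<omega> *\<^sub>R a + Re \<omega> *\<^sub>R b"
proof -
  have "(cmat M *v z) $ i = \<omega> * z $ i" for i using assms(1) by simp
  then have eq: "(\<Sum>j\<in>UNIV. complex_of_real (M $ i $ j) * z $ j) = \<omega> * z $ i" for i
    by (simp add: matrix_vector_mult_def)
  show "M *v a = Re \<omega> *\<^sub>R a - Im \<omega> *\<^sub>R b" "M *v b = Im \<omega> *\<^sub>R a + Re \<omega> *\<^sub>R b"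
    using arg_cong[OF eq, of Re] arg_cong[OF eq, of Im]
    by (simp_all add: vec_eq_iff matrix_vector_mult_def a_def b_def)
qed

text \<open>From here on only the symmetries of the coefficients matter, not the Lagrangian they come
  from. Both parts of the eigenvector start solutions, and \<open>\<phi>\<close> is the
  boundary term whose increment over \<open>[0,T]\<close> is the energy.\<close>

lemma hyperbolic_of_sturm_positive_definite:
  fixes P Q R :: "real \<Rightarrow> real^'m^'m::finite" and \<gamma> :: "real \<Rightarrow> real^('m + 'm)^('m + 'm)"
  assumes co: "sturm_coefficients P Q R"
    and sh: "shift_covariant d S P Q R" and refl: "reflection_covariant d N P Q R"
    and d: "d > 0" and n: "n \<ge> 1" and per: "Q (of_nat n * d) = Q 0"
    and pd: "sturm_positive_definite (d / 2) P Q R"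
    and fs: "fundamental_solution (of_nat n * d) (\<lambda>t. symp_J ** hamiltonian_B (P t) (Q t) (R t)) \<gamma>"
  shows "hyperbolic_monodromy (\<gamma> (of_nat n * d))"
  unfolding hyperbolic_monodromy_def complex_eigenvalue_def
proof (safe)
  fix \<omega> :: complex and z :: "complex^('m + 'm)"
  assume \<omega>: "norm \<omega> = 1" and z: "z \<noteq> 0" and eig: "cmat (\<gamma> (of_nat n * d)) *v z = \<omega> *s z"
  define T where "T = of_nat n * d"
  have h: "d / 2 > 0" using d by simp
  have "1 * d \<le> of_nat n * d" using d n by (intro mult_right_mono) auto
  then have T: "d / 2 \<le> T" "0 \<le> T" using d by (simp_all add: T_def)
  define \<phi> where "\<phi> w = (upper w - Q 0 *v lower w) \<bullet> lower w" for w :: "real^('m + 'm)"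
  have \<gamma>0: "\<gamma> 0 *v c = c" for c
    using fs by (simp add: fundamental_solution_def matrix_vector_mul_lid)
  have key: "0 \<le> \<phi> (\<gamma> T *v c) - \<phi> c" "\<phi> (\<gamma> T *v c) - \<phi> c = 0 \<Longrightarrow> c = 0" for c
  proof -
    obtain v where sol: "sturm_solution P Q R 0 T (\<lambda>t. lower (\<gamma> t *v c)) v"
      and mom: "\<And>t. P t *v v t + Q t *v lower (\<gamma> t *v c) = upper (\<gamma> t *v c)"
      using sturm_solution_of_fundamental_solution[OF co fs, of c] unfolding T_def by blast
    let ?u = "\<lambda>t. lower (\<gamma> t *v c)"
    have Pv: "P t *v v t = upper (\<gamma> t *v c) - Q t *v ?u t" for t
      using mom[of t] by (simp add: algebra_simps)
    have eT: "energy P Q R 0 T ?u v = \<phi> (\<gamma> T *v c) - \<phi> c"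
      unfolding energy_solution[OF sol T(2)] Pv \<gamma>0 \<phi>_def using per by (simp add: T_def)
    have path: "C1_path 0 (of_nat n * d) ?u v" using sol by (simp add: sturm_solution_def T_def)
    have le: "energy P Q R 0 (d / 2) ?u v \<le> energy P Q R 0 T ?u v"
      unfolding T_def
      by (rule energy_nonneg_fundamental_domain[OF co sh refl d _ path n]) (erule energy_nonneg[OF co pd h])
    have solh: "sturm_solution P Q R 0 (d / 2) ?u v"
      by (rule sturm_solution_subset[OF sol order_refl T(1)])
    have pos: "0 \<le> energy P Q R 0 (d / 2) ?u v"
      by (rule energy_nonneg[OF co pd h]) (use solh in \<open>simp add: sturm_solution_def\<close>)
    show "0 \<le> \<phi> (\<gamma> T *v c) - \<phi> c" using eT le pos by simp
    assume "\<phi> (\<gamma> T *v c) - \<phi> c = 0"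
    then have "energy P Q R 0 (d / 2) ?u v = 0" using eT le pos by simp
    from zero_energy_solution_trivial[OF co pd h solh this]
    have "lower c = 0" "v 0 = 0" unfolding \<gamma>0 .
    then show "c = 0"
      using mom[of 0] unfolding \<gamma>0 by (intro upper_lower_eq_0) simp_all
  qed
  define a where "a = (\<chi> i. Re (z $ i))"
  define b where "b = (\<chi> i. Im (z $ i))"
  note parts = complex_eigenvector_parts[OF eig, folded a_def b_def T_def]
  have "(Re \<omega>)\<^sup>2 + (Im \<omega>)\<^sup>2 = 1" using \<omega> by (simp add: cmod_power2[symmetric])
  then have "\<phi> (\<gamma> T *v a) + \<phi> (\<gamma> T *v b) = \<phi> a + \<phi> b"
    unfolding parts \<phi>_def by (rule sum_of_rotated_forms)
  then have "a = 0" "b = 0" using key[of a] key[of b] by linarith+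
  then have "z = 0" by (simp add: a_def b_def vec_eq_iff complex_eq_iff)
  with z show False by simp
qed

theorem corollary2:
  fixes T :: real and n :: nat
    and S N :: "real^'m^'m::finite"
    and L :: "'m lagrangian"
    and x :: "real \<Rightarrow> real^'m"
    and \<gamma> :: "real \<Rightarrow> real^('m + 'm)^('m + 'm)"
  assumes "T > 0" and "n \<ge> 1"
    and "dihedral_matrices n S N"
    and "C2_lagrangian L" and "legendre_convex L"
    and "lagrangian_symmetric T n S N L"
    and "critical_point L T x" and "equivariant T n S N x"
    and "sturm_positive_definite (T / (2 * real n)) (P_along L x) (Q_along L x) (R_along L x)"
    and "fundamental_solution T (linearized_system L x) \<gamma>"
  shows "hyperbolic_monodromy (\<gamma> T)"
proof -
  have per: "periodic_C1 T x" using assms(7) by (simp add: critical_point_def)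
  have T: "real n * (T / real n) = T" and h: "T / (2 * real n) = T / real n / 2"
    using assms(2) by simp_all
  have d: "T / real n > 0" using assms(1,2) by simp
  note sh = shift_covariant_along[OF assms(4,6) per assms(8)]
  have Q: "Q_along L x (real n * (T / real n)) = Q_along L x 0"
    using assms(3) by (intro shift_covariant_period[OF sh]) (simp add: dihedral_matrices_def)
  have "fundamental_solution (real n * (T / real n))
      (\<lambda>t. symp_J ** hamiltonian_B (P_along L x t) (Q_along L x t) (R_along L x t)) \<gamma>"
    using assms(10) unfolding T linearized_system_def[abs_def] .
  from hyperbolic_of_sturm_positive_definite[OF sturm_coefficients_along[OF assms(4,5) per] sh
      reflection_covariant_along[OF assms(4,6) per assms(8)] d assms(2) Q assms(9)[unfolded h] this]
  show ?thesis unfolding T .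
qed

end
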